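(* Let $\alpha$ be irrational with bounded partial quotients, with denominators of best rational approximations $(q_s)$. Let $f\in C^2(\mathbb{T}\setminus\{a_1,\dots,a_k\})$, $f>0$, $f\in L^1(\mathbb{T})$, have singularities of type $h$ at $\{a_1,\dots,a_k\}$ with constants $A_i,B_i\ge0$. Suppose the set of singularities is divided into $F=\{a_1,\dots,a_v\}$ and $E=\{a_{v+1},\dots,a_k\}$, with $E$ nonempty, such that: (i) $A_i^2+B_i^2>0$ for every $i\in\{v+1,\dots,k\}$; (ii) for every $i\in\{1,\dots,v\}$, $a_i$ is a singularity of $f$ of type $g_i$, where $g_i$ is a positive function in $C^2(\mathbb{T}\setminus\{0\})$, decreasing on $(0,1)$, with $g_i'$ increasing on $(0,1)$, such that $\lim_{x\to a_i^+}\left|\frac{f'(x)}{g_i'(x-a_i)}\right|$ and $\lim_{x\to a_i^-}\left|\frac{f'(x)}{g_i'(a_i-x)}\right|$ exist and are finite; $\lim_{x\to0^+}\frac{g_i(x)}{h(x)}=0$; and for every $s\in\mathbb{N}$ there exists $x_{i,s}\in(0,1)$ with $x_{i,s}>\frac{1}{q_sh(\frac1{2q_s})}$ such that $\lim_{s\to+\infty}\frac{g_i'(x_{i,s})}{h'(\frac1{2q_s})}=0$ and $\sum_{s}q_sx_{i,s}<+\infty$. Assume that $\{a_{v+1},\dots,a_k\}$ is badly approximable by $\alpha$ with some constant $C>1$, and that there exist constants $D_1,D_2>0$ such that for every $s\in\mathbb{N}$ $$D_2>\frac{-h'(\frac{1}{C^4q_s})}{q_sh(\frac1{2q_s})}>D_1\quad\text{and}\quad\frac{h(\frac1{2q_s})}{h(\frac1{2q_{s+1}})}>D_1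 .$$ Then the special flow $(T^f_t)_{t\in\mathbb{R}}$ above the rotation $R_\alpha$ and under $f$ has the SWR-property.
   Context: $\mathbb{T}=\mathbb{R}/\mathbb{Z}$, with Lebesgue (Haar) measure $\lambda$ and metric $\|x-y\|$ (distance to the nearest integer); functions on $\mathbb{T}\setminus\{0\}$ are identified with functions on $(0,1)$; $R_\alpha x=x+\alpha$. Denominators: $(q_s)_{s\ge0}$ is the unique increasing sequence of integers with $q_0=1$ and $\|q_s\alpha\|<\|k\alpha\|$ for every $1\le k<q_{s+1}$, $k\ne q_s$. Bounded partial quotients means: there is a constant $r_\alpha$ with $q_{n+1}<r_\alpha q_n$ for all $n$. Singularities of type $h$: $h$ is a positive function in $C^2(\mathbb{T}\setminus\{0\})$, decreasing on $(0,1)$, with $\lim_{x\to0^+}h(x)=+\infty$ and $h'$ increasing on $(0,1)$. A function $f\in C^2(\mathbb{T}\setminus\{a_1,\dots,a_k\})$ has singularities of type $h$ at $\{a_1,\dots,a_k\}$ if for each $i$, $\lim_{x\to a_i^+}\frac{f'(x)}{h'(x-a_i)}=A_i$ and $\lim_{x\to a_i^-}\frac{f'(x)}{h'(a_i-x)}=-B_i$ for some numbers $A_i,B_i\ge0$ (possibly zero). The same terminology is used at a single singularity and with other functions in place of $h$. Badly approximable: a finite set $\{b_1,\dots,b_m\}\subset\mathbb{T}$ is badly approximable by $\alpha$ (with constant $C>1$) if for every $x\in\mathbb{T}$ and every $s\in\mathbb{N}$ there is at most one $i_0\in\{0,\dots,q_s-1\}$ with $x+i_0\alpha\in\bigcup_{i=1}^m\left[b_i-\frac1{2Cq_s},b_i+\frac1{2Cq_s}\right]$.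 Special flow: let $T$ be an automorphism of $(X,\mathscr{B},\mu)$, and let $f>0$, $f\in L^1(X,\mu)$. The special flow $(T^f_t)$ above $T$ and under $f$ acts on $X^f=\{(x,s): x\in X,\ 0\le s<f(x)\}$ (equivalently on $X\times\mathbb{R}$ modulo $(x,s+f(x))\sim(Tx,s)$) by $T^f_t(x,s)=(T^nx,\,t+s-f^{(n)}(x))$, where $n\in\mathbb{Z}$ is the unique integer with $f^{(n)}(x)\le t+s<f^{(n+1)}(x)$. Here $f^{(n)}(x)=f(x)+\dots+f(T^{n-1}x)$ for $n>0$, $f^{(0)}=0$, and $f^{(n)}(x)=-(f(T^nx)+\dots+f(T^{-1}x))$ for $n<0$. It preserves the normalized restriction of $\mu\otimes$Lebesgue to $X^f$. If $(X,d)$ is a metric space, $X^f$ carries the metric $d^f((x,s),(x',s'))=d(x,x')+|s-s'|$. SWR-property: let $(T_t)_{t\in\mathbb{R}}$ be an ergodic flow on a standard Borel probability space $(X,\mathscr{B},\mu)$, with $X$ a metric space with metric $d$. Let $t_0>0$ and $P\subset\mathbb{R}\setminus\{0\}$ compact. The flow has the switchable $R(t_0,P)$-property if for every $\epsilon>0$ and $N\in\mathbb{N}$ there exist $\kappa=\kappa(\epsilon)>0$, $\delta=\delta(\epsilon,N)>0$ and $Z=Z(\epsilon,N)\in\mathscr{B}$ with $\mu(Z)>1-\epsilon$ such that for any $x,y\in Z$ with $d(x,y)<\delta$ and $x$ not in the orbit of $y$, there exist $M,L\in\mathbb{N}$ with $M,L>N$ and $L/M\ge\kappa$, and $p\in P$,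 such that $\frac1L|\{n\in[M,M+L]\cap\mathbb{Z}: d(T_{nt_0}(x),T_{nt_0+p}(y))<\epsilon\}|>1-\epsilon$ or $\frac1L|\{n\in[M,M+L]\cap\mathbb{Z}: d(T_{-nt_0}(x),T_{-nt_0+p}(y))<\epsilon\}|>1-\epsilon$. The flow has the SWR-property if for some compact $P\subset\mathbb{R}\setminus\{0\}$ the set of $t_0>0$ for which it has the switchable $R(t_0,P)$-property is uncountable. *)

theory Defs
  imports "HOL-Probability.Probability"
begin

text \<open>
  The circle \<open>\<real>/\<int>\<close> is represented by its fundamental domain \<open>[0,1)\<close>, and a function on the
  circle by a 1-periodic function on the reals. In this way derivatives and one-sided limits
  on the circle are those on the line, also at the base point \<open>0\<close>.
\<close>

definition circle_norm :: "real \<Rightarrow> real" where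
  "circle_norm x = \<bar>x - of_int (round x)\<bar>"

definition circle_dist :: "real \<Rightarrow> real \<Rightarrow> real" where
  "circle_dist x y = circle_norm (x - y)"

definition circle :: "real measure" where
  "circle = restrict_space lborel {0..<1}"

definition rotation :: "real \<Rightarrow> real \<Rightarrow> real" where
  "rotation \<alpha> x = frac (x + \<alpha>)"

definition best_denominators :: "real \<Rightarrow> (nat \<Rightarrow> nat) \<Rightarrow> bool" where
  "best_denominators \<alpha> q \<longleftrightarrow>
     strict_mono q \<and> q 0 = 1 \<and>
     (\<forall>s k. 1 \<le> k \<and> k < q (Suc s) \<and> k \<noteq> q s \<longrightarrow>
        circle_norm (real (q s) * \<alpha>) < circle_norm (real k * \<alpha>))"

text \<open>Stated for the sequence of denominators \<open>q\<close> of the rotation number.\<close>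

definition bounded_partial_quotients :: "(nat \<Rightarrow> nat) \<Rightarrow> bool" where
  "bounded_partial_quotients q \<longleftrightarrow> (\<exists>r::real. \<forall>n. real (q (Suc n)) < r * real (q n))"

text \<open>
  Membership of a point of the circle in the arc \<open>[b - \<rho>, b + \<rho>]\<close> is
  expressed as being at distance at most \<open>\<rho>\<close> from \<open>b\<close>.
\<close>

definition badly_approximable :: "real \<Rightarrow> (nat \<Rightarrow> nat) \<Rightarrow> real \<Rightarrow> real set \<Rightarrow> bool" where
  "badly_approximable \<alpha> q C B \<longleftrightarrow>
     finite B \<and> C > 1 \<and>
     (\<forall>x s. \<exists>\<^sub>\<le>\<^sub>1 i. i < q s \<and>
        (\<exists>b\<in>B. circle_dist (x + real i * \<alpha>) b \<le> 1 / (2 * C * real (q s))))"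

text \<open>Intended for open \<open>S\<close>.\<close>

definition C2_on :: "real set \<Rightarrow> (real \<Rightarrow> real) \<Rightarrow> bool" where
  "C2_on S f \<longleftrightarrow> f C1_differentiable_on S \<and> deriv f C1_differentiable_on S"

text \<open>
  Only the values of \<open>h\<close> on \<open>(0,1)\<close> matter. Monotonicity is understood in the weak sense.
\<close>

definition comparison_function :: "(real \<Rightarrow> real) \<Rightarrow> bool" where
  "comparison_function h \<longleftrightarrow>
     (\<forall>x\<in>{0<..<1}. h x > 0) \<and> C2_on {0<..<1} h \<and>
     antimono_on {0<..<1} h \<and> mono_on {0<..<1} (deriv h)"

text \<open>
  The first conjunct says that the quotients are defined near the singularity; without it,
  \<open>x / 0 = 0\<close> would make the limits trivially \<open>0\<close> for functions \<open>h\<close> constant near \<open>0\<close>.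
  It is automatic for a comparison function which is unbounded at \<open>0\<close>.
\<close>

definition singularity_of_type ::
  "(real \<Rightarrow> real) \<Rightarrow> real \<Rightarrow> (real \<Rightarrow> real) \<Rightarrow> real \<Rightarrow> real \<Rightarrow> bool" where
  "singularity_of_type f a h A B \<longleftrightarrow>
     (\<forall>\<^sub>F x in at_right 0. deriv h x \<noteq> 0) \<and> A \<ge> 0 \<and> B \<ge> 0 \<and>
     ((\<lambda>x. deriv f x / deriv h (x - a)) \<longlongrightarrow> A) (at_right a) \<and>
     ((\<lambda>x. deriv f x / deriv h (a - x)) \<longlongrightarrow> - B) (at_left a)"

definition standard_borel :: "'a measure \<Rightarrow> bool" where
  "standard_borel M \<longleftrightarrow>
     (\<exists>\<tau>. topspace \<tau> = space M \<and> completely_metrizable_space \<tau> \<and> second_countable \<tau> \<and>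
          sets M = sigma_sets (space M) {U. openin \<tau> U})"

definition measure_preserving_flow :: "'a measure \<Rightarrow> (real \<Rightarrow> 'a \<Rightarrow> 'a) \<Rightarrow> bool" where
  "measure_preserving_flow M T \<longleftrightarrow>
     (\<lambda>(t, x). T t x) \<in> borel \<Otimes>\<^sub>M M \<rightarrow>\<^sub>M M \<and>
     (\<forall>x\<in>space M. T 0 x = x) \<and>
     (\<forall>s t. \<forall>x\<in>space M. T (s + t) x = T s (T t x)) \<and>
     (\<forall>t. distr M M (T t) = M)"

definition ergodic_flow :: "'a measure \<Rightarrow> (real \<Rightarrow> 'a \<Rightarrow> 'a) \<Rightarrow> bool" where
  "ergodic_flow M T \<longleftrightarrow>
     measure_preserving_flow M T \<and>
     (\<forall>A\<in>sets M. (\<forall>t. T t -` A \<inter> space M = A) \<longrightarrow> measure M A = 0 \<or> measure M A = 1)"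

definition switchable_R ::
  "'a measure \<Rightarrow> ('a \<Rightarrow> 'a \<Rightarrow> real) \<Rightarrow> (real \<Rightarrow> 'a \<Rightarrow> 'a) \<Rightarrow> real \<Rightarrow> real set \<Rightarrow> bool" where
  "switchable_R M d T t\<^sub>0 P \<longleftrightarrow>
     (\<forall>\<epsilon>>0. \<exists>\<kappa>>0. \<forall>N::nat. \<exists>\<delta>>0. \<exists>Z\<in>sets M. measure M Z > 1 - \<epsilon> \<and>
        (\<forall>x\<in>Z. \<forall>y\<in>Z. d x y < \<delta> \<and> (\<nexists>t. x = T t y) \<longrightarrow>
           (\<exists>(K::nat) (L::nat). \<exists>p\<in>P. K > N \<and> L > N \<and> real L / real K \<ge> \<kappa> \<and>
              (real (card {n\<in>{K..K + L}.
                   d (T (real n * t\<^sub>0) x) (T (real n * t\<^sub>0 + p) y) < \<epsilon>}) / real L > 1 - \<epsilon> \<or>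
               real (card {n\<in>{K..K + L}.
                   d (T (- real n * t\<^sub>0) x) (T (- real n * t\<^sub>0 + p) y) < \<epsilon>}) / real L > 1 - \<epsilon>))))"

text \<open>
  The SWR-property is a property of ergodic flows on standard Borel probability spaces
  equipped with a metric; these requirements are part of the predicate.
\<close>

definition SWR_property ::
  "'a measure \<Rightarrow> ('a \<Rightarrow> 'a \<Rightarrow> real) \<Rightarrow> (real \<Rightarrow> 'a \<Rightarrow> 'a) \<Rightarrow> bool" where
  "SWR_property M d T \<longleftrightarrow>
     prob_space M \<and> standard_borel M \<and> Metric_space (space M) d \<and> ergodic_flow M T \<and>
     (\<exists>P. compact P \<and> 0 \<notin> P \<and> uncountable {t\<^sub>0. t\<^sub>0 > 0 \<and> switchable_R M d T t\<^sub>0 P})"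

definition int_iterate :: "'a measure \<Rightarrow> ('a \<Rightarrow> 'a) \<Rightarrow> int \<Rightarrow> 'a \<Rightarrow> 'a" where
  "int_iterate M T n =
     (if n \<ge> 0 then T ^^ nat n else inv_into (space M) T ^^ nat (- n))"

definition birkhoff_sum ::
  "'a measure \<Rightarrow> ('a \<Rightarrow> 'a) \<Rightarrow> ('a \<Rightarrow> real) \<Rightarrow> int \<Rightarrow> 'a \<Rightarrow> real" where
  "birkhoff_sum M T f n x =
     (if n \<ge> 0 then (\<Sum>i\<in>{0..<n}. f (int_iterate M T i x))
      else - (\<Sum>i\<in>{n..<0}. f (int_iterate M T i x)))"

definition special_flow_space :: "'a measure \<Rightarrow> ('a \<Rightarrow> real) \<Rightarrow> ('a \<times> real) set" where
  "special_flow_space M f = {(x, s). x \<in> space M \<and> 0 \<le> s \<and> s < f x}"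

definition special_flow_measure :: "'a measure \<Rightarrow> ('a \<Rightarrow> real) \<Rightarrow> ('a \<times> real) measure" where
  "special_flow_measure M f =
     uniform_measure (restrict_space (M \<Otimes>\<^sub>M lborel) (special_flow_space M f))
       (special_flow_space M f)"

definition special_flow ::
  "'a measure \<Rightarrow> ('a \<Rightarrow> 'a) \<Rightarrow> ('a \<Rightarrow> real) \<Rightarrow> real \<Rightarrow> 'a \<times> real \<Rightarrow> 'a \<times> real" where
  "special_flow M T f t = (\<lambda>(x, s).
     let n = (THE n. birkhoff_sum M T f n x \<le> t + s \<and> t + s < birkhoff_sum M T f (n + 1) x)
     in (int_iterate M T n x, t + s - birkhoff_sum M T f n x))"

definition special_flow_dist ::
  "('a \<Rightarrow> 'a \<Rightarrow> real) \<Rightarrow> 'a \<times> real \<Rightarrow> 'a \<times> real \<Rightarrow> real" where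
  "special_flow_dist d = (\<lambda>(x, s) (x', s'). d x x' + \<bar>s - s'\<bar>)"

end

theory Submission
  imports Defs
begin

text \<open>
  Write \<open>D n\<close> for the difference, at two base points \<open>x\<close> and \<open>y\<close>, of the \<open>n\<close>-th Birkhoff sums of
  the roof function \<open>f\<close> (\<open>drift\<close> below). If \<open>D\<close> stays close to a value \<open>p \<noteq> 0\<close> during a block of
  times, then there the flow orbits of the two points are close to each other up to the delay
  \<open>p\<close>. So one has to find such blocks whose length is a definite fraction of their distance
  from time zero.

  The scale is \<open>H s = q\<^sub>s h (1 / (2 q\<^sub>s))\<close>. A sum of \<open>h'\<close> over at most \<open>q\<^sub>s\<close> points of an orbit which
  all have distance at least of the order \<open>1 / q\<^sub>s\<close> from a singularity is of the order \<open>H s\<close>, because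
  the points are separated by \<open>1 / (2 q\<^sub>s)\<close> (\<open>orbit_deriv_sum\<close>). For \<open>x\<close> and \<open>y\<close> at distance about
  \<open>1 / H s\<close> the following happens within \<open>q\<^sub>s\<close> steps.

  \<^item> Since the strong singularities are badly approximable, the orbit of \<open>x\<close> comes closer to
    them than \<open>1 / (2 C q\<^sub>s)\<close> in at most one of the two directions of time
    (\<open>avoids_strong_switch\<close>). In the other direction the drift remains bounded (\<open>drift_le\<close>).
  \<^item> In that direction the orbit still comes, by density, as near as a constant times \<open>1 / q\<^sub>s\<close> to a
    strong singularity, on a side on which \<open>f'\<close> is comparable to \<open>h'\<close>. There the drift jumps by a
    definite amount (\<open>jump\<close>), hence it is not small either before or after the jump.
  \<^item> Bad approximability at a smaller scale \<open>r\<close>, with \<open>q\<^sub>r\<close> about \<open>\<kappa> q\<^sub>s\<close>, keeps the orbit away from the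
    strong singularities for \<open>q\<^sub>r\<close> steps on either side of the jump; during these the drift
    changes by at most a multiple of \<open>H r / H s\<close>, up to the contribution of the weak singularities. The hypothesis on \<open>h'\<close> makes \<open>h\<close> grow like a power, so that
    this quotient is \<open>o(\<kappa>)\<close> as \<open>\<kappa>\<close> tends to zero (\<open>decay\<close>, \<open>drift_window\<close>).

  The weak singularities contribute \<open>o(H s)\<close> as long as the orbit avoids their neighbourhoods of
  radius \<open>2 \<xi> i s\<close>; by the summability condition and the Borel-Cantelli lemma this is so
  for all large \<open>s\<close> and all points outside a set of small measure.

  Back in the flow, the delay keeps both points in the same lap, unless the first one is
  within \<open>2 \<rho> \<kappa>\<close> of the base or of the roof, where \<open>\<rho> \<kappa>\<close> bounds the variation of the drift. These times
  must be rare among the times \<open>n t\<^sub>0\<close> of a window which occupies about the fraction \<open>\<kappa>\<close> of its distance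
  from zero, so their frequency from time zero on has to be at most a small multiple of \<open>\<kappa>\<close>. By the
  maximal inequality (\<open>maximal_inequality\<close>) the set where this fails has measure of order
  \<open>\<rho> \<kappa> / \<kappa> = \<rho>\<close>, for every \<open>t\<^sub>0 > 0\<close>; this is where the gain \<open>o(\<kappa>)\<close> is used.

  The SWR-property also asserts that the special flow is an ergodic measure-preserving flow on a
  standard Borel space. The flow is piecewise a measure-preserving shear of the cylinder
  (\<open>emeasure_flow\<close>), and its ergodicity is that of the irrational rotation.
\<close>

section \<open>The circle and its rotations\<close>

lemma circle_norm_le: "circle_norm x \<le> \<bar>x - of_int k\<bar>"
  unfolding circle_norm_def by (rule round_diff_minimal)

lemma circle_norm_nonneg: "0 \<le> circle_norm x"
  by (simp add: circle_norm_def)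

lemma circle_norm_obtain:
  obtains k :: int where "circle_norm x = \<bar>x - of_int k\<bar>"
  unfolding circle_norm_def by blast

lemma circle_norm_le_half: "circle_norm x \<le> 1/2"
  unfolding circle_norm_def using of_int_round_abs_le[of x] by (simp add: abs_minus_commute)

lemma circle_norm_triangle: "circle_norm (x + y) \<le> circle_norm x + circle_norm y"
proof -
  obtain k where k: "circle_norm x = \<bar>x - of_int k\<bar>" by (rule circle_norm_obtain)
  obtain l where l: "circle_norm y = \<bar>y - of_int l\<bar>" by (rule circle_norm_obtain)
  have "circle_norm (x + y) \<le> \<bar>x + y - of_int (k + l)\<bar>" by (rule circle_norm_le)
  then show ?thesis using k l by simp
qed

lemma circle_norm_minus: "circle_norm (- x) = circle_norm x"
proof -
  have "circle_norm (- x) \<le> circle_norm x" for x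
  proof -
    obtain k where "circle_norm x = \<bar>x - of_int k\<bar>" by (rule circle_norm_obtain)
    with circle_norm_le[of "- x" "- k"] show ?thesis by simp
  qed
  from this[of x] this[of "- x"] show ?thesis by simp
qed

lemma circle_norm_minus_commute: "circle_norm (x - y) = circle_norm (y - x)"
  using circle_norm_minus[of "x - y"] by simp

lemma circle_norm_add_of_int [simp]: "circle_norm (x + of_int k) = circle_norm x"
proof -
  have le: "circle_norm (x + of_int k) \<le> circle_norm x" for x k
  proof -
    obtain l where "circle_norm x = \<bar>x - of_int l\<bar>" by (rule circle_norm_obtain)
    with circle_norm_le[of "x + of_int k" "l + k"] show ?thesis by simp
  qed
  from le[of x k] le[of "x + of_int k" "- k"] show ?thesis by simp
qed

lemma circle_norm_diff_of_int [simp]: "circle_norm (x - of_int k) = circle_norm x"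
  using circle_norm_add_of_int[of x "- k"] by simp

lemma circle_norm_cong: "x - y = of_int k \<Longrightarrow> circle_norm x = circle_norm y"
  using circle_norm_add_of_int[of y k] by (simp add: algebra_simps)

lemma circle_norm_eq_abs: "\<bar>x\<bar> \<le> 1/2 \<Longrightarrow> circle_norm x = \<bar>x\<bar>"
proof -
  assume x: "\<bar>x\<bar> \<le> 1/2"
  have "circle_norm x \<le> \<bar>x\<bar>" using circle_norm_le[of x 0] by simp
  moreover obtain k where k: "circle_norm x = \<bar>x - of_int k\<bar>" by (rule circle_norm_obtain)
  have "\<bar>x\<bar> \<le> \<bar>x - of_int k\<bar>"
  proof (cases "k = 0")
    case False
    then have "\<bar>real_of_int k\<bar> \<ge> 1" by linarith
    with x show ?thesis by linarith
  qed simp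
  ultimately show ?thesis using k by simp
qed

lemma circle_norm_triangle_diff: "circle_norm x \<le> circle_norm y + \<bar>x - y\<bar>"
  using circle_norm_triangle[of y "x - y"] circle_norm_le[of "x - y" 0] by simp

lemma frac_add_of_int: "frac (x + of_int k) = frac (x :: real)"
  by (simp add: frac_def)

lemma frac_frac_add: "frac (frac x + y) = frac (x + y :: real)"
proof -
  have "x + y = (frac x + y) + of_int \<lfloor>x\<rfloor>" by (simp add: frac_def)
  then show ?thesis by (metis frac_add_of_int)
qed

lemma circle_dist_frac [simp]: "circle_dist (frac x) (frac y) = circle_norm (x - y)"
proof -
  have "frac x - frac y - (x - y) = of_int (\<lfloor>y\<rfloor> - \<lfloor>x\<rfloor>)" unfolding frac_def by simp
  then show ?thesis unfolding circle_dist_def by (rule circle_norm_cong)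
qed

lemma circle_dist_eq_0_iff:
  assumes "x \<in> {0..<1}" "y \<in> {0..<1}"
  shows "circle_dist x y = 0 \<longleftrightarrow> x = y"
proof
  assume "circle_dist x y = 0"
  then obtain k :: int where "x - y = of_int k"
    unfolding circle_dist_def circle_norm_def by force
  with assms have "\<bar>real_of_int k\<bar> < 1" by auto
  then have "k = 0" by linarith
  with \<open>x - y = of_int k\<close> show "x = y" by simp
qed (simp add: circle_dist_def circle_norm_eq_abs)

lemma space_circle [simp]: "space circle = {0..<1}"
  by (simp add: circle_def)

lemma sets_circle: "A \<in> sets circle \<longleftrightarrow> A \<in> sets borel \<and> A \<subseteq> {0..<1}"
  by (auto simp: circle_def sets_restrict_space_iff)

lemma emeasure_circle: "A \<in> sets circle \<Longrightarrow> emeasure circle A = emeasure lborel A"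
  unfolding circle_def by (subst emeasure_restrict_space) (auto simp: sets_restrict_space_iff)

lemma prob_space_circle: "prob_space circle"
  by (rule prob_spaceI) (use emeasure_circle[of "{0..<1}"] in \<open>simp add: sets_circle\<close>)

lemma measurable_circle_borel:
  "g \<in> borel_measurable borel \<Longrightarrow> g \<in> borel_measurable circle"
  unfolding circle_def by (rule measurable_restrict_space1) simp

lemma measurable_frac [measurable]: "frac \<in> borel \<rightarrow>\<^sub>M (circle :: real measure)"
  unfolding circle_def
proof (rule measurable_restrict_space2)
  have "(\<lambda>x::real. x - of_int \<lfloor>x\<rfloor>) \<in> borel_measurable borel"
    by (intro borel_measurable_diff borel_measurable_real_floor measurable_ident_sets refl)
  then show "(frac :: real \<Rightarrow> real) \<in> borel \<rightarrow>\<^sub>M lborel"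
    by (simp only: frac_def[abs_def] measurable_lborel1)
qed (auto simp: frac_lt_1)

lemma measurable_rotation [measurable]: "(\<lambda>x. frac (x + \<beta>)) \<in> circle \<rightarrow>\<^sub>M circle"
proof (rule measurable_compose[OF _ measurable_frac])
  show "(\<lambda>x. x + \<beta>) \<in> borel_measurable circle"
    by (rule measurable_circle_borel) (intro borel_measurable_add measurable_ident_sets borel_measurable_const refl)
qed

lemma emeasure_lborel_vimage_add:
  assumes "B \<in> sets borel"
  shows "emeasure lborel ((\<lambda>x::real. x + c) -` B) = emeasure lborel B"
proof -
  have "emeasure lborel B = emeasure (distr lborel borel ((+) c)) B"
    by (simp add: lborel_distr_plus)
  also have "\<dots> = emeasure lborel ((+) c -` B)" using assms by (subst emeasure_distr) auto
  also have "(+) c = (\<lambda>x. x + c)" by auto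
  finally show ?thesis by simp
qed

text \<open>Rotating by \<open>\<beta>\<close> cuts the fundamental domain into two intervals and translates each.\<close>

lemma distr_circle_rotation: "distr circle circle (\<lambda>x. frac (x + \<beta>)) = circle"
proof (rule measure_eqI)
  fix A assume "A \<in> sets (distr circle circle (\<lambda>x. frac (x + \<beta>)))"
  then have A: "A \<in> sets borel" "A \<subseteq> {0..<1}" "A \<in> sets circle" by (auto simp: sets_circle)
  define b where "b = frac \<beta>"
  have b: "0 \<le> b" "b < 1" by (auto simp: b_def frac_lt_1)
  have [measurable]: "A \<in> sets borel" by (rule A)
  have fr: "frac (x + \<beta>) = (if x < 1 - b then x + b else x + b - 1)" if "x \<in> {0..<1}" for x
  proof -
    have "frac x = x" using that by (simp add: frac_eq)
    then show ?thesis using frac_add[of x \<beta>] by (auto simp: b_def)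
  qed
  let ?U = "(\<lambda>x. x + b) -` (A \<inter> {b..<1})" and ?V = "(\<lambda>x. x + (b - 1)) -` (A \<inter> {0..<b})"
  have "emeasure (distr circle circle (\<lambda>x. frac (x + \<beta>))) A
      = emeasure circle ((\<lambda>x. frac (x + \<beta>)) -` A \<inter> {0..<1})"
    using A(3) by (subst emeasure_distr) (auto)
  also have "(\<lambda>x. frac (x + \<beta>)) -` A \<inter> {0..<1} = ?U \<union> ?V"
  proof (intro set_eqI iffI)
    fix x assume "x \<in> (\<lambda>x. frac (x + \<beta>)) -` A \<inter> {0..<1}"
    then have x: "x \<in> {0..<1}" "frac (x + \<beta>) \<in> A" by auto
    with fr[OF x(1)] b show "x \<in> ?U \<union> ?V"
      by (cases "x < 1 - b") (simp_all add: add_diff_eq)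
  next
    fix x assume x: "x \<in> ?U \<union> ?V"
    then have x01: "x \<in> {0..<1}" using b by auto
    with x fr[OF x01] show "x \<in> (\<lambda>x. frac (x + \<beta>)) -` A \<inter> {0..<1}"
      by (auto simp: algebra_simps)
  qed
  also have "emeasure circle (?U \<union> ?V) = emeasure lborel (?U \<union> ?V)"
  proof (rule emeasure_circle)
    show "?U \<union> ?V \<in> sets circle" unfolding sets_circle
    proof
      show "?U \<union> ?V \<in> sets borel"
        by (intro sets.Un measurable_sets_borel[of _ borel]) auto
    qed (use b in auto)
  qed
  also have "\<dots> = emeasure lborel ?U + emeasure lborel ?V"
  proof (rule plus_emeasure[symmetric])
    show "?U \<in> sets lborel" "?V \<in> sets lborel"
      by (auto intro!: measurable_sets_borel[of _ borel])
  qed (use b in auto)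
  also have "\<dots> = emeasure lborel (A \<inter> {b..<1}) + emeasure lborel (A \<inter> {0..<b})"
    by (simp only: emeasure_lborel_vimage_add A sets.Int atLeastLessThan_borel)
  also have "\<dots> = emeasure lborel ((A \<inter> {b..<1}) \<union> (A \<inter> {0..<b}))"
    by (rule plus_emeasure) auto
  also have "(A \<inter> {b..<1}) \<union> (A \<inter> {0..<b}) = A" using A b by auto
  finally show "emeasure (distr circle circle (\<lambda>x. frac (x + \<beta>))) A = emeasure circle A"
    by (simp add: emeasure_circle[OF A(3)])
qed simp

text \<open>
  Ergodicity of an irrational rotation. If \<open>B\<close> is an invariant set, lifted to a periodic
  set on the line, then the measure of \<open>B \<inter> J\<close> does not change when the interval \<open>J\<close> is
  translated by the dense group of all \<open>n \<alpha> + m\<close>; by continuity it is invariant under all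
  translations, so \<open>B \<inter> -\<close> is a multiple \<open>c\<close> of Lebesgue measure. Evaluating at
  \<open>B\<close> gives \<open>c = c\<^sup>2\<close>.
\<close>

lemma irrational_rotation_ergodic:
  assumes irr: "\<alpha> \<notin> \<rat>" and B: "B \<in> sets circle"
    and inv: "\<And>x. x \<in> {0..<1} \<Longrightarrow> frac (x + \<alpha>) \<in> B \<longleftrightarrow> x \<in> B"
  shows "emeasure circle B = 0 \<or> emeasure circle B = 1"
proof -
  define L where "L = {y. frac y \<in> B}"
  have Bb[measurable]: "B \<in> sets borel" and Bs: "B \<subseteq> {0..<1}" using B by (auto simp: sets_circle)
  have Lb[measurable]: "L \<in> sets borel"
    unfolding L_def using measurable_sets[OF measurable_frac B] by (simp add: vimage_def)
  have L1: "y + \<alpha> \<in> L \<longleftrightarrow> y \<in> L" for y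
  proof -
    have "frac (frac y + \<alpha>) = frac (y + \<alpha>)" by (rule frac_frac_add)
    then show ?thesis using inv[of "frac y"] by (simp add: L_def frac_lt_1)
  qed
  have Lnat: "y + of_nat n * \<alpha> \<in> L \<longleftrightarrow> y \<in> L" for y n
  proof (induction n)
    case (Suc n)
    have "y + of_nat (Suc n) * \<alpha> = (y + of_nat n * \<alpha>) + \<alpha>" by (simp add: algebra_simps)
    then show ?case using L1 Suc by metis
  qed simp
  have Lint: "y + of_int k \<in> L \<longleftrightarrow> y \<in> L" for y k
    unfolding L_def by (simp add: frac_def)
  define F where "F a b = measure lborel (L \<inter> {a<..<b})" for a b
  have fin: "emeasure lborel (L \<inter> {a<..<b}) < \<infinity>" for a b
  proof -
    have "emeasure lborel (L \<inter> {a<..<b}) \<le> emeasure lborel {a<..<b}"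
      by (intro emeasure_mono) auto
    also have "\<dots> < \<infinity>" by (cases "a \<le> b") (auto)
    finally show ?thesis .
  qed
  have Fm: "emeasure lborel (L \<inter> {a<..<b}) = ennreal (F a b)" for a b
    unfolding F_def using fin[of a b] by (subst emeasure_eq_ennreal_measure) auto
  have F0: "0 \<le> F a b" for a b unfolding F_def by simp
  have shiftF: "F (a + t) (b + t) = F a b" if t: "\<And>y. y + t \<in> L \<longleftrightarrow> y \<in> L" for a b t
  proof -
    have "emeasure lborel (L \<inter> {a + t<..<b + t})
        = emeasure (distr lborel borel ((+) t)) (L \<inter> {a + t<..<b + t})"
      by (simp add: lborel_distr_plus)
    also have "\<dots> = emeasure lborel ((+) t -` (L \<inter> {a + t<..<b + t}))"
      by (subst emeasure_distr) auto
    also have "(+) t -` (L \<inter> {a + t<..<b + t}) = L \<inter> {a<..<b}"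
    proof -
      have "t + y \<in> L \<longleftrightarrow> y \<in> L" for y using t[of y] by (simp only: add.commute)
      then show ?thesis by (auto simp only: vimage_eq Int_iff greaterThanLessThan_iff)
    qed
    finally show ?thesis unfolding F_def measure_def by simp
  qed
  have split: "F a c = F a b + F b c" if "a \<le> b" "b \<le> c" for a b c
  proof -
    have "AE x in lborel. x \<noteq> b" by (rule AE_lborel_singleton)
    then have "emeasure lborel (L \<inter> {a<..<c}) = emeasure lborel (L \<inter> {a<..<b} \<union> L \<inter> {b<..<c})"
      by (intro emeasure_eq_AE) (use that in \<open>auto elim!: eventually_mono\<close>)
    also have "\<dots> = emeasure lborel (L \<inter> {a<..<b}) + emeasure lborel (L \<inter> {b<..<c})"
      by (rule plus_emeasure[symmetric]) auto
    finally have "ennreal (F a c) = ennreal (F a b + F b c)"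
      by (simp only: Fm ennreal_plus[OF F0 F0])
    then show ?thesis by (simp only: ennreal_inj[OF F0 add_nonneg_nonneg[OF F0 F0]])
  qed
  have Fle: "F a b \<le> b - a" if "a \<le> b" for a b
  proof -
    have "emeasure lborel (L \<inter> {a<..<b}) \<le> emeasure lborel {a<..<b}"
      by (intro emeasure_mono) auto
    then show ?thesis using that by (simp add: Fm)
  qed
  have trans: "F (a + t) (b + t) = F a b" if ab: "a \<le> b" for a b t
  proof (rule ccontr)
    assume ne: "F (a + t) (b + t) \<noteq> F a b"
    define e where "e = \<bar>F (a + t) (b + t) - F a b\<bar> / 3"
    have e: "e > 0" using ne by (simp add: e_def)
    obtain h k where hk: "\<bar>real_of_int k * \<alpha> - real_of_int h - t\<bar> < e" "k > 0"
      using sequence_of_fractional_parts_is_dense[OF irr e, of t] by (metis)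
    define u where "u = real_of_int k * \<alpha> - real_of_int h"
    have uL: "y + u \<in> L \<longleftrightarrow> y \<in> L" for y
      using Lnat[of "y + of_int (-h)" "nat k"] Lint[of y "-h"] hk(2) by (simp add: u_def algebra_simps)
    have d: "\<bar>F (a + t) (b + t) - F (a + u) (b + u)\<bar> \<le> 2 * \<bar>u - t\<bar>"
    proof -
      have *: "\<bar>F c d - F c' d'\<bar> \<le> \<bar>c - c'\<bar> + \<bar>d - d'\<bar>" if "c \<le> d" "c' \<le> d'" for c d c' d'
      proof -
        define lo where "lo = min c c'" define hi where "hi = max d d'"
        have le: "lo \<le> c" "lo \<le> c'" "d \<le> hi" "d' \<le> hi" by (auto simp: lo_def hi_def)
        have "F lo hi = F lo c + F c d + F d hi"
          using split[of lo c hi] split[of c d hi] le that by linarith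
        moreover have "F lo hi = F lo c' + F c' d' + F d' hi"
          using split[of lo c' hi] split[of c' d' hi] le that by linarith
        moreover have "F lo c \<le> c - lo" "F lo c' \<le> c' - lo" "F d hi \<le> hi - d" "F d' hi \<le> hi - d'"
          by (intro Fle; simp add: lo_def hi_def)+
        moreover note F0[of lo c] F0[of lo c'] F0[of d hi] F0[of d' hi]
        ultimately show ?thesis unfolding lo_def hi_def by (auto simp: min_def max_def abs_if split: if_splits)
      qed
      show ?thesis using *[of "a + t" "b + t" "a + u" "b + u"] ab by (simp add: abs_minus_commute)
    qed
    have "F (a + u) (b + u) = F a b" by (rule shiftF) (rule uL)
    with d have "3 * e \<le> 2 * \<bar>u - t\<bar>" by (simp add: e_def)
    also have "\<dots> < 2 * e" using hk(1) by (simp add: u_def)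
    finally show False using e by simp
  qed
  define c where "c = F 0 1"
  have lin: "F a b = c * (b - a)" if ab: "a \<le> b" for a b
  proof -
    define \<phi> where "\<phi> t = F 0 t" for t
    have add: "\<phi> (s + t) = \<phi> s + \<phi> t" if "0 \<le> s" "0 \<le> t" for s t
      using split[of 0 s "s + t"] trans[of 0 t s] that by (simp add: \<phi>_def add.commute)
    have nat: "\<phi> (of_nat n * t) = of_nat n * \<phi> t" if "0 \<le> t" for n t
    proof (induction n)
      case 0 then show ?case using Fle[of 0 0] F0[of 0 0] by (simp add: \<phi>_def)
    next
      case (Suc n) then show ?case using add[of "of_nat n * t" t] that by (simp add: algebra_simps)
    qed
    have \<phi>mono: "\<phi> s \<le> \<phi> t" if "0 \<le> s" "s \<le> t" for s t
      using add[of s "t - s"] F0[of 0 "t - s"] that by (simp add: \<phi>_def)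
    have c0: "0 \<le> c" by (simp add: c_def F0)
    have "\<phi> t = c * t" if t: "0 \<le> t" for t
    proof -
      \<comment> \<open>Monotonicity pinches \<open>\<phi>\<close> between integer multiples of \<open>\<phi> 1\<close>, with a bounded error;
        replacing \<open>t\<close> by \<open>n t\<close> removes the error.\<close>
      have bd: "\<bar>\<phi> t - c * t\<bar> \<le> c" if "0 \<le> t" for t
      proof -
        define n where "n = nat \<lfloor>t\<rfloor>"
        have n: "real n \<le> t" "t \<le> real n + 1" using that by (auto simp: n_def)
        have "real n * c \<le> \<phi> t" "\<phi> t \<le> (real n + 1) * c"
          using nat[of 1 n] nat[of 1 "Suc n"] \<phi>mono[of "real n" t] \<phi>mono[of t "real n + 1"] n that
          by (auto simp: \<phi>_def c_def algebra_simps)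
        moreover have "real n * c \<le> c * t" "c * t \<le> (real n + 1) * c"
          using n c0 by (auto intro!: mult_left_mono simp: mult.commute[of _ c])
        ultimately show ?thesis by (auto simp: algebra_simps abs_le_iff)
      qed
      show ?thesis
      proof (rule ccontr)
        assume "\<phi> t \<noteq> c * t"
        then have pos: "\<bar>\<phi> t - c * t\<bar> > 0" by simp
        obtain n :: nat where n: "c < real n * \<bar>\<phi> t - c * t\<bar>" using reals_Archimedean3[OF pos] by blast
        have "\<phi> (real n * t) - c * (real n * t) = real n * (\<phi> t - c * t)"
          using nat[OF t, of n] by (simp add: algebra_simps)
        then have "\<bar>\<phi> (real n * t) - c * (real n * t)\<bar> = real n * \<bar>\<phi> t - c * t\<bar>"
          by (simp add: abs_mult)
        with bd[of "real n * t"] t n show False by simp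
      qed
    qed
    then show ?thesis using trans[of 0 "b - a" a] ab by (simp add: \<phi>_def)
  qed
  have c0: "0 \<le> c" by (simp add: c_def F0)
  have LB: "L \<inter> B = B" using Bs by (auto simp: L_def frac_eq)
  have L01: "L \<inter> {0..<1} = B" using Bs by (auto simp: L_def frac_eq)
  have eB: "emeasure circle B = ennreal c"
  proof -
    have "AE x in lborel. x \<noteq> (0::real)" by (rule AE_lborel_singleton)
    then have "emeasure lborel B = emeasure lborel (L \<inter> {0<..<1})"
      unfolding L01[symmetric] by (intro emeasure_eq_AE) (auto elim!: eventually_mono)
    then show ?thesis by (simp add: emeasure_circle[OF B] Fm c_def)
  qed
  have "c = 0 \<or> c = 1"
  proof (cases "c = 0")
    case False
    with c0 have cpos: "c > 0" by simp
    define \<nu> where "\<nu> = density lborel (\<lambda>x. ennreal (1 / c) * indicator L x)"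
    have \<nu>: "emeasure \<nu> A = ennreal (1 / c) * emeasure lborel (L \<inter> A)" if [measurable]: "A \<in> sets borel" for A
      unfolding \<nu>_def
      by (subst emeasure_density)
         (auto simp: mult.assoc nn_integral_cmult indicator_inter_arith[symmetric])
    have "lborel = \<nu>"
    proof (rule lborel_eqI)
      fix l u :: real assume lu: "\<And>b. b \<in> Basis \<Longrightarrow> l \<bullet> b \<le> u \<bullet> b"
      then have "l \<le> u" by simp
      then show "emeasure \<nu> (box l u) = (\<Prod>b\<in>Basis. (u - l) \<bullet> b)"
        using cpos by (simp add: \<nu> Fm lin box_real flip: ennreal_mult')
    qed (simp add: \<nu>_def)
    then have "emeasure lborel B = ennreal (1 / c) * emeasure lborel (L \<inter> B)" using \<nu>[OF Bb] by simp
    then have "ennreal c = ennreal (1 / c) * ennreal c" using eB LB by (simp add: emeasure_circle[OF B])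
    then have "c = 1" using cpos by (simp flip: ennreal_mult')
    then show ?thesis ..
  qed simp
  with eB show ?thesis by auto
qed

section \<open>A maximal inequality\<close>

text \<open>
  \<open>max_sum T g N x\<close> is the largest of the sums \<open>g x + \<dots> + g (T\<^sup>n\<^sup>-\<^sup>1 x)\<close> with \<open>0 \<le> n \<le> N\<close>;
  this recursion for it is all that is used in the proof of the maximal inequality.
\<close>

primrec max_sum :: "('a \<Rightarrow> 'a) \<Rightarrow> ('a \<Rightarrow> real) \<Rightarrow> nat \<Rightarrow> 'a \<Rightarrow> real" where
  "max_sum T g 0 x = 0"
| "max_sum T g (Suc N) x = max 0 (g x + max_sum T g N (T x))"

lemma max_sum_nonneg: "0 \<le> max_sum T g N x"
  by (cases N) auto

lemma max_sum_mono_Suc: "max_sum T g N x \<le> max_sum T g (Suc N) x"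
proof (induction N arbitrary: x)
  case 0 then show ?case by simp
next
  case (Suc N)
  have "max_sum T g N (T x) \<le> max_sum T g (Suc N) (T x)" by (rule Suc)
  then show ?case by (simp only: max_sum.simps(2)[of T g _ x])
qed

lemma sum_le_max_sum: "n \<le> N \<Longrightarrow> (\<Sum>i<n. g ((T ^^ i) x)) \<le> max_sum T g N x"
proof (induction N arbitrary: x n)
  case (Suc N)
  show ?case
  proof (cases n)
    case 0 then show ?thesis using max_sum_nonneg[of T g "Suc N" x] by simp
  next
    case (Suc m)
    have "(\<Sum>i<n. g ((T ^^ i) x)) = g x + (\<Sum>i<m. g ((T ^^ i) (T x)))"
      unfolding Suc by (subst sum.lessThan_Suc_shift) (simp add: funpow_Suc_right del: funpow.simps)
    also have "\<dots> \<le> g x + max_sum T g N (T x)" using Suc.IH[of m "T x"] Suc.prems Suc by simp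
    finally show ?thesis by simp
  qed
qed simp

lemma integral_measure_preserving:
  fixes g :: "'a \<Rightarrow> real"
  assumes T: "T \<in> M \<rightarrow>\<^sub>M M" "distr M M T = M" and g: "integrable M g"
  shows "integrable M (\<lambda>x. g (T x))" "(\<integral>x. g (T x) \<partial>M) = (\<integral>x. g x \<partial>M)"
proof -
  have gm: "g \<in> borel_measurable M" using g by simp
  show "integrable M (\<lambda>x. g (T x))" using integrable_distr_eq[OF T(1) gm] g T(2) by simp
  show "(\<integral>x. g (T x) \<partial>M) = (\<integral>x. g x \<partial>M)" using integral_distr[OF T(1) gm] T(2) by simp
qed

lemma integrable_max_sum:
  assumes T: "T \<in> M \<rightarrow>\<^sub>M M" "distr M M T = M" and g: "integrable M g"
  shows "integrable M (max_sum T g N)"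
proof (induction N)
  case (Suc N)
  show ?case
    by (simp only: max_sum.simps(2)[abs_def])
      (intro integrable_max integrable_zero Bochner_Integration.integrable_add g
        integral_measure_preserving(1)[OF T Suc])
qed (simp add: max_sum.simps(1)[abs_def])

text \<open>
  Garsia's argument: where \<open>max_sum\<close> is positive, \<open>g\<close> equals the difference
  of \<open>max_sum\<close> at level \<open>N + 1\<close> and of \<open>max_sum \<circ> T\<close> at level \<open>N\<close>, and \<open>T\<close> preserves integrals.
\<close>

lemma maximal_ergodic_theorem:
  assumes T: "T \<in> M \<rightarrow>\<^sub>M M" "distr M M T = M" and g: "integrable M g"
  shows "0 \<le> (\<integral>x. indicator {x \<in> space M. max_sum T g N x > 0} x * g x \<partial>M)"
proof -
  note int = integrable_max_sum[OF T g]
  have [measurable]: "max_sum T g N \<in> borel_measurable M" for N using int[of N] by simp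
  show ?thesis
  proof (cases N)
    case (Suc n)
    let ?E = "{x \<in> space M. max_sum T g N x > 0}"
    have iT: "integrable M (\<lambda>x. max_sum T g n (T x))"
      by (rule integral_measure_preserving(1)[OF T int])
    have "0 \<le> (\<integral>x. max_sum T g N x \<partial>M) - (\<integral>x. max_sum T g n x \<partial>M)"
      using integral_mono[OF int int, of n N] max_sum_mono_Suc[of T g n]
      by (simp del: max_sum.simps add: Suc)
    also have "\<dots> = (\<integral>x. max_sum T g N x - max_sum T g n (T x) \<partial>M)"
      using integral_measure_preserving(2)[OF T int] int iT by simp
    also have "\<dots> \<le> (\<integral>x. indicator ?E x * g x \<partial>M)"
    proof (rule integral_mono)
      show "integrable M (\<lambda>x. indicator ?E x * g x)"
        using integrable_real_mult_indicator[OF _ g, of ?E] by (simp add: mult.commute)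
      fix x assume x: "x \<in> space M"
      show "max_sum T g N x - max_sum T g n (T x) \<le> indicator ?E x * g x"
        using x max_sum_nonneg[of T g n "T x"] max_sum_nonneg[of T g N x]
        by (auto simp: Suc indicator_def max_def)
    qed (intro Bochner_Integration.integrable_diff int iT)
    finally show ?thesis .
  qed simp
qed

text \<open>
  Apply the theorem to \<open>f - K\<close>: on the set where some average exceeds \<open>K\<close>, the integral of \<open>f\<close> is
  at least \<open>K\<close> times the measure of the set.
\<close>

lemma maximal_inequality:
  assumes "finite_measure M" and T: "T \<in> M \<rightarrow>\<^sub>M M" "distr M M T = M"
    and f: "integrable M f" and nonneg: "\<And>x. x \<in> space M \<Longrightarrow> 0 \<le> f x" and K: "K > 0"
  shows "{x \<in> space M. \<exists>n\<ge>1. (\<Sum>i<n. f ((T ^^ i) x)) > K * real n} \<in> sets M" (is "?B \<in> _")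
    and "measure M {x \<in> space M. \<exists>n\<ge>1. (\<Sum>i<n. f ((T ^^ i) x)) > K * real n} \<le> (\<integral>x. f x \<partial>M) / K"
proof -
  interpret finite_measure M by fact
  note T(1)[measurable]
  have [measurable]: "f \<in> borel_measurable M" using f by simp
  have Ti[measurable]: "(T ^^ i) \<in> M \<rightarrow>\<^sub>M M" for i
    by (rule measurable_compose_n[OF T(1)])
  show B: "?B \<in> sets M" by measurable
  define g where "g x = f x - K" for x
  have g: "integrable M g" unfolding g_def[abs_def] using f by simp
  have [measurable]: "g \<in> borel_measurable M" using g by simp
  have mx[measurable]: "max_sum T g N \<in> borel_measurable M" for N
    using integrable_max_sum[OF T g, of N] by simp
  define E where "E N = {x \<in> space M. max_sum T g N x > 0}" for N
  have E[measurable]: "E N \<in> sets M" for N unfolding E_def by measurable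
  have bound: "measure M (E N) \<le> (\<integral>x. f x \<partial>M) / K" for N
  proof -
    have if': "integrable M (\<lambda>x. indicator (E N) x * f x)"
      using integrable_real_mult_indicator[OF E f] by (simp add: mult.commute)
    have ik: "integrable M (\<lambda>x. indicator (E N) x * K)"
      using integrable_real_mult_indicator[OF E, of "\<lambda>_. K"] by (simp add: mult.commute)
    have "0 \<le> (\<integral>x. indicator (E N) x * g x \<partial>M)"
      unfolding E_def by (rule maximal_ergodic_theorem[OF T g])
    also have "(\<lambda>x. indicator (E N) x * g x) = (\<lambda>x. indicator (E N) x * f x - indicator (E N) x * K)"
      by (simp add: g_def fun_eq_iff algebra_simps)
    also have "(\<integral>x. indicator (E N) x * f x - indicator (E N) x * K \<partial>M)
        = (\<integral>x. indicator (E N) x * f x \<partial>M) - measure M (E N) * K"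
      using if' ik by simp
    also have "(\<integral>x. indicator (E N) x * f x \<partial>M) \<le> (\<integral>x. f x \<partial>M)"
      by (rule integral_mono[OF if' f]) (auto simp: indicator_def nonneg)
    finally show ?thesis using K by (simp add: field_simps)
  qed
  have "incseq E"
    unfolding incseq_Suc_iff E_def using max_sum_mono_Suc[of T g] by (auto intro: less_le_trans)
  then have "(\<lambda>N. measure M (E N)) \<longlonglongrightarrow> measure M (\<Union>N. E N)"
    by (intro finite_Lim_measure_incseq) auto
  then have lim: "measure M (\<Union>N. E N) \<le> (\<integral>x. f x \<partial>M) / K"
    by (rule LIMSEQ_le_const2) (use bound in auto)
  have "?B \<subseteq> (\<Union>N. E N)"
  proof
    fix x assume "x \<in> ?B"
    then obtain n where n: "x \<in> space M" "n \<ge> 1" "(\<Sum>i<n. f ((T ^^ i) x)) > K * real n" by auto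
    have "0 < (\<Sum>i<n. g ((T ^^ i) x))" using n(3) by (simp add: g_def sum_subtractf mult.commute)
    also have "\<dots> \<le> max_sum T g n x" by (rule sum_le_max_sum) simp
    finally show "x \<in> (\<Union>N. E N)" using n(1) by (auto simp: E_def)
  qed
  then have "measure M ?B \<le> measure M (\<Union>N. E N)" by (intro finite_measure_mono) auto
  with lim show "measure M ?B \<le> (\<integral>x. f x \<partial>M) / K" by simp
qed

section \<open>The special flow over a rotation\<close>

text \<open>
  Birkhoff sums of a periodic function along a rotation, for an arbitrary base point on the
  line; working on the line avoids the fractional parts of the rotation of the circle.
\<close>

definition roof_sum :: "real \<Rightarrow> (real \<Rightarrow> real) \<Rightarrow> int \<Rightarrow> real \<Rightarrow> real" where
  "roof_sum \<alpha> f n x =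
     (if n \<ge> 0 then (\<Sum>i\<in>{0..<n}. f (x + of_int i * \<alpha>))
      else - (\<Sum>i\<in>{n..<0}. f (x + of_int i * \<alpha>)))"

lemma roof_sum_0 [simp]: "roof_sum \<alpha> f 0 x = 0"
  by (simp add: roof_sum_def)

lemma roof_sum_Suc: "roof_sum \<alpha> f (n + 1) x = roof_sum \<alpha> f n x + f (x + of_int n * \<alpha>)"
proof (cases "n \<ge> 0")
  case True
  then have "{0..<n + 1} = insert n {0..<n}" by auto
  with True show ?thesis by (simp add: roof_sum_def)
next
  case False
  then have "{n..<0} = insert n {n + 1..<0}" by auto
  with False show ?thesis by (auto simp: roof_sum_def)
qed

lemma roof_sum_add: "roof_sum \<alpha> f (m + n) x = roof_sum \<alpha> f m x + roof_sum \<alpha> f n (x + of_int m * \<alpha>)"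
proof (induction n rule: int_induct[where k = 0])
  case (step1 n)
  show ?case
    using step1 roof_sum_Suc[of \<alpha> f "m + n" x] roof_sum_Suc[of \<alpha> f n "x + of_int m * \<alpha>"]
    by (simp add: algebra_simps)
next
  case (step2 n)
  show ?case
    using step2 roof_sum_Suc[of \<alpha> f "m + (n - 1)" x] roof_sum_Suc[of \<alpha> f "n - 1" "x + of_int m * \<alpha>"]
    by (simp add: algebra_simps)
qed simp

lemma roof_sum_minus: "roof_sum \<alpha> f (- n) x = - roof_sum \<alpha> f n (x - of_int n * \<alpha>)"
  using roof_sum_add[of \<alpha> f n "- n" "x - of_int n * \<alpha>"] by simp

lemma roof_sum_of_nat: "roof_sum \<alpha> f (int n) x = (\<Sum>i<n. f (x + real i * \<alpha>))"
proof (induction n)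
  case (Suc n)
  then show ?case using roof_sum_Suc[of \<alpha> f "int n" x] by (simp add: algebra_simps)
qed simp

lemma rotation_funpow:
  assumes "x \<in> {0..<1}"
  shows "(rotation \<alpha> ^^ n) x = frac (x + real n * \<alpha>)"
proof (induction n)
  case 0 then show ?case using assms by (simp add: frac_eq)
next
  case (Suc n)
  have "(rotation \<alpha> ^^ Suc n) x = frac (frac (x + real n * \<alpha>) + \<alpha>)"
    by (simp only: funpow.simps o_apply Suc) (simp only: rotation_def)
  then show ?case by (simp add: frac_frac_add algebra_simps del: funpow.simps)
qed

lemma inv_rotation:
  assumes "y \<in> {0..<1}"
  shows "inv_into (space circle) (rotation \<alpha>) y = rotation (- \<alpha>) y"
proof (rule inv_into_f_eq)
  show "inj_on (rotation \<alpha>) (space circle)"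
  proof (rule inj_on_inverseI)
    fix x assume "x \<in> space circle"
    then show "frac (rotation \<alpha> x - \<alpha>) = x"
      using frac_frac_add[of "x + \<alpha>" "- \<alpha>"] by (simp add: rotation_def frac_eq)
  qed
  show "rotation (- \<alpha>) y \<in> space circle" by (simp add: rotation_def frac_lt_1)
  show "rotation \<alpha> (rotation (- \<alpha>) y) = y"
    using assms frac_frac_add[of "y - \<alpha>" \<alpha>] by (simp add: rotation_def frac_eq)
qed

lemma int_iterate_rotation:
  assumes x: "x \<in> {0..<1}"
  shows "int_iterate circle (rotation \<alpha>) n x = frac (x + of_int n * \<alpha>)"
proof (cases "n \<ge> 0")
  case True
  then show ?thesis using rotation_funpow[OF x, where \<alpha> = \<alpha> and n = "nat n"] by (simp add: int_iterate_def)
next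
  case False
  have "(inv_into (space circle) (rotation \<alpha>) ^^ m) x = (rotation (- \<alpha>) ^^ m) x" for m
  proof (induction m)
    case (Suc m)
    have "(rotation (- \<alpha>) ^^ m) x \<in> {0..<1}" by (simp add: rotation_funpow[OF x] frac_lt_1)
    then show ?case using Suc inv_rotation by simp
  qed simp
  with False show ?thesis
    using rotation_funpow[OF x, where \<alpha> = "- \<alpha>" and n = "nat (- n)"] by (simp add: int_iterate_def)
qed

lemma periodic_add_of_int:
  fixes f :: "real \<Rightarrow> 'a"
  assumes "\<And>y. f (y + 1) = f y"
  shows "f (y + of_int m) = f y"
proof (induction m rule: int_induct[where k = 0])
  case (step1 m) then show ?case using assms[of "y + of_int m"] by (simp add: add.assoc)
next
  case (step2 m) then show ?case using assms[of "y + of_int (m - 1)"] by (simp add: add.assoc)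
qed simp

lemma second_countable_euclidean_plane: "second_countable (euclidean :: (real \<times> real) topology)"
proof -
  obtain \<B> :: "(real \<times> real) set set" where "countable \<B>" "\<And>C. C \<in> \<B> \<Longrightarrow> open C"
    "\<And>U. open U \<Longrightarrow> \<exists>\<U>\<subseteq>\<B>. U = \<Union>\<U>"
    using univ_second_countable by blast
  then show ?thesis unfolding second_countable_def by (intro exI[of _ \<B>]) (fastforce simp: subset_iff)
qed

text \<open>
  Linear growth of the sums, uniformly in the base point, excludes that infinitely many laps
  are run in finite time, for every single point and not only for almost all of them.
\<close>

locale rotation_roof =
  fixes \<alpha> :: real and f :: "real \<Rightarrow> real"
  assumes irrational: "\<alpha> \<notin> \<rat>"
    and periodic: "\<And>y. f (y + 1) = f y"
    and pos: "\<And>y. f y > 0"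
    and integrable: "integrable circle f"
    and linear_growth: "\<exists>c>0. \<exists>N. \<forall>n\<ge>N. \<forall>x. c * real n \<le> roof_sum \<alpha> f (int n) x"
begin

abbreviation S :: "int \<Rightarrow> real \<Rightarrow> real" where "S \<equiv> roof_sum \<alpha> f"

abbreviation flow :: "real \<Rightarrow> real \<times> real \<Rightarrow> real \<times> real" where
  "flow \<equiv> special_flow circle (rotation \<alpha>) f"

abbreviation X :: "(real \<times> real) set" where "X \<equiv> special_flow_space circle f"

abbreviation \<mu> :: "(real \<times> real) measure" where "\<mu> \<equiv> special_flow_measure circle f"

abbreviation P :: "(real \<times> real) measure" where "P \<equiv> circle \<Otimes>\<^sub>M lborel"

lemma f_add_of_int [simp]: "f (y + of_int k) = f y"
  by (rule periodic_add_of_int[of f, OF periodic])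

lemma f_frac [simp]: "f (frac y) = f y"
  using f_add_of_int[of "frac y" "\<lfloor>y\<rfloor>"] by (simp add: frac_def)

lemma S_add_of_int [simp]: "S n (x + of_int k) = S n x"
proof -
  have "f (x + of_int k + of_int i * \<alpha>) = f (x + of_int i * \<alpha>)" for i
    using f_add_of_int[of "x + of_int i * \<alpha>" k] by (simp add: algebra_simps)
  then show ?thesis by (simp add: roof_sum_def)
qed

lemma S_frac_add [simp]: "S n (frac y) = S n y"
  using S_add_of_int[of n "frac y" "\<lfloor>y\<rfloor>"] by (simp add: frac_def)

lemma birkhoff_sum_eq: "x \<in> {0..<1} \<Longrightarrow> birkhoff_sum circle (rotation \<alpha>) f n x = S n x"
  by (simp add: birkhoff_sum_def roof_sum_def int_iterate_rotation)

lemma S_less: "m < n \<Longrightarrow> S m x < S n x"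
proof (induction n rule: int_gr_induct)
  case base then show ?case using roof_sum_Suc[of \<alpha> f m x] pos by simp
next
  case (step n) then show ?case using roof_sum_Suc[of \<alpha> f n x] pos[of "x + of_int n * \<alpha>"] by simp
qed

lemma S_less_iff [simp]: "S m x < S n x \<longleftrightarrow> m < n"
  using S_less[of m n x] S_less[of n m x] by (cases m n rule: linorder_cases) auto

lemma S_unique: "S m x \<le> u \<Longrightarrow> u < S (m + 1) x \<Longrightarrow> S n x \<le> u \<Longrightarrow> u < S (n + 1) x \<Longrightarrow> m = n"
  using S_less_iff[of m x "n + 1"] S_less_iff[of n x "m + 1"] by (simp del: S_less_iff)

lemma S_exists: "\<exists>n. S n x \<le> u \<and> u < S (n + 1) x"
proof -
  obtain c N where c: "c > 0" "\<And>n x. n \<ge> N \<Longrightarrow> c * real n \<le> S (int n) x"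
    using linear_growth by blast
  obtain k :: nat where k: "\<bar>u\<bar> < real k * c" using reals_Archimedean3[OF c(1)] by blast
  define m where "m = max k N"
  have m: "\<bar>u\<bar> < c * real m"
  proof -
    have "real k * c \<le> real m * c" using c(1) by (intro mult_right_mono) (auto simp: m_def)
    with k show ?thesis by (simp add: mult.commute)
  qed
  have up: "u < S (int m) y" for y using c(2)[of m y] m by (simp add: m_def)
  have lo: "S (- int m) x < u"
    using c(2)[of m "x - real m * \<alpha>"] m by (simp add: roof_sum_minus m_def)
  have ex: "u < S (- int m + int (2 * m)) x" using up[of x] by simp
  define j where "j = (LEAST j. u < S (- int m + int j) x)"
  have j: "u < S (- int m + int j) x" unfolding j_def by (rule LeastI[where P = "\<lambda>j. u < S (- int m + int j) x", OF ex])
  have "j \<noteq> 0" using j lo by (cases j) auto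
  then obtain i where i: "j = Suc i" by (cases j) auto
  have "\<not> u < S (- int m + int i) x"
    using not_less_Least[of i "\<lambda>j. u < S (- int m + int j) x"] i by (simp add: j_def)
  then have "S (- int m + int i) x \<le> u" by simp
  moreover have "u < S (- int m + int i + 1) x" using j by (simp add: i algebra_simps)
  ultimately show ?thesis by blast
qed

text \<open>The number of times the flow has crossed the roof when the height \<open>u\<close> above \<open>x\<close> is unrolled.\<close>

definition lap :: "real \<Rightarrow> real \<Rightarrow> int" where
  "lap x u = (THE n. S n x \<le> u \<and> u < S (n + 1) x)"

lemma lap_eqI: "S n x \<le> u \<Longrightarrow> u < S (n + 1) x \<Longrightarrow> lap x u = n"
  unfolding lap_def using S_unique by (intro the_equality) blast+

lemma lap: "S (lap x u) x \<le> u" "u < S (lap x u + 1) x"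
  using S_exists[of x u] lap_eqI by auto

lemma lap_eq_iff: "lap x u = n \<longleftrightarrow> S n x \<le> u \<and> u < S (n + 1) x"
  using lap lap_eqI by auto

lemma mem_X: "(x, s) \<in> X \<longleftrightarrow> 0 \<le> x \<and> x < 1 \<and> 0 \<le> s \<and> s < f x"
  by (auto simp: special_flow_space_def)

lemma flow_eq:
  assumes "x \<in> {0..<1}"
  shows "flow t (x, s) = (frac (x + of_int (lap x (t + s)) * \<alpha>), t + s - S (lap x (t + s)) x)"
  unfolding special_flow_def lap_def using assms
  by (simp add: birkhoff_sum_eq int_iterate_rotation Let_def)

lemma flow_eqI:
  assumes "x \<in> {0..<1}" "S n x \<le> t + s" "t + s < S (n + 1) x"
  shows "flow t (x, s) = (frac (x + of_int n * \<alpha>), t + s - S n x)"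
  using flow_eq[OF assms(1), of t s] lap_eqI[OF assms(2,3)] by simp

lemma flow_in_X: "p \<in> X \<Longrightarrow> flow t p \<in> X"
proof (cases p)
  case (Pair x s)
  assume "p \<in> X"
  then have x: "x \<in> {0..<1}" by (auto simp: Pair mem_X)
  show ?thesis
    using lap[where x = x and u = "t + s"] roof_sum_Suc[of \<alpha> f "lap x (t + s)" x]
    by (simp add: Pair flow_eq[OF x] mem_X frac_lt_1)
qed

lemma flow_0: "p \<in> X \<Longrightarrow> flow 0 p = p"
proof (cases p)
  case (Pair x s)
  assume "p \<in> X"
  then have x: "x \<in> {0..<1}" "0 \<le> s" "s < f x" by (auto simp: Pair mem_X)
  then show ?thesis
    using flow_eqI[OF x(1), of 0 0 s] roof_sum_Suc[of \<alpha> f 0 x] by (simp add: Pair frac_eq)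
qed

lemma flow_add: "p \<in> X \<Longrightarrow> flow (t + t') p = flow t (flow t' p)"
proof (cases p)
  case (Pair x s)
  assume "p \<in> X"
  then have x: "x \<in> {0..<1}" by (auto simp: Pair mem_X)
  define m where "m = lap x (t' + s)"
  define y where "y = x + of_int m * \<alpha>"
  define s' where "s' = t' + s - S m x"
  define n where "n = lap y (t + s')"
  have 1: "flow t' (x, s) = (frac y, s')" by (simp add: flow_eq[OF x] m_def y_def s'_def)
  have n: "S n y \<le> t + s'" "t + s' < S (n + 1) y" using lap[where x = y and u = "t + s'"] by (auto simp: n_def)
  have 2: "flow t (frac y, s') = (frac (frac y + of_int n * \<alpha>), t + s' - S n y)"
    using n flow_eqI[of "frac y" n t s'] by (simp add: frac_lt_1)
  have c: "S (m + n) x = S m x + S n y" "S (m + n + 1) x = S m x + S (n + 1) y"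
    using roof_sum_add[of \<alpha> f m n x] roof_sum_add[of \<alpha> f m "n + 1" x] by (auto simp: y_def add.assoc)
  have "flow (t + t') (x, s) = (frac (x + of_int (m + n) * \<alpha>), t + t' + s - S (m + n) x)"
    by (rule flow_eqI[OF x]) (use n c in \<open>auto simp: s'_def\<close>)
  then show ?thesis
    unfolding Pair 1 2 by (simp add: c frac_frac_add s'_def y_def algebra_simps)
qed

lemma f_measurable [measurable]: "f \<in> borel_measurable borel"
proof -
  have "f \<in> borel_measurable circle" using integrable by simp
  then have "(\<lambda>y. f (frac y)) \<in> borel_measurable borel"
    by (rule measurable_compose[OF measurable_frac])
  then show ?thesis by simp
qed

lemma S_measurable [measurable]: "S n \<in> borel_measurable borel"
  unfolding roof_sum_def[abs_def] by measurable

lemma fst_P_measurable [measurable]: "fst \<in> borel_measurable P"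
  by (rule measurable_compose[OF measurable_fst measurable_circle_borel]) simp

lemma snd_P_measurable [measurable]: "snd \<in> borel_measurable P"
  using measurable_snd[of circle lborel] by simp

lemma X_eq: "X = {p \<in> space P. 0 \<le> snd p \<and> snd p < f (fst p)}"
  by (auto simp: special_flow_space_def space_pair_measure)

lemma X_sets [measurable]: "X \<in> sets P"
  unfolding X_eq by measurable

lemma sets_\<mu>_cong: "sets \<mu> = sets (restrict_space P X)"
  unfolding special_flow_measure_def by simp

lemma sets_\<mu>: "A \<in> sets \<mu> \<longleftrightarrow> A \<in> sets P \<and> A \<subseteq> X"
  unfolding sets_\<mu>_cong by (subst sets_restrict_space_iff) (rule sets.Int[OF X_sets sets.top], rule conj_commute)

lemma X_sets_\<mu>: "X \<in> sets \<mu>"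
  by (simp only: sets_\<mu> X_sets subset_refl)

lemma space_\<mu> [simp]: "space \<mu> = X"
  unfolding special_flow_measure_def using sets.sets_into_space[OF X_sets]
  by (auto simp: space_restrict_space)

lemma emeasure_P: "A \<in> sets P \<Longrightarrow> emeasure P A = (\<integral>\<^sup>+x. emeasure lborel (Pair x -` A) \<partial>circle)"
  by (rule lborel.emeasure_pair_measure_alt)

definition area :: real where "area = (\<integral>x. f x \<partial>circle)"

lemma emeasure_X: "emeasure P X = ennreal area"
proof -
  have "emeasure P X = (\<integral>\<^sup>+x. ennreal (f x) \<partial>circle)"
    unfolding emeasure_P[OF X_sets]
  proof (rule nn_integral_cong)
    fix x assume "x \<in> space circle"
    then have "Pair x -` X = {0..<f x}" by (auto simp: special_flow_space_def)
    then show "emeasure lborel (Pair x -` X) = ennreal (f x)" using pos[of x] by simp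
  qed
  also have "\<dots> = ennreal area"
    unfolding area_def by (rule nn_integral_eq_integral[OF integrable]) (auto simp: pos less_imp_le)
  finally show ?thesis .
qed

lemma area_pos: "area > 0"
proof (rule ccontr)
  assume "\<not> area > 0"
  moreover have "area \<ge> 0" unfolding area_def by (rule Bochner_Integration.integral_nonneg) (simp add: pos less_imp_le)
  ultimately have "(\<integral>x. f x \<partial>circle) = 0" by (simp add: area_def)
  then have "AE x in circle. f x = 0"
    using integral_nonneg_eq_0_iff_AE[OF integrable] pos by (simp add: less_imp_le)
  then have "AE x in circle. False" by (rule AE_mp) (use pos in \<open>auto simp: less_le\<close>)
  then show False using prob_space.AE_False[OF prob_space_circle] by simp
qed

lemma emeasure_\<mu>: "A \<in> sets \<mu> \<Longrightarrow> emeasure \<mu> A = emeasure P A / ennreal area"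
proof -
  assume A: "A \<in> sets \<mu>"
  then have AX: "A \<in> sets (restrict_space P X)" "A \<subseteq> X" "X \<in> sets (restrict_space P X)"
    using sets_\<mu>[of A] X_sets_\<mu> by (auto simp only: sets_\<mu>_cong)
  have e: "emeasure (restrict_space P X) B = emeasure P B" if "B \<subseteq> X" for B
    using that X_sets by (intro emeasure_restrict_space sets.Int sets.top)
  show ?thesis
    unfolding special_flow_measure_def
    using AX by (simp add: e emeasure_X Int_absorb1)
qed

lemma prob_space_\<mu>: "prob_space \<mu>"
proof
  show "emeasure \<mu> (space \<mu>) = 1"
    using area_pos by (simp add: emeasure_\<mu>[OF X_sets_\<mu>] emeasure_X divide_ennreal)
qed

section \<open>Invariance of the measure and ergodicity\<close>

text \<open>
  On the part of the phase space where it has crossed the roof \<open>n\<close> times, the time-\<open>t\<close> map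
  of the flow agrees with a shear of the whole cylinder which preserves the product measure.
\<close>

definition shear :: "int \<Rightarrow> real \<Rightarrow> real \<times> real \<Rightarrow> real \<times> real" where
  "shear n t p = (frac (fst p + of_int n * \<alpha>), t + snd p - S n (fst p))"

lemma shear_measurable:
  assumes [measurable]: "a \<in> borel_measurable Q" "b \<in> borel_measurable Q" "t \<in> borel_measurable Q"
  shows "(\<lambda>\<omega>. shear n (t \<omega>) (a \<omega>, b \<omega>)) \<in> Q \<rightarrow>\<^sub>M P"
  unfolding shear_def fst_conv snd_conv
proof (rule measurable_Pair)
  show "(\<lambda>\<omega>. frac (a \<omega> + of_int n * \<alpha>)) \<in> Q \<rightarrow>\<^sub>M circle"
    by (rule measurable_compose[OF _ measurable_frac]) measurable
  show "(\<lambda>\<omega>. t \<omega> + b \<omega> - S n (a \<omega>)) \<in> Q \<rightarrow>\<^sub>M lborel"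
    unfolding measurable_lborel1 by measurable
qed

lemma shear_measurable' [measurable]: "shear n t \<in> P \<rightarrow>\<^sub>M P"
  using shear_measurable[of fst P snd "\<lambda>_. t" n] by simp

lemma emeasure_shear:
  assumes A: "A \<in> sets P"
  shows "emeasure P (shear n t -` A \<inter> space P) = emeasure P A"
proof -
  define g where "g z = emeasure lborel (Pair z -` A)" for z
  have g: "g \<in> borel_measurable circle"
    unfolding g_def using lborel.measurable_emeasure_Pair[OF A] .
  have "emeasure P (shear n t -` A \<inter> space P) = (\<integral>\<^sup>+x. g (frac (x + of_int n * \<alpha>)) \<partial>circle)"
    unfolding emeasure_P[OF measurable_sets[OF shear_measurable' A]]
  proof (rule nn_integral_cong)
    fix x assume x: "x \<in> space circle"
    have "Pair x -` (shear n t -` A \<inter> space P)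
        = (\<lambda>s. s + (t - S n x)) -` (Pair (frac (x + of_int n * \<alpha>)) -` A)"
      using x by (auto simp: shear_def space_pair_measure algebra_simps)
    moreover have "Pair (frac (x + of_int n * \<alpha>)) -` A \<in> sets borel"
      using sets_Pair1[OF A] by simp
    ultimately show "emeasure lborel (Pair x -` (shear n t -` A \<inter> space P)) = g (frac (x + of_int n * \<alpha>))"
      unfolding g_def by (simp only: emeasure_lborel_vimage_add)
  qed
  also have "\<dots> = (\<integral>\<^sup>+z. g z \<partial>distr circle circle (\<lambda>x. frac (x + of_int n * \<alpha>)))"
    by (rule nn_integral_distr[symmetric, OF measurable_rotation]) (use g in simp)
  also have "\<dots> = emeasure P A"
    unfolding distr_circle_rotation g_def emeasure_P[OF A] ..
  finally show ?thesis .
qed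

lemma flow_eq_shear: "p \<in> X \<Longrightarrow> flow t p = shear (lap (fst p) (t + snd p)) t p"
  by (cases p) (simp add: mem_X flow_eq shear_def)

lemma \<mu>_measurable_P: "(\<lambda>p. p) \<in> \<mu> \<rightarrow>\<^sub>M P"
  unfolding measurable_cong_sets[OF sets_\<mu>_cong refl]
  by (rule measurable_restrict_space1) simp

lemma lap_measurable:
  assumes [measurable]: "a \<in> borel_measurable Q" "b \<in> borel_measurable Q"
  shows "(\<lambda>\<omega>. lap (a \<omega>) (b \<omega>)) \<in> Q \<rightarrow>\<^sub>M count_space UNIV"
proof -
  have "(\<lambda>\<omega>. lap (a \<omega>) (b \<omega>)) -` {n} \<inter> space Q
      = {\<omega> \<in> space Q. S n (a \<omega>) \<le> b \<omega> \<and> b \<omega> < S (n + 1) (a \<omega>)}" for n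
    by (auto simp: lap_eq_iff lap)
  then show ?thesis by (subst measurable_count_space_eq2_countable) auto
qed

lemma flow_measurable: "(\<lambda>(t, p). flow t p) \<in> borel \<Otimes>\<^sub>M \<mu> \<rightarrow>\<^sub>M \<mu>"
proof -
  let ?Q = "borel \<Otimes>\<^sub>M \<mu> :: (real \<times> real \<times> real) measure"
  let ?x = "\<lambda>\<omega>::real \<times> real \<times> real. fst (snd \<omega>)" and ?s = "\<lambda>\<omega>::real \<times> real \<times> real. snd (snd \<omega>)"
  have sP: "snd \<in> ?Q \<rightarrow>\<^sub>M P" using measurable_compose[OF measurable_snd \<mu>_measurable_P] .
  have m[measurable]: "fst \<in> borel_measurable ?Q" "?x \<in> borel_measurable ?Q" "?s \<in> borel_measurable ?Q"
    using measurable_compose[OF sP fst_P_measurable] measurable_compose[OF sP snd_P_measurable] by auto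
  let ?L = "\<lambda>\<omega>. lap (?x \<omega>) (fst \<omega> + ?s \<omega>)"
  have L: "?L \<in> ?Q \<rightarrow>\<^sub>M count_space UNIV" by (rule lap_measurable) measurable
  have "(\<lambda>\<omega>. shear (?L \<omega>) (fst \<omega>) (?x \<omega>, ?s \<omega>)) \<in> ?Q \<rightarrow>\<^sub>M P"
    by (rule measurable_compose_countable[OF shear_measurable L]) measurable
  moreover have eq: "flow (fst \<omega>) (snd \<omega>) = shear (?L \<omega>) (fst \<omega>) (?x \<omega>, ?s \<omega>)"
    if "\<omega> \<in> space ?Q" for \<omega>
    using that by (simp add: space_pair_measure flow_eq_shear mem_Times_iff)
  ultimately have "(\<lambda>\<omega>. flow (fst \<omega>) (snd \<omega>)) \<in> ?Q \<rightarrow>\<^sub>M P"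
    by (subst measurable_cong[OF eq]) auto
  then have "(\<lambda>\<omega>. flow (fst \<omega>) (snd \<omega>)) \<in> ?Q \<rightarrow>\<^sub>M restrict_space P X"
    by (intro measurable_restrict_space2) (auto simp: space_pair_measure intro!: flow_in_X)
  then show ?thesis
    unfolding measurable_cong_sets[OF refl sets_\<mu>_cong] by (simp add: split_beta')
qed

lemma flow_t_measurable [measurable]: "flow t \<in> \<mu> \<rightarrow>\<^sub>M \<mu>"
  using measurable_compose[OF measurable_Pair1'[of t borel \<mu>] flow_measurable] by simp

text \<open>
  The images of the parts on which the flow is a shear partition the target, because the
  inverse of the time-\<open>t\<close> map is the time-\<open>(-t)\<close> map.
\<close>

lemma emeasure_flow:
  assumes A: "A \<in> sets \<mu>"
  shows "emeasure \<mu> (flow t -` A \<inter> X) = emeasure \<mu> A"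
proof -
  have AP[measurable]: "A \<in> sets P" and AX: "A \<subseteq> X" using A by (auto simp only: sets_\<mu>)
  define C where "C n = {p \<in> space P. p \<in> A \<and> S (- n) (fst p) \<le> snd p - t \<and> snd p - t < S (- n + 1) (fst p)}" for n
  define B where "B n = {p \<in> X. flow t p \<in> A \<and> lap (fst p) (t + snd p) = n}" for n
  have C[measurable]: "C n \<in> sets P" for n unfolding C_def by measurable
  have BC: "B n = shear n t -` C n \<inter> space P" for n
  proof -
    have key: "S (- n) (x + of_int n * \<alpha>) = - S n x" "S (1 - n) (x + of_int n * \<alpha>) = f x - S n x" for x
      using roof_sum_minus[of \<alpha> f n "x + of_int n * \<alpha>"] roof_sum_Suc[of \<alpha> f "- n" "x + of_int n * \<alpha>"]
      by simp_all
    have "(x, s) \<in> B n \<longleftrightarrow> (x, s) \<in> shear n t -` C n \<inter> space P" for x s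
    proof (cases "x \<in> {0..<1}")
      case True
      have sh: "shear n t (x, s) = (frac (x + of_int n * \<alpha>), t + s - S n x)" by (simp add: shear_def)
      have "(x, s) \<in> B n \<longleftrightarrow> 0 \<le> s \<and> s < f x \<and> lap x (t + s) = n \<and> shear n t (x, s) \<in> A"
        using True flow_eq_shear[of "(x, s)" t] by (auto simp: B_def mem_X)
      also have "\<dots> \<longleftrightarrow> 0 \<le> s \<and> s < f x \<and> shear n t (x, s) \<in> A"
      proof -
        have "lap x (t + s) = n" if "shear n t (x, s) \<in> A"
        proof -
          have "0 \<le> t + s - S n x" "t + s - S n x < f (x + of_int n * \<alpha>)"
            using that AX unfolding sh by (auto simp: mem_X dest!: subsetD)
          then show ?thesis using roof_sum_Suc[of \<alpha> f n x] by (intro lap_eqI) auto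
        qed
        then show ?thesis by blast
      qed
      also have "\<dots> \<longleftrightarrow> (x, s) \<in> shear n t -` C n \<inter> space P"
        using True by (auto simp: C_def space_pair_measure sh key frac_lt_1)
      finally show ?thesis .
    next
      case False
      then show ?thesis by (auto simp: B_def mem_X space_pair_measure)
    qed
    then show ?thesis by auto
  qed
  have B[measurable]: "B n \<in> sets P" for n unfolding BC by measurable
  have "emeasure P (flow t -` A \<inter> X) = emeasure P (\<Union>n. B n)"
    by (rule arg_cong[where f = "emeasure P"]) (auto simp: B_def)
  also have "\<dots> = (\<integral>\<^sup>+n. emeasure P (B n) \<partial>count_space UNIV)"
    by (rule emeasure_UN_countable[OF B]) (auto simp: disjoint_family_on_def B_def)
  also have "\<dots> = (\<integral>\<^sup>+n. emeasure P (C n) \<partial>count_space UNIV)"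
    unfolding BC emeasure_shear[OF C] ..
  also have "\<dots> = emeasure P (\<Union>n. C n)"
  proof (rule emeasure_UN_countable[OF C, symmetric])
    show "disjoint_family_on C UNIV"
      unfolding disjoint_family_on_def C_def using S_unique by fastforce
  qed auto
  also have "(\<Union>n. C n) = A"
  proof
    show "A \<subseteq> (\<Union>n. C n)"
    proof
      fix p assume p: "p \<in> A"
      obtain n where "S n (fst p) \<le> snd p - t" "snd p - t < S (n + 1) (fst p)" using S_exists by blast
      then have "p \<in> C (- n)" using p sets.sets_into_space[OF AP] by (auto simp: C_def)
      then show "p \<in> (\<Union>n. C n)" by blast
    qed
  qed (auto simp: C_def)
  finally have "emeasure P (flow t -` A \<inter> X) = emeasure P A" .
  moreover have "flow t -` A \<inter> X \<in> sets \<mu>" using measurable_sets[OF flow_t_measurable A] by simp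
  ultimately show ?thesis using A by (simp only: emeasure_\<mu>)
qed

lemma distr_flow: "distr \<mu> \<mu> (flow t) = \<mu>"
proof (rule measure_eqI)
  fix A assume "A \<in> sets (distr \<mu> \<mu> (flow t))"
  then show "emeasure (distr \<mu> \<mu> (flow t)) A = emeasure \<mu> A"
    by (subst emeasure_distr) (auto simp: emeasure_flow)
qed simp

lemma measure_preserving_flow: "measure_preserving_flow \<mu> flow"
  unfolding measure_preserving_flow_def
  using flow_measurable flow_0 flow_add distr_flow by simp

definition strip :: "real set \<Rightarrow> (real \<times> real) set" where "strip W = {p \<in> X. fst p \<in> W}"

lemma strip_sets:
  assumes W: "W \<in> sets circle"
  shows "strip W \<in> sets \<mu>"
proof -
  have "strip W = X \<inter> (fst -` W \<inter> space P)"
    using sets.sets_into_space[OF X_sets] by (auto simp: strip_def)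
  moreover have "fst -` W \<inter> space P \<in> sets P" by (rule measurable_sets[OF measurable_fst W])
  ultimately have "strip W \<in> sets P" using X_sets by (simp only: sets.Int)
  then show ?thesis by (simp only: sets_\<mu>) (auto simp: strip_def)
qed

lemma emeasure_strip_null:
  assumes N: "N \<in> null_sets circle"
  shows "emeasure P (strip N) = 0"
proof -
  have NW: "N \<in> sets circle" and N0: "emeasure circle N = 0" using N by auto
  have sP: "strip N \<in> sets P" using strip_sets[OF NW] sets_\<mu> by blast
  have "emeasure P (strip N) \<le> (\<integral>\<^sup>+x. \<infinity> * indicator N x \<partial>circle)"
    unfolding emeasure_P[OF sP] by (rule nn_integral_mono) (auto simp: strip_def indicator_def)
  also have "\<dots> = 0" using NW N0 by (simp add: nn_integral_cmult_indicator)
  finally show ?thesis by simp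
qed

text \<open>
  An invariant set is a union of whole fibres over a set which is invariant under the rotation.
\<close>

lemma ergodic_flow: "ergodic_flow \<mu> flow"
  unfolding ergodic_flow_def
proof (intro conjI measure_preserving_flow ballI impI)
  fix A assume A: "A \<in> sets \<mu>" and "\<forall>t. flow t -` A \<inter> space \<mu> = A"
  then have inv: "flow t p \<in> A \<longleftrightarrow> p \<in> A" if "p \<in> X" for t p using that by auto
  have AP: "A \<in> sets P" and AX: "A \<subseteq> X" using A by (auto simp only: sets_\<mu>)
  define B where "B = (\<lambda>x. (x, 0)) -` A \<inter> space circle"
  have B: "B \<in> sets circle"
    unfolding B_def by (rule measurable_sets[OF _ AP]) (auto intro: measurable_Pair2')
  have fibre: "(x, s) \<in> A \<longleftrightarrow> x \<in> B" if x: "(x, s) \<in> X" for x s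
  proof -
    have "flow s (x, 0) = (x, s)"
      using x flow_eqI[of x 0 s 0] roof_sum_Suc[of \<alpha> f 0 x] by (simp add: mem_X frac_eq)
    moreover have "(x, 0) \<in> X" using x by (simp add: mem_X pos)
    ultimately show ?thesis using inv[of "(x, 0)" s] x by (simp add: B_def mem_X)
  qed
  have "emeasure circle B = 0 \<or> emeasure circle B = 1"
  proof (rule irrational_rotation_ergodic[OF irrational B])
    fix x :: real assume x: "x \<in> {0..<1}"
    have "flow (f x) (x, 0) = (frac (x + \<alpha>), 0)"
      using x flow_eqI[of x 1 "f x" 0] roof_sum_Suc[of \<alpha> f 0 x] roof_sum_Suc[of \<alpha> f 1 x] pos
      by simp
    moreover have "(x, 0) \<in> X" using x by (simp add: mem_X pos)
    ultimately show "frac (x + \<alpha>) \<in> B \<longleftrightarrow> x \<in> B"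
      using inv[of "(x, 0)" "f x"] x by (simp add: B_def frac_lt_1)
  qed
  then show "measure \<mu> A = 0 \<or> measure \<mu> A = 1"
  proof
    assume 0: "emeasure circle B = 0"
    have "A = strip B" using fibre AX by (auto simp: strip_def)
    then have "emeasure P A = 0" using emeasure_strip_null[of B] 0 B by (simp add: null_sets_def)
    then show ?thesis using A by (simp add: measure_def emeasure_\<mu>)
  next
    assume 1: "emeasure circle B = 1"
    then have "measure circle B = 1" by (simp add: measure_def)
    then have "AE x in circle. x \<in> B"
      using prob_space.prob_eq_1[OF prob_space_circle B] by simp
    have "emeasure P A = emeasure P X"
      unfolding emeasure_P[OF AP] emeasure_P[OF X_sets]
    proof (rule nn_integral_cong_AE, rule AE_mp[OF \<open>AE x in circle. x \<in> B\<close>], rule AE_I2, rule impI)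
      fix x assume "x \<in> space circle" "x \<in> B"
      then have "Pair x -` A = Pair x -` X" using fibre AX by auto
      then show "emeasure lborel (Pair x -` A) = emeasure lborel (Pair x -` X)" by simp
    qed
    then show ?thesis using A area_pos by (simp add: measure_def emeasure_\<mu> emeasure_X divide_ennreal)
  qed
qed

section \<open>The phase space as a standard Borel and metric space\<close>

text \<open>
  The phase space is Borel isomorphic to the closed quadrant of the plane: both \<open>x\<close> and the
  relative height \<open>s / f x\<close> range over half-open intervals, which are stretched to half-lines.
\<close>

lemma standard_borel_\<mu>: "standard_borel \<mu>"
proof -
  define \<psi> :: "real \<times> real \<Rightarrow> real \<times> real" where "\<psi> p = (fst p / (1 - fst p), snd p / (f (fst p) - snd p))" for p
  define \<theta> :: "real \<times> real \<Rightarrow> real \<times> real"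
    where "\<theta> w = (frac (fst w / (1 + fst w)), f (fst w / (1 + fst w)) * snd w / (1 + snd w))" for w
  define Y :: "(real \<times> real) set" where "Y = {0..} \<times> {0..}"
  have Y: "closed Y" unfolding Y_def by (intro closed_Times) auto
  have Y_mem: "w \<in> Y \<longleftrightarrow> 0 \<le> fst w \<and> 0 \<le> snd w" for w by (cases w) (auto simp: Y_def)
  have \<psi>Y: "\<psi> p \<in> Y" if "p \<in> X" for p using that by (cases p) (auto simp: mem_X \<psi>_def Y_def)
  have \<theta>X: "\<theta> w \<in> X" if "w \<in> Y" for w
  proof (cases w)
    case (Pair u v)
    with that have uv: "0 \<le> u" "0 \<le> v" by (auto simp: Y_def)
    have "f (u / (1 + u)) * v < f (u / (1 + u)) * (1 + v)"
      using pos uv by (intro mult_strict_left_mono) auto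
    then show ?thesis using uv pos[of "u / (1 + u)"]
      by (simp add: Pair \<theta>_def mem_X frac_lt_1 divide_less_eq less_imp_le)
  qed
  have \<theta>\<psi>: "\<theta> (\<psi> p) = p" if "p \<in> X" for p
  proof (cases p)
    case (Pair x s)
    with that have xs: "0 \<le> x" "x < 1" "0 \<le> s" "s < f x" by (auto simp: mem_X)
    have "x / (1 - x) / (1 + x / (1 - x)) = x" using xs by (simp add: field_simps)
    moreover have "f x * (s / (f x - s)) / (1 + s / (f x - s)) = s"
      using xs pos[of x] by (simp add: divide_simps)
    ultimately show ?thesis using xs by (simp add: Pair \<theta>_def \<psi>_def frac_eq)
  qed
  have \<psi>\<theta>: "\<psi> (\<theta> w) = w" if "w \<in> Y" for w
  proof (cases w)
    case (Pair u v)
    with that have uv: "0 \<le> u" "0 \<le> v" by (auto simp: Y_def)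
    define z where "z = u / (1 + u)"
    have z: "0 \<le> z" "z < 1" "z / (1 - z) = u" using uv by (auto simp: z_def field_simps)
    have fz: "f z > 0" by (rule pos)
    have "f z * v / (1 + v) / (f z - f z * v / (1 + v)) = v"
    proof -
      have "f z - f z * v / (1 + v) = f z / (1 + v)" using uv by (simp add: field_simps)
      moreover have "f z * v / (1 + v) = v * (f z / (1 + v))" by simp
      moreover have "f z / (1 + v) \<noteq> 0" using uv fz by simp
      ultimately show ?thesis by (metis nonzero_mult_div_cancel_right)
    qed
    then show ?thesis using z by (simp add: Pair \<theta>_def \<psi>_def frac_eq flip: z_def)
  qed
  have \<psi>m: "\<psi> \<in> \<mu> \<rightarrow>\<^sub>M borel"
  proof -
    have "\<psi> \<in> P \<rightarrow>\<^sub>M borel \<Otimes>\<^sub>M borel" unfolding \<psi>_def[abs_def] by measurable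
    then show ?thesis using measurable_compose[OF \<mu>_measurable_P] by (simp add: borel_prod)
  qed
  have \<theta>m: "\<theta> \<in> borel \<rightarrow>\<^sub>M P"
  proof -
    let ?R = "borel \<Otimes>\<^sub>M borel :: (real \<times> real) measure"
    have "(\<lambda>w. fst w / (1 + fst w)) \<in> borel_measurable ?R" by measurable
    then have "(\<lambda>w. frac (fst w / (1 + fst w))) \<in> ?R \<rightarrow>\<^sub>M circle"
      by (rule measurable_compose[OF _ measurable_frac])
    moreover have "(\<lambda>w. f (fst w / (1 + fst w)) * snd w / (1 + snd w)) \<in> ?R \<rightarrow>\<^sub>M lborel"
      unfolding measurable_lborel1 by measurable
    ultimately have "\<theta> \<in> ?R \<rightarrow>\<^sub>M P" unfolding \<theta>_def[abs_def] by (rule measurable_Pair)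
    then show ?thesis by (simp add: borel_prod)
  qed
  define \<tau> where "\<tau> = pullback_topology X \<psi> euclidean"
  have top: "topspace \<tau> = X" by (simp add: \<tau>_def topspace_pullback_topology)
  have hom: "homeomorphic_map \<tau> (top_of_set Y) \<psi>"
  proof (rule homeomorphic_map_maps[THEN iffD2], intro exI[of _ \<theta>], unfold homeomorphic_maps_def, intro conjI)
    show "continuous_map \<tau> (top_of_set Y) \<psi>"
      unfolding continuous_map_in_subtopology
    proof
      show "continuous_map \<tau> euclidean \<psi>"
        unfolding \<tau>_def using continuous_map_pullback[OF continuous_map_id] by (simp add: comp_def id_def)
      show "\<psi> \<in> topspace \<tau> \<rightarrow> Y" using \<psi>Y by (simp add: top)
    qed
    show "continuous_map (top_of_set Y) \<tau> \<theta>"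
      unfolding \<tau>_def
    proof (rule continuous_map_pullback')
      show "continuous_map (top_of_set Y) euclidean (\<psi> \<circ> \<theta>)"
        by (rule continuous_map_eq[OF continuous_map_from_subtopology[OF continuous_map_id]]) (auto simp: \<psi>\<theta>)
      show "topspace (top_of_set Y) \<subseteq> \<theta> -` X" using \<theta>X by auto
    qed
  qed (auto simp: top \<theta>\<psi> \<psi>\<theta>)
  have hs: "\<tau> homeomorphic_space (top_of_set Y)" by (rule homeomorphic_map_imp_homeomorphic_space[OF hom])
  have cm: "completely_metrizable_space \<tau>"
    using homeomorphic_completely_metrizable_space[OF hs]
      completely_metrizable_space_closedin[OF completely_metrizable_space_euclidean, of Y] Y by auto
  have sc: "second_countable \<tau>"
    using homeomorphic_space_second_countability[OF hs] second_countable_subtopology[of euclidean Y]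
      second_countable_euclidean_plane by auto
  have "sigma_sets X {U. openin \<tau> U} = sigma_sets X {\<psi> -` U \<inter> X |U. U \<in> Collect open}"
    by (rule arg_cong[where f = "sigma_sets X"]) (auto simp: \<tau>_def openin_pullback_topology)
  also have "\<dots> = {\<psi> -` U \<inter> X |U. U \<in> sigma_sets UNIV (Collect open)}"
    by (rule sigma_sets_vimage_commute[symmetric]) auto
  also have "\<dots> = sets \<mu>"
  proof
    show "{\<psi> -` U \<inter> X |U. U \<in> sigma_sets UNIV (Collect open)} \<subseteq> sets \<mu>"
      using measurable_sets[OF \<psi>m] by (auto simp: borel_def)
    show "sets \<mu> \<subseteq> {\<psi> -` U \<inter> X |U. U \<in> sigma_sets UNIV (Collect open)}"
    proof
      fix A assume A: "A \<in> sets \<mu>"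
      then have AP: "A \<in> sets P" and AX: "A \<subseteq> X" by (auto simp only: sets_\<mu>)
      have "\<theta> -` A \<in> sets borel" using measurable_sets[OF \<theta>m AP] by simp
      moreover have "A = \<psi> -` (\<theta> -` A) \<inter> X"
      proof (intro set_eqI iffI)
        fix p assume "p \<in> A"
        then show "p \<in> \<psi> -` (\<theta> -` A) \<inter> X" using AX \<theta>\<psi>[of p] by auto
      next
        fix p assume "p \<in> \<psi> -` (\<theta> -` A) \<inter> X"
        then have "p \<in> X" "\<theta> (\<psi> p) \<in> A" by simp_all
        then show "p \<in> A" using \<theta>\<psi>[of p] by simp
      qed
      ultimately show "A \<in> {\<psi> -` U \<inter> X |U. U \<in> sigma_sets UNIV (Collect open)}"
        by (auto simp: borel_def)
    qed
  qed
  finally have "sets \<mu> = sigma_sets (space \<mu>) {U. openin \<tau> U}" by simp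
  with top cm sc show ?thesis unfolding standard_borel_def by auto
qed

lemma Metric_space_flow: "Metric_space X (special_flow_dist circle_dist)"
proof
  show "0 \<le> special_flow_dist circle_dist p p'" for p p'
    by (auto simp: special_flow_dist_def circle_dist_def circle_norm_nonneg split: prod.split)
  show "special_flow_dist circle_dist p p' = special_flow_dist circle_dist p' p" for p p'
    by (auto simp: special_flow_dist_def circle_dist_def circle_norm_minus_commute abs_minus_commute split: prod.split)
  show "(special_flow_dist circle_dist p p' = 0) = (p = p')" if "p \<in> X" "p' \<in> X" for p p'
  proof (cases p, cases p')
    fix x s x' s' assume eq: "p = (x, s)" "p' = (x', s')"
    have "circle_dist x x' + \<bar>s - s'\<bar> = 0 \<longleftrightarrow> circle_dist x x' = 0 \<and> \<bar>s - s'\<bar> = 0"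
      by (rule add_nonneg_eq_0_iff) (auto simp: circle_dist_def circle_norm_nonneg)
    then show ?thesis using that eq circle_dist_eq_0_iff[of x x'] by (simp add: special_flow_dist_def mem_X)
  qed
  show "special_flow_dist circle_dist p p'' \<le> special_flow_dist circle_dist p p' + special_flow_dist circle_dist p' p''" for p p' p''
  proof (cases p, cases p', cases p'')
    fix x s x' s' x'' s'' assume "p = (x, s)" "p' = (x', s')" "p'' = (x'', s'')"
    then show ?thesis
      using circle_norm_triangle[of "x - x'" "x' - x''"] by (simp add: special_flow_dist_def circle_dist_def)
  qed
qed

lemma SWR_propertyI:
  assumes "compact Q" "0 \<notin> Q"
    and "\<And>t\<^sub>0. t\<^sub>0 > 0 \<Longrightarrow> switchable_R \<mu> (special_flow_dist circle_dist) flow t\<^sub>0 Q"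
  shows "SWR_property \<mu> (special_flow_dist circle_dist) flow"
proof -
  have "{t\<^sub>0. t\<^sub>0 > 0 \<and> switchable_R \<mu> (special_flow_dist circle_dist) flow t\<^sub>0 Q} = {0<..}"
    using assms(3) by auto
  moreover have "uncountable {0::real<..}"
    using uncountable_open_interval[of 0 1] countable_subset[of "{0<..<1::real}" "{0<..}"] by force
  ultimately show ?thesis
    unfolding SWR_property_def space_\<mu>
    by (intro conjI exI[of _ Q] prob_space_\<mu> standard_borel_\<mu> Metric_space_flow ergodic_flow assms(1,2)) simp
qed

end

section \<open>Best approximations\<close>

locale best_approximation =
  fixes \<alpha> :: real and q :: "nat \<Rightarrow> nat"
  assumes irrational: "\<alpha> \<notin> \<rat>" and best_denominators: "best_denominators \<alpha> q"
begin

lemma q_mono: "strict_mono q"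
  and q_0: "q 0 = 1"
  and best: "1 \<le> k \<Longrightarrow> k < q (Suc s) \<Longrightarrow> k \<noteq> q s \<Longrightarrow>
    circle_norm (real (q s) * \<alpha>) < circle_norm (real k * \<alpha>)"
  using best_denominators by (auto simp: best_denominators_def)

lemma q_less: "m < n \<Longrightarrow> q m < q n"
  using q_mono by (simp add: strict_mono_less)

lemma q_le: "m \<le> n \<Longrightarrow> q m \<le> q n"
  using q_mono by (simp add: strict_mono_less_eq)

lemma q_pos: "0 < q s"
  using q_le[of 0 s] q_0 by simp

lemma le_q: "s \<le> q s"
  by (rule strict_mono_imp_increasing[OF q_mono])

definition err :: "nat \<Rightarrow> real" where "err s = real (q s) * \<alpha> - of_int (round (real (q s) * \<alpha>))"

lemma circle_norm_q: "circle_norm (real (q s) * \<alpha>) = \<bar>err s\<bar>"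
  by (simp add: circle_norm_def err_def)

lemma err_nonzero: "err s \<noteq> 0"
proof
  assume "err s = 0"
  then have "\<alpha> = of_int (round (real (q s) * \<alpha>)) / real (q s)"
    using q_pos[of s] by (simp add: err_def field_simps)
  then have "\<alpha> \<in> \<rat>" by (metis Rats_divide Rats_of_int Rats_of_nat)
  with irrational show False by simp
qed

lemma best_le: "1 \<le> k \<Longrightarrow> k < q (Suc s) \<Longrightarrow> \<bar>err s\<bar> \<le> circle_norm (real k * \<alpha>)"
  using best[of k s] by (cases "k = q s") (auto simp: circle_norm_q)

text \<open>Dirichlet's approximation theorem, with denominators less than \<open>q\<^sub>s\<^sub>+\<^sub>1\<close>.\<close>

lemma err_less: "\<bar>err s\<bar> < 1 / real (q s)"
proof -
  have N: "0 < q (Suc s) - 1" using q_less[of s "Suc s"] q_pos[of s] by simp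
  obtain h k where hk: "0 < k" "k \<le> int (q (Suc s) - 1)"
    "\<bar>of_int k * \<alpha> - of_int h\<bar> < 1 / real (q (Suc s) - 1)"
    using Dirichlet_approx[OF N] by metis
  have k: "1 \<le> nat k" "nat k < q (Suc s)" "real (nat k) = of_int k" using hk(1,2) N by auto
  have "\<bar>err s\<bar> \<le> circle_norm (real (nat k) * \<alpha>)" by (rule best_le[OF k(1,2)])
  also have "\<dots> \<le> \<bar>of_int k * \<alpha> - of_int h\<bar>" using circle_norm_le k(3) by metis
  also note hk(3)
  also have "1 / real (q (Suc s) - 1) \<le> 1 / real (q s)"
    using q_less[of s "Suc s"] q_pos[of s] N by (intro divide_left_mono) auto
  finally show ?thesis .
qed

lemma err_decreasing: "\<bar>err (Suc s)\<bar> < \<bar>err s\<bar>"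
proof -
  have "q s < q (Suc s)" "q (Suc s) < q (Suc (Suc s))" by (auto intro: q_less)
  then show ?thesis using best[of "q s" "Suc s"] q_pos[of s] by (simp add: circle_norm_q)
qed

text \<open>A common divisor \<open>d\<close> would give a smaller denominator with an error smaller by the factor \<open>d\<close>.\<close>

lemma coprime_q: "coprime (round (real (q s) * \<alpha>)) (int (q s))"
proof (rule ccontr)
  let ?p = "round (real (q s) * \<alpha>)"
  assume "\<not> coprime ?p (int (q s))"
  define d where "d = gcd ?p (int (q s))"
  have "d > 0" using q_pos[of s] by (simp add: d_def)
  moreover have "d \<noteq> 1" using \<open>\<not> coprime _ _\<close> by (simp add: d_def coprime_iff_gcd_eq_1)
  ultimately have d: "d \<ge> 2" by simp
  obtain p' where p': "?p = d * p'" using gcd_dvd1[of ?p "int (q s)"] unfolding d_def[symmetric] by (elim dvdE)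
  obtain q' where q': "int (q s) = d * q'" using gcd_dvd2[of ?p "int (q s)"] unfolding d_def[symmetric] by (elim dvdE)
  have q'pos: "q' > 0" using q' q_pos[of s] d by (metis of_nat_0_less_iff zero_less_mult_pos order_less_le_trans zero_less_numeral)
  have "q' * 2 \<le> q' * d" using d q'pos by (intro mult_left_mono) auto
  then have less: "q' < int (q s)" using q' q'pos by (simp add: mult.commute)
  have rq: "real (q s) = of_int d * of_int q'" using q' by (metis of_int_mult of_int_of_nat_eq)
  have rp: "real_of_int ?p = of_int d * of_int p'" by (subst p') simp
  have "err s = real (q s) * \<alpha> - of_int ?p" by (simp only: err_def)
  also have "\<dots> = real (q s) * \<alpha> - of_int d * of_int p'" by (simp only: rp)
  also have "\<dots> = of_int d * (of_int q' * \<alpha> - of_int p')" unfolding rq by (simp add: algebra_simps)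
  finally have "err s = of_int d * (of_int q' * \<alpha> - of_int p')" .
  then have "\<bar>err s\<bar> = of_int d * \<bar>of_int q' * \<alpha> - of_int p'\<bar>" using d by (simp add: abs_mult)
  moreover have "1 * \<bar>of_int q' * \<alpha> - of_int p'\<bar> \<le> real_of_int d * \<bar>of_int q' * \<alpha> - of_int p'\<bar>"
    using d by (intro mult_right_mono) auto
  ultimately have "\<bar>of_int q' * \<alpha> - of_int p'\<bar> \<le> \<bar>err s\<bar>" by simp
  also have "\<dots> < circle_norm (real (nat q') * \<alpha>)"
    using best[of "nat q'" s] less q'pos q_less[of s "Suc s"] by (simp add: circle_norm_q)
  also have "\<dots> \<le> \<bar>of_int q' * \<alpha> - of_int p'\<bar>"
    using circle_norm_le[of "real (nat q') * \<alpha>" p'] q'pos by simp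
  finally show False by simp
qed

text \<open>
  The lower bound comes from the determinant of two consecutive convergents, a nonzero integer.
\<close>

lemma separation:
  assumes "1 \<le> k" "k < q s"
  shows "1 / (2 * real (q s)) \<le> circle_norm (real k * \<alpha>)"
proof (cases s)
  case 0 then show ?thesis using assms q_0 by simp
next
  case (Suc t)
  define a b where "a = round (real (q t) * \<alpha>)" and "b = round (real (q s) * \<alpha>)"
  define D where "D = b * int (q t) - a * int (q s)"
  have "D \<noteq> 0"
  proof
    assume "D = 0"
    then have "int (q s) dvd b * int (q t)" by (simp add: D_def)
    moreover have "coprime (int (q s)) b" using coprime_q[of s] by (simp add: b_def coprime_commute)
    ultimately have "int (q s) dvd int (q t)" by (simp add: coprime_dvd_mult_right_iff)
    then have "q s \<le> q t" using q_pos[of t] by (auto dest: dvd_imp_le)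
    with q_less[of t s] Suc show False by simp
  qed
  then have "1 \<le> \<bar>real_of_int D\<bar>" by linarith
  also have "real_of_int D = real (q s) * err t - real (q t) * err s"
    by (simp add: D_def err_def a_def b_def algebra_simps)
  also have "\<bar>\<dots>\<bar> \<le> real (q s) * \<bar>err t\<bar> + real (q t) * \<bar>err s\<bar>"
    using abs_triangle_ineq4[of "real (q s) * err t" "real (q t) * err s"] by (simp add: abs_mult)
  also have "\<dots> \<le> real (q s) * \<bar>err t\<bar> + real (q s) * \<bar>err t\<bar>"
    using q_less[of t s] err_decreasing[of t] Suc by (intro add_left_mono mult_mono) auto
  finally have "1 / (2 * real (q s)) \<le> \<bar>err t\<bar>" using q_pos[of s] by (simp add: field_simps)
  also have "\<dots> \<le> circle_norm (real k * \<alpha>)" using best_le[of k t] assms Suc by simp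
  finally show ?thesis .
qed

lemma separation_int:
  assumes "k \<noteq> 0" "\<bar>k\<bar> < int (q s)"
  shows "1 / (2 * real (q s)) \<le> circle_norm (of_int k * \<alpha>)"
proof -
  have "1 / (2 * real (q s)) \<le> circle_norm (real (nat \<bar>k\<bar>) * \<alpha>)"
    using assms by (intro separation) auto
  also have "\<dots> = circle_norm (of_int k * \<alpha>)"
    using circle_norm_minus[of "of_int k * \<alpha>"] by (cases "k \<ge> 0") auto
  finally show ?thesis .
qed

text \<open>
  Up to an error less than \<open>1 / q\<^sub>s\<close>, the first \<open>q\<^sub>s\<close> points of an orbit
  are a permutation of the points of an arithmetic progression with step \<open>1 / q\<^sub>s\<close>.
\<close>

lemma density:
  fixes n\<^sub>0 :: int and x c :: real
  shows "\<exists>n\<in>{n\<^sub>0..<n\<^sub>0 + int (q s)}. \<exists>k::int. c < x + of_int n * \<alpha> - of_int k \<and> x + of_int n * \<alpha> - of_int k < c + 3 / real (q s)"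
proof -
  define Q where "Q = int (q s)"
  define p where "p = round (real (q s) * \<alpha>)"
  have Q: "Q > 0" "real_of_int Q = real (q s)" using q_pos[of s] by (auto simp: Q_def)
  define x' where "x' = x + of_int n\<^sub>0 * \<alpha>"
  define m where "m = \<lceil>(c - x') * of_int Q\<rceil> + 1"
  obtain u v where uv: "u * p + v * Q = 1"
    using bezout_int[of p Q] coprime_q[of s] by (auto simp: p_def Q_def coprime_iff_gcd_eq_1)
  define i where "i = (m * u) mod Q"
  have i: "0 \<le> i" "i < Q" using Q by (auto simp: i_def)
  define k where "k = - (m * v + (m * u) div Q * p)"
  have ip: "i * p = m + k * Q"
  proof -
    have "i = m * u - (m * u) div Q * Q" by (simp add: i_def minus_div_mult_eq_mod)
    then have "i * p = (m * u - (m * u) div Q * Q) * p" by simp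
    also have "\<dots> = m * (u * p) - (m * u) div Q * Q * p" by (simp add: algebra_simps)
    also have "u * p = 1 - v * Q" using uv by simp
    finally show ?thesis by (simp add: k_def algebra_simps)
  qed
  have e: "\<bar>of_int i * err s\<bar> < 1"
  proof -
    have "\<bar>of_int i * err s\<bar> \<le> of_int Q * \<bar>err s\<bar>"
      using i by (simp add: abs_mult mult_right_mono)
    also have "\<dots> < 1" using err_less[of s] Q q_pos[of s] by (simp add: field_simps)
    finally show ?thesis .
  qed
  have "of_int i * \<alpha> * of_int Q = of_int (i * p) + of_int i * err s"
    by (simp add: err_def p_def Q algebra_simps)
  then have main: "(x' + of_int i * \<alpha> - of_int k) * of_int Q = x' * of_int Q + of_int m + of_int i * err s"
    unfolding ip by (simp add: algebra_simps)
  have m: "(c - x') * of_int Q + 1 \<le> of_int m" "of_int m < (c - x') * of_int Q + 2"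
    unfolding m_def by linarith+
  have "c * of_int Q < (x' + of_int i * \<alpha> - of_int k) * of_int Q"
    using main m e by (auto simp: algebra_simps)
  then have 1: "c < x' + of_int i * \<alpha> - of_int k" using Q by simp
  have "(x' + of_int i * \<alpha> - of_int k) * of_int Q < (c + 3 / of_int Q) * of_int Q"
    using main m e Q(1) by (auto simp: algebra_simps)
  then have 2: "x' + of_int i * \<alpha> - of_int k < c + 3 / of_int Q" using Q by simp
  show ?thesis
    using 1 2 i Q by (intro bexI[of _ "n\<^sub>0 + i"] exI[of _ k]) (auto simp: x'_def Q_def algebra_simps)
qed

lemma err_le_diff:
  assumes "q s < q t" "q t - q s < q (Suc s)"
  shows "\<bar>err s\<bar> \<le> \<bar>err t - err s\<bar>"
proof -
  have "\<bar>err s\<bar> \<le> circle_norm (real (q t - q s) * \<alpha>)" using assms by (intro best_le) auto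
  also have "\<dots> \<le> \<bar>real (q t - q s) * \<alpha> - of_int (round (real (q t) * \<alpha>) - round (real (q s) * \<alpha>))\<bar>"
    by (rule circle_norm_le)
  also have "\<dots> = \<bar>err t - err s\<bar>" using assms by (simp add: err_def of_nat_diff algebra_simps)
  finally show ?thesis .
qed

text \<open>
  Two consecutive errors of the same sign would make \<open>q\<^sub>s\<^sub>+\<^sub>1 - q\<^sub>s\<close> a better denominator. As the
  signs alternate, the errors with indices \<open>s\<close> and \<open>s + 2\<close> have the same sign, which leads to the
  Fibonacci-type growth of the denominators.
\<close>

lemma err_alternate: "err (Suc s) * err s < 0"
proof (rule ccontr)
  assume "\<not> err (Suc s) * err s < 0"
  then have "err (Suc s) * err s > 0" using err_nonzero[of s] err_nonzero[of "Suc s"]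
    by (simp add: not_less le_less)
  then have "\<bar>err (Suc s) - err s\<bar> < \<bar>err s\<bar>"
    using err_decreasing[of s] by (auto simp: zero_less_mult_iff abs_if split: if_splits)
  moreover have "\<bar>err s\<bar> \<le> \<bar>err (Suc s) - err s\<bar>"
    using err_le_diff[of s "Suc s"] q_less[of s "Suc s"] q_pos[of s] by simp
  ultimately show False by simp
qed

lemma q_growth: "q s + q (Suc s) \<le> q (Suc (Suc s))"
proof -
  have less: "q s < q (Suc (Suc s))" by (auto intro: q_less)
  have "err (Suc (Suc s)) * err s > 0"
    using err_alternate[of s] err_alternate[of "Suc s"]
    by (auto simp: zero_less_mult_iff mult_less_0_iff)
  then have "\<bar>err (Suc (Suc s)) - err s\<bar> < \<bar>err s\<bar>"
    using err_decreasing[of s] err_decreasing[of "Suc s"]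
    by (auto simp: zero_less_mult_iff abs_if split: if_splits)
  then have "\<not> q (Suc (Suc s)) - q s < q (Suc s)" using err_le_diff[of s "Suc (Suc s)"] less by linarith
  then show ?thesis using less by linarith
qed

lemma q_growth_power: "2 ^ j * q s \<le> q (s + 2 * j)"
proof (induction j)
  case (Suc j)
  have "2 ^ Suc j * q s \<le> 2 * q (s + 2 * j)" using Suc by simp
  also have "\<dots> \<le> q (s + 2 * j) + q (Suc (s + 2 * j))" using q_le[of "s + 2 * j" "Suc (s + 2 * j)"] by simp
  also have "\<dots> \<le> q (s + 2 * Suc j)" using q_growth[of "s + 2 * j"] by simp
  finally show ?case .
qed simp

lemma q_growth_factor: "\<exists>j. \<forall>s. K * real (q s) \<le> real (q (s + j))" for K :: real
proof -
  obtain j where j: "K < 2 ^ j" using real_arch_pow[of 2 K] by auto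
  have "K * real (q s) \<le> real (q (s + 2 * j))" for s
  proof -
    have "K * real (q s) \<le> 2 ^ j * real (q s)" using j by (intro mult_right_mono) auto
    also have "\<dots> = real (2 ^ j * q s)" by simp
    also have "\<dots> \<le> real (q (s + 2 * j))" using q_growth_power[of j s] by (intro of_nat_mono)
    finally show ?thesis .
  qed
  then show ?thesis by blast
qed

lemma q_bracket: "1 \<le> y \<Longrightarrow> \<exists>r. real (q r) \<le> y \<and> y < real (q (Suc r))" for y :: real
proof -
  assume y: "1 \<le> y"
  obtain n where n: "y < real n" using reals_Archimedean2 by blast
  define r' where "r' = (LEAST r. y < real (q r))"
  have ex: "y < real (q n)" using n le_q[of n] by linarith
  have r': "y < real (q r')" unfolding r'_def by (rule LeastI[where P = "\<lambda>r. y < real (q r)", OF ex])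
  have "r' \<noteq> 0" using r' y q_0 by (cases r') auto
  then obtain r where r: "r' = Suc r" by (cases r') auto
  have "\<not> y < real (q r)" using not_less_Least[of r "\<lambda>r. y < real (q r)"] r by (simp add: r'_def)
  with r' r show ?thesis by (intro exI[of _ r]) auto
qed

lemma filterlim_q: "filterlim (\<lambda>s. real (q s)) at_top sequentially"
  by (rule filterlim_compose[OF filterlim_real_sequentially filterlim_subseq[OF q_mono]])

end

section \<open>Sums of derivatives of comparison functions along orbits\<close>

lemma C1_has_real_derivative:
  assumes "C2_on U g" "x \<in> U"
  shows "(g has_real_derivative deriv g x) (at x)"
proof -
  obtain D where "(g has_vector_derivative D x) (at x)"
    using assms by (auto simp: C2_on_def C1_differentiable_on_def)
  then have "(g has_real_derivative D x) (at x)" by (simp add: has_real_derivative_iff_has_vector_derivative)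
  then show ?thesis using DERIV_imp_deriv by metis
qed

lemma C2_continuous_deriv:
  assumes "C2_on U g"
  shows "continuous_on U (deriv g)"
  using assms C1_differentiable_imp_continuous_on by (auto simp: C2_on_def)

context
  fixes h :: "real \<Rightarrow> real"
  assumes h: "comparison_function h"
begin

lemma comparison_pos: "0 < x \<Longrightarrow> x < 1 \<Longrightarrow> 0 < h x"
  using h by (auto simp: comparison_function_def)

lemma comparison_antimono: "0 < x \<Longrightarrow> x \<le> y \<Longrightarrow> y < 1 \<Longrightarrow> h y \<le> h x"
  using h by (auto simp: comparison_function_def monotone_on_def)

lemma comparison_deriv_mono: "0 < x \<Longrightarrow> x \<le> y \<Longrightarrow> y < 1 \<Longrightarrow> deriv h x \<le> deriv h y"
  using h by (auto simp: comparison_function_def monotone_on_def)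

lemma comparison_DERIV: "0 < x \<Longrightarrow> x < 1 \<Longrightarrow> (h has_real_derivative deriv h x) (at x)"
  using h by (intro C1_has_real_derivative[of "{0<..<1}"]) (auto simp: comparison_function_def)

text \<open>Both inequalities are the mean value theorem for a function with monotone derivative.\<close>

lemma comparison_diff:
  assumes "0 < x" "x \<le> y" "y < 1"
  shows "(y - x) * - deriv h y \<le> h x - h y" "h x - h y \<le> (y - x) * - deriv h x"
proof -
  have "(y - x) * - deriv h y \<le> h x - h y \<and> h x - h y \<le> (y - x) * - deriv h x"
  proof (cases "x = y")
    case False
    with assms have "x < y" by simp
    moreover have "(h has_real_derivative deriv h z) (at z)" if "x \<le> z" "z \<le> y" for z
      using that assms by (intro comparison_DERIV) auto
    ultimately obtain z where z: "x < z" "z < y" "h y - h x = (y - x) * deriv h z"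
      using MVT2[of x y h "deriv h"] by auto
    have "deriv h x \<le> deriv h z" "deriv h z \<le> deriv h y"
      using z assms by (auto intro!: comparison_deriv_mono)
    then have "(y - x) * deriv h x \<le> (y - x) * deriv h z" "(y - x) * deriv h z \<le> (y - x) * deriv h y"
      using \<open>x < y\<close> by (auto intro!: mult_left_mono)
    with z(3) show ?thesis by auto
  qed simp
  then show "(y - x) * - deriv h y \<le> h x - h y" "h x - h y \<le> (y - x) * - deriv h x" by auto
qed

lemma comparison_deriv_nonpos: "0 < x \<Longrightarrow> x < 1 \<Longrightarrow> deriv h x \<le> 0"
proof -
  assume x: "0 < x" "x < 1"
  define y where "y = (x + 1) / 2"
  have y: "x < y" "y < 1" using x by (auto simp: y_def)
  have "0 \<le> (y - x) * - deriv h x"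
    using comparison_diff(2)[of x y] comparison_antimono[of x y] x y by linarith
  with y show ?thesis by (simp add: mult_le_0_iff)
qed

lemma comparison_deriv_le: "0 < x \<Longrightarrow> x < 1 \<Longrightarrow> - deriv h x \<le> 2 / x * h (x / 2)"
proof -
  assume x: "0 < x" "x < 1"
  have "(x - x / 2) * - deriv h x \<le> h (x / 2) - h x" using x by (intro comparison_diff) auto
  then have "x / 2 * - deriv h x \<le> h (x / 2)" using comparison_pos[of x] x by simp
  with x show ?thesis by (simp add: field_simps)
qed

text \<open>
  Each term is at most the integral of \<open>- h'\<close> over the interval of length \<open>\<eta>\<close> to the left of the
  point, and these intervals do not overlap.
\<close>

lemma separated_deriv_sum_aux:
  assumes "finite X" "0 < \<eta>" "\<eta> < l" "b < 1" "l - \<eta> \<le> b" "\<And>w. w \<in> X \<Longrightarrow> l \<le> w \<and> w \<le> b"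
    "\<And>w w'. w \<in> X \<Longrightarrow> w' \<in> X \<Longrightarrow> w < w' \<Longrightarrow> \<eta> \<le> w' - w"
  shows "\<eta> * (\<Sum>w\<in>X. - deriv h w) \<le> h (l - \<eta>) - h b"
  using assms
proof (induction X arbitrary: b rule: finite_linorder_max_induct)
  case empty
  then show ?case using comparison_antimono[of "l - \<eta>" b] by simp
next
  case (insert w X)
  have w: "l \<le> w" "w \<le> b" using insert.prems by auto
  have "\<eta> * (\<Sum>w\<in>X. - deriv h w) \<le> h (l - \<eta>) - h (w - \<eta>)"
  proof (rule insert.IH)
    fix w' assume w': "w' \<in> X"
    then have "w' < w" using insert.hyps by auto
    then have "\<eta> \<le> w - w'" using insert.prems w' by blast
    then show "l \<le> w' \<and> w' \<le> w - \<eta>" using insert.prems(5)[of w'] w' by auto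
  next
    fix u u' assume "u \<in> X" "u' \<in> X" "u < u'"
    then show "\<eta> \<le> u' - u" using insert.prems(6) by auto
  next
    show "w - \<eta> < 1" "l - \<eta> \<le> w - \<eta>" using insert.prems(1-3) w by linarith+
  qed (use insert.prems(1,2) in auto)
  moreover have "(w - (w - \<eta>)) * - deriv h w \<le> h (w - \<eta>) - h w"
    using w insert.prems(1-3) by (intro comparison_diff) linarith+
  moreover have "h b \<le> h w" using w insert.prems(1-3) by (intro comparison_antimono) linarith+
  moreover have "w \<notin> X" using insert.hyps by auto
  ultimately show ?case using insert.hyps(1) by (simp add: algebra_simps)
qed

text \<open>At most one point lies closer than \<open>2 \<eta>\<close>; it is the only one for which \<open>l\<close> matters.\<close>

lemma separated_deriv_sum:
  fixes w :: "'i \<Rightarrow> real"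
  assumes J: "finite J" and \<eta>: "0 < \<eta>" "\<eta> < 1" and l: "0 < l" "l < 1"
    and w: "\<And>n. n \<in> J \<Longrightarrow> l \<le> w n \<and> w n \<le> 1/2"
    and sep: "\<And>n m. n \<in> J \<Longrightarrow> m \<in> J \<Longrightarrow> n \<noteq> m \<Longrightarrow> 2 * \<eta> \<le> \<bar>w n - w m\<bar>"
  shows "(\<Sum>n\<in>J. - deriv h (w n)) \<le> - deriv h l + h \<eta> / \<eta>"
proof -
  define N where "N = {n \<in> J. w n < 2 * \<eta>}"
  have N: "N \<subseteq> J" "finite N" using J by (auto simp: N_def)
  have near: "(\<Sum>n\<in>N. - deriv h (w n)) \<le> - deriv h l"
  proof (cases "N = {}")
    case True then show ?thesis using comparison_deriv_nonpos l by simp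
  next
    case False
    then obtain n where n: "n \<in> N" by blast
    have "m = n" if "m \<in> N" for m
    proof (rule ccontr)
      assume "m \<noteq> n"
      then have "2 * \<eta> \<le> \<bar>w m - w n\<bar>" using sep that n N by blast
      moreover have "0 < w m" "0 < w n" "w m < 2 * \<eta>" "w n < 2 * \<eta>"
        using that n w[of m] w[of n] l by (auto simp: N_def)
      ultimately show False by linarith
    qed
    with n have "N = {n}" by blast
    moreover have "deriv h l \<le> deriv h (w n)"
      using n w[of n] l by (intro comparison_deriv_mono) (auto simp: N_def)
    ultimately show ?thesis by simp
  qed
  have far: "(\<Sum>n\<in>J - N. - deriv h (w n)) \<le> h \<eta> / \<eta>"
  proof -
    have inj: "inj_on w (J - N)"
    proof (rule inj_onI, rule ccontr)
      fix n m assume "n \<in> J - N" "m \<in> J - N" "w n = w m" "n \<noteq> m"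
      then show False using sep[of n m] \<eta> by auto
    qed
    show ?thesis
    proof (cases "J - N = {}")
      case True show ?thesis unfolding True using comparison_pos[of \<eta>] \<eta> by simp
    next
      case False
      then obtain n where "n \<in> J - N" by blast
      then have "2 * \<eta> \<le> 1/2" using w[of n] by (auto simp: N_def)
      then have "\<eta> * (\<Sum>x\<in>w ` (J - N). - deriv h x) \<le> h (2 * \<eta> - \<eta>) - h (1/2)"
      proof (intro separated_deriv_sum_aux)
        fix x x' assume "x \<in> w ` (J - N)" "x' \<in> w ` (J - N)" "x < x'"
        then obtain n m where nm: "n \<in> J" "m \<in> J" "x = w n" "x' = w m" by auto
        with \<open>x < x'\<close> have "n \<noteq> m" by auto
        with sep[of n m] nm \<open>x < x'\<close> \<eta> show "\<eta> \<le> x' - x" by auto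
      qed (use J \<eta> w in \<open>auto simp: N_def not_less\<close>)
      then have "\<eta> * (\<Sum>n\<in>J - N. - deriv h (w n)) \<le> h \<eta>"
        using comparison_pos[of "1/2"] by (simp add: sum.reindex[OF inj] o_def)
      with \<eta> show ?thesis by (simp add: field_simps)
    qed
  qed
  have "(\<Sum>n\<in>J. - deriv h (w n)) = (\<Sum>n\<in>J - N. - deriv h (w n)) + (\<Sum>n\<in>N. - deriv h (w n))"
    by (rule sum.subset_diff[OF N(1) J])
  with near far show ?thesis by linarith
qed

end

text \<open>
  A point at distance \<open>w\<close> from \<open>a\<close> lies on one of the two sides of \<open>a\<close>; points on the same
  side inherit the separation of the orbit.
\<close>

lemma (in best_approximation) orbit_deriv_sum:
  fixes \<theta> :: "int \<Rightarrow> real"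
  assumes G: "comparison_function G" and I: "finite I"
    and block: "\<And>m n. m \<in> I \<Longrightarrow> n \<in> I \<Longrightarrow> \<bar>m - n\<bar> < int (q s)"
    and \<theta>: "\<And>n. n \<in> I \<Longrightarrow> \<bar>\<theta> n - (x + of_int n * \<alpha>)\<bar> \<le> 1 / (8 * real (q s))"
    and l: "0 < l" "l < 1" "\<And>n. n \<in> I \<Longrightarrow> l \<le> circle_norm (\<theta> n - a)"
  shows "(\<Sum>n\<in>I. - deriv G (circle_norm (\<theta> n - a)))
    \<le> 2 * (- deriv G l + 8 * real (q s) * G (1 / (8 * real (q s))))"
proof -
  define k where "k n = round (\<theta> n - a)" for n
  define R where "R = {n \<in> I. 0 \<le> \<theta> n - a - of_int (k n)}"
  have R: "R \<subseteq> I" using I by (auto simp: R_def)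
  define \<eta> where "\<eta> = 1 / (8 * real (q s))"
  have \<eta>: "0 < \<eta>" "\<eta> < 1" using q_pos[of s] by (auto simp: \<eta>_def field_simps)
  have side: "(\<Sum>n\<in>J. - deriv G (circle_norm (\<theta> n - a))) \<le> - deriv G l + G \<eta> / \<eta>"
    if J: "J \<subseteq> I" and \<sigma>: "\<sigma> = 1 \<or> \<sigma> = - 1" "\<And>n. n \<in> J \<Longrightarrow> circle_norm (\<theta> n - a) = \<sigma> * (\<theta> n - a - of_int (k n))"
    for J and \<sigma> :: real
  proof (rule separated_deriv_sum[OF G _ \<eta> l(1,2)])
    fix n m assume nm: "n \<in> J" "m \<in> J" "n \<noteq> m"
    then have nI: "n \<in> I" "m \<in> I" using J by auto
    have "1 / (2 * real (q s)) \<le> circle_norm (of_int (n - m) * \<alpha>)"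
      using block[OF nI] nm by (intro separation_int) auto
    also have "\<dots> \<le> circle_norm (\<theta> n - \<theta> m) + \<bar>of_int (n - m) * \<alpha> - (\<theta> n - \<theta> m)\<bar>"
      by (rule circle_norm_triangle_diff)
    also have "\<bar>of_int (n - m) * \<alpha> - (\<theta> n - \<theta> m)\<bar> \<le> 2 * \<eta>"
      using \<theta>[OF nI(1)] \<theta>[OF nI(2)] by (auto simp: \<eta>_def algebra_simps abs_le_iff)
    also have "circle_norm (\<theta> n - \<theta> m) \<le> \<bar>\<theta> n - \<theta> m - of_int (k n - k m)\<bar>" by (rule circle_norm_le)
    also have "\<dots> = \<bar>circle_norm (\<theta> n - a) - circle_norm (\<theta> m - a)\<bar>"
    proof -
      have "circle_norm (\<theta> n - a) - circle_norm (\<theta> m - a) = \<sigma> * (\<theta> n - \<theta> m - of_int (k n - k m))"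
        using \<sigma>(2)[OF nm(1)] \<sigma>(2)[OF nm(2)] by (simp add: algebra_simps)
      then show ?thesis using \<sigma>(1) by (auto simp: abs_mult)
    qed
    finally show "2 * \<eta> \<le> \<bar>circle_norm (\<theta> n - a) - circle_norm (\<theta> m - a)\<bar>" by (simp add: \<eta>_def field_simps)
  qed (use J I l circle_norm_le_half finite_subset in auto)
  have "(\<Sum>n\<in>R. - deriv G (circle_norm (\<theta> n - a))) \<le> - deriv G l + G \<eta> / \<eta>"
    by (rule side[OF R, of 1]) (auto simp: R_def k_def circle_norm_def)
  moreover have "(\<Sum>n\<in>I - R. - deriv G (circle_norm (\<theta> n - a))) \<le> - deriv G l + G \<eta> / \<eta>"
    by (rule side[of _ "- 1"]) (auto simp: R_def k_def circle_norm_def)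
  ultimately have "(\<Sum>n\<in>I. - deriv G (circle_norm (\<theta> n - a))) \<le> 2 * (- deriv G l + G \<eta> / \<eta>)"
    unfolding sum.subset_diff[OF R I] mult_2 by (rule add_mono[rotated])
  also have "G \<eta> / \<eta> = 8 * real (q s) * G (1 / (8 * real (q s)))"
    using q_pos[of s] by (simp add: \<eta>_def)
  finally show ?thesis .
qed

section \<open>Growth of the comparison function along the denominators\<close>

locale comparison_scale = best_approximation +
  fixes h :: "real \<Rightarrow> real" and R C D :: real
  assumes h: "comparison_function h" and h_at_0: "filterlim h at_top (at_right 0)"
    and R: "\<And>n. real (q (Suc n)) < R * real (q n)"
    and C: "C > 1" and D: "D > 0"
    and D_deriv: "\<And>s. D * (real (q s) * h (1 / (2 * real (q s)))) \<le> - deriv h (1 / (C ^ 4 * real (q s)))"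
    and D_ratio: "\<And>s. D * h (1 / (2 * real (q (Suc s)))) \<le> h (1 / (2 * real (q s)))"
begin

text \<open>The size of \<open>h\<close> and the order of the derivative sums at the scale of the \<open>s\<close>-th denominator.\<close>

definition hq :: "nat \<Rightarrow> real" where "hq s = h (1 / (2 * real (q s)))"

definition H :: "nat \<Rightarrow> real" where "H s = real (q s) * hq s"

lemma q_ge_1: "1 \<le> real (q s)"
  using q_pos[of s] by linarith

lemma R_pos: "R > 1"
proof -
  have "1 * real (q 0) < R * real (q 0)" using R[of 0] q_less[of 0 "Suc 0"] by linarith
  then show ?thesis using q_0 by simp
qed

lemma inverse_q_in:
  assumes "1 < K"
  shows "0 < 1 / (K * real (q s))" "1 / (K * real (q s)) < 1"
proof -
  have "1 < K * real (q s)" using mult_mono[of 1 K 1 "real (q s)"] q_ge_1[of s] assms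
    by (metis less_le_trans mult.right_neutral mult_left_mono le_less_trans less_imp_le order.strict_trans2 zero_less_one)
  then show "0 < 1 / (K * real (q s))" "1 / (K * real (q s)) < 1" by auto
qed

lemma h_inverse_mono:
  assumes "1 < K" "K * real (q r) \<le> L * real (q s)"
  shows "h (1 / (K * real (q r))) \<le> h (1 / (L * real (q s)))"
proof (rule comparison_antimono[OF h])
  have "0 < K * real (q r)" using assms(1) q_pos[of r] by simp
  with assms(2) show "0 < 1 / (L * real (q s))" "1 / (L * real (q s)) \<le> 1 / (K * real (q r))"
    by (auto intro!: divide_left_mono)
qed (rule inverse_q_in[OF assms(1)])

lemma hq_pos: "0 < hq s"
  unfolding hq_def using inverse_q_in[of 2 s] by (intro comparison_pos[OF h]) auto

lemma H_pos: "0 < H s"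
  unfolding H_def using hq_pos[of s] q_pos[of s] by simp

lemma hq_mono: "r \<le> s \<Longrightarrow> hq r \<le> hq s"
  unfolding hq_def using q_le[of r s] by (intro h_inverse_mono) auto

lemma H_mono: "r \<le> s \<Longrightarrow> H r \<le> H s"
  unfolding H_def using q_le[of r s] hq_mono[of r s] hq_pos[of r] by (intro mult_mono) auto

lemma hq_at_top: "filterlim hq at_top sequentially"
proof -
  have "filterlim (\<lambda>s. 2 * real (q s)) at_top sequentially"
    by (rule filterlim_tendsto_pos_mult_at_top[OF tendsto_const _ filterlim_q]) simp
  then have "filterlim (\<lambda>s. inverse (2 * real (q s))) (at_right 0) sequentially"
    by (rule filterlim_compose[OF filterlim_inverse_at_right_top])
  then show ?thesis
    unfolding hq_def[abs_def] using filterlim_compose[OF h_at_0] by (simp add: inverse_eq_divide)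
qed

lemma H_at_top: "filterlim H at_top sequentially"
  by (rule filterlim_at_top_mono[OF hq_at_top])
    (use q_ge_1 hq_pos in \<open>auto simp: H_def intro!: always_eventually\<close>)

lemma D_power: "D ^ j * hq (s + j) \<le> hq s"
proof (induction j)
  case (Suc j)
  have "D ^ Suc j * hq (s + Suc j) = D ^ j * (D * hq (Suc (s + j)))" by simp
  also have "\<dots> \<le> D ^ j * hq (s + j)" using D D_ratio[of "s + j"] by (intro mult_left_mono) (auto simp: hq_def)
  also note Suc
  finally show ?case .
qed simp

lemma H_ratio: "D / R * H (Suc s) \<le> H s"
proof -
  have "D * hq (Suc s) * real (q (Suc s)) \<le> hq s * (R * real (q s))"
    using D_ratio[of s] R[of s] D hq_pos[of "Suc s"] hq_pos[of s] by (intro mult_mono) (auto simp: hq_def)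
  then show ?thesis using R_pos by (simp add: H_def field_simps)
qed

lemma H_ratio_power: "(D / R) ^ j * H (s + j) \<le> H s"
proof (induction j)
  case (Suc j)
  have "(D / R) ^ Suc j * H (s + Suc j) = (D / R) ^ j * (D / R * H (Suc (s + j)))" by simp
  also have "\<dots> \<le> (D / R) ^ j * H (s + j)"
    using D R_pos by (intro mult_left_mono H_ratio) auto
  also note Suc
  finally show ?case .
qed simp

text \<open>
  Changing the argument of \<open>h\<close> or \<open>h'\<close> by a constant factor amounts to a bounded number of steps
  along the denominators, each of which changes \<open>hq\<close> and \<open>H\<close> by a bounded factor only.
\<close>

lemma doubling:
  assumes K: "1 < K"
  obtains K' where "K' > 0" "\<And>s. h (1 / (K * real (q s))) \<le> K' * hq s"
proof -
  obtain j where j: "\<And>s. K * real (q s) \<le> real (q (s + j))" using q_growth_factor[of K] by blast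
  show ?thesis
  proof
    show "1 / D ^ j > 0" using D by simp
    fix s
    have "h (1 / (K * real (q s))) \<le> hq (s + j)"
      unfolding hq_def using j[of s] q_pos[of "s + j"] by (intro h_inverse_mono[OF K]) linarith
    also have "\<dots> \<le> 1 / D ^ j * hq s" using D_power[of j s] D by (simp add: field_simps)
    finally show "h (1 / (K * real (q s))) \<le> 1 / D ^ j * hq s" .
  qed
qed

lemma deriv_upper:
  assumes K: "1 < K"
  obtains K' where "K' > 0" "\<And>s. - deriv h (1 / (K * real (q s))) \<le> K' * H s"
proof -
  obtain K' where K': "K' > 0" "\<And>s. h (1 / (2 * K * real (q s))) \<le> K' * hq s"
    using doubling[of "2 * K"] K by auto
  show ?thesis
  proof
    show "2 * K * K' > 0" using K K' by simp
    fix s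
    have "- deriv h (1 / (K * real (q s))) \<le> 2 / (1 / (K * real (q s))) * h (1 / (K * real (q s)) / 2)"
      by (rule comparison_deriv_le[OF h inverse_q_in[OF K]])
    also have "\<dots> = 2 * K * real (q s) * h (1 / (2 * K * real (q s)))" by (simp add: mult_ac)
    also have "\<dots> \<le> 2 * K * real (q s) * (K' * hq s)" using K by (intro mult_left_mono K') auto
    finally show "- deriv h (1 / (K * real (q s))) \<le> 2 * K * K' * H s" by (simp add: H_def mult_ac)
  qed
qed

lemma deriv_lower:
  assumes K: "0 < K"
  obtains c s\<^sub>0 where "c > 0" "\<And>s. s \<ge> s\<^sub>0 \<Longrightarrow> K / real (q s) < 1 \<and> c * H s \<le> - deriv h (K / real (q s))"
proof -
  obtain j where j: "\<And>s. K * C ^ 4 * real (q s) \<le> real (q (s + j))" using q_growth_factor[of "K * C ^ 4"] by blast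
  show ?thesis
  proof
    show "D * (D / R) ^ j > 0" using D R_pos by simp
    fix s assume "s \<ge> j"
    then obtain t where t: "s = t + j" by (metis le_add_diff_inverse2)
    have C4: "1 < C ^ 4" using C by simp
    have le: "K / real (q s) \<le> 1 / (C ^ 4 * real (q t))"
    proof -
      define Z where "Z = C ^ 4 * real (q t)"
      have "0 < Z" using C q_pos[of t] by (simp add: Z_def)
      moreover have "K * Z \<le> real (q s)" using j[of t] by (simp add: Z_def t mult_ac)
      ultimately show ?thesis using q_pos[of s] unfolding Z_def[symmetric] by (simp add: field_simps)
    qed
    have "0 < K / real (q s)" using K q_pos[of s] by simp
    then have "- deriv h (1 / (C ^ 4 * real (q t))) \<le> - deriv h (K / real (q s))"
      using comparison_deriv_mono[OF h _ le inverse_q_in(2)[OF C4]] by simp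
    moreover have "K / real (q s) < 1" using le inverse_q_in(2)[OF C4, of t] by linarith
    moreover have "D * ((D / R) ^ j * H s) \<le> D * H t"
      using H_ratio_power[of j t] D by (intro mult_left_mono) (auto simp: t)
    moreover have "D * H t \<le> - deriv h (1 / (C ^ 4 * real (q t)))"
      using D_deriv[of t] by (simp add: H_def hq_def)
    ultimately show "K / real (q s) < 1 \<and> D * (D / R) ^ j * H s \<le> - deriv h (K / real (q s))"
      by (simp add: mult.assoc)
  qed
qed

text \<open>
  The lower bound on the derivative forces \<open>h\<close> to grow by a definite factor over a bounded
  number of scales, so \<open>h\<close> grows like a power along the denominators.
\<close>

lemma power_growth:
  obtains c L where "c > 1" "L \<ge> 2" "\<And>r s. L * real (q r) \<le> real (q s) \<Longrightarrow> c * hq r \<le> hq s"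
proof -
  define u where "u = min (1/2) (1 / C ^ 4)"
  have C4: "1 < C ^ 4" using C by simp
  have u: "0 < u" "u \<le> 1/2" "u \<le> 1 / C ^ 4" using C4 by (auto simp: u_def)
  show ?thesis
  proof
    show "1 + D * u / 2 > 1" using D u by simp
    show "1 / u \<ge> 2" using u by (simp add: field_simps)
    fix r s assume rs: "1 / u * real (q r) \<le> real (q s)"
    define y where "y = u / real (q r)"
    have y0: "0 < y" using u q_pos[of r] by (simp add: y_def)
    have y1: "y \<le> 1 / (C ^ 4 * real (q r))" "y \<le> 1 / (2 * real (q r))"
      using u q_pos[of r] C4 by (auto simp: y_def field_simps)
    have y2: "y < 1" using y1(2) inverse_q_in[of 2 r] by linarith
    have "D * (real (q r) * hq r) \<le> - deriv h y"
      using D_deriv[of r] comparison_deriv_mono[OF h y0 y1(1) inverse_q_in(2)[OF C4]] by (simp add: hq_def)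
    then have "y / 2 * (D * (real (q r) * hq r)) \<le> y / 2 * - deriv h y"
      using y0 by (intro mult_left_mono) auto
    also have "y / 2 * - deriv h y = (y - y / 2) * - deriv h y" by simp
    also have "\<dots> \<le> h (y / 2) - h y" using y0 y2 by (intro comparison_diff(1)[OF h]) auto
    finally have "D * u / 2 * hq r \<le> h (y / 2) - h y" using q_pos[of r] by (simp add: y_def field_simps)
    moreover have "hq r \<le> h y" unfolding hq_def
      using y0 y1 inverse_q_in[of 2 r] by (intro comparison_antimono[OF h]) auto
    moreover have "h (y / 2) \<le> hq s" unfolding hq_def
    proof (rule comparison_antimono[OF h])
      show "1 / (2 * real (q s)) \<le> y / 2"
        using rs u q_pos[of r] q_pos[of s] by (simp add: y_def field_simps)
    qed (use q_pos[of s] y2 y0 in auto)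
    ultimately show "(1 + D * u / 2) * hq r \<le> hq s" by (simp add: algebra_simps)
  qed
qed

text \<open>Iterating the growth by the factor \<open>c\<close>, and read backwards in the scales.\<close>

lemma decay:
  assumes \<rho>: "0 < \<rho>"
  obtains K where "K > 0" "\<And>r s. K * real (q r) \<le> real (q s) \<Longrightarrow> hq r \<le> \<rho> * hq s"
proof -
  obtain c L where c: "c > 1" "L \<ge> 2" "\<And>r s. L * real (q r) \<le> real (q s) \<Longrightarrow> c * hq r \<le> hq s"
    by (rule power_growth) blast
  have power: "(L * R) ^ n * real (q r) \<le> real (q s) \<Longrightarrow> c ^ n * hq r \<le> hq s" for n r s
  proof (induction n arbitrary: r)
    case 0
    then have "r \<le> s" using q_less[of s r] by (cases "r \<le> s") auto
    then show ?case using hq_mono by simp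
  next
    case (Suc n)
    have "1 * 1 \<le> L * real (q r)" using q_ge_1[of r] c(2) by (intro mult_mono) auto
    then obtain t where t: "real (q t) \<le> L * real (q r)" "L * real (q r) < real (q (Suc t))"
      using q_bracket by auto
    have "real (q (Suc t)) \<le> L * R * real (q r)"
    proof -
      have "R * real (q t) \<le> R * (L * real (q r))" using t(1) R_pos by (intro mult_left_mono) auto
      then show ?thesis using R[of t] by (simp add: algebra_simps)
    qed
    then have "(L * R) ^ n * real (q (Suc t)) \<le> (L * R) ^ n * (L * R * real (q r))"
      using c(2) R_pos by (intro mult_left_mono) auto
    also have "\<dots> \<le> real (q s)" using Suc.prems by (simp add: mult_ac)
    finally have "c ^ n * hq (Suc t) \<le> hq s" by (rule Suc.IH)
    moreover have "c ^ n * (c * hq r) \<le> c ^ n * hq (Suc t)"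
      using c t by (intro mult_left_mono) auto
    ultimately show ?case by (simp add: mult_ac)
  qed
  obtain n where n: "1 / \<rho> < c ^ n" using real_arch_pow[OF c(1)] by blast
  show ?thesis
  proof
    show "(L * R) ^ n > 0" using c(2) R_pos by simp
    fix r s assume "(L * R) ^ n * real (q r) \<le> real (q s)"
    then have "c ^ n * hq r \<le> hq s" by (rule power)
    moreover have "1 / \<rho> * hq r \<le> c ^ n * hq r" using n hq_pos[of r] by (intro mult_right_mono) auto
    ultimately have "1 / \<rho> * hq r \<le> hq s" by linarith
    then show "hq r \<le> \<rho> * hq s" using \<rho> by (simp add: field_simps)
  qed
qed

text \<open>The right-hand side of \<open>orbit_deriv_sum\<close> for \<open>h\<close>, at the distance kept from strong singularities.\<close>

lemma scale_sum_bound: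
  obtains K where "K > 0"
    "\<And>s. 2 * (- deriv h (1 / (4 * C * real (q s))) + 8 * real (q s) * h (1 / (8 * real (q s)))) \<le> K * H s"
proof -
  obtain K1 where K1: "K1 > 0" "\<And>s. - deriv h (1 / (4 * C * real (q s))) \<le> K1 * H s"
    using deriv_upper[of "4 * C"] C by auto
  obtain K2 where K2: "K2 > 0" "\<And>s. h (1 / (8 * real (q s))) \<le> K2 * hq s"
    using doubling[of 8] by auto
  show ?thesis
  proof
    show "2 * (K1 + 8 * K2) > 0" using K1 K2 by simp
    fix s
    have "8 * real (q s) * h (1 / (8 * real (q s))) \<le> 8 * real (q s) * (K2 * hq s)"
      by (intro mult_left_mono K2) auto
    then show "2 * (- deriv h (1 / (4 * C * real (q s))) + 8 * real (q s) * h (1 / (8 * real (q s)))) \<le> 2 * (K1 + 8 * K2) * H s"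
      using K1(2)[of s] by (simp add: H_def algebra_simps)
  qed
qed

text \<open>A weaker singularity contributes nothing at the scale \<open>H\<close> away from its \<open>\<xi> s\<close>-neighbourhood.\<close>

lemma negligible_sum:
  assumes g: "comparison_function g" and gh: "((\<lambda>y. g y / h y) \<longlongrightarrow> 0) (at_right 0)"
    and lim: "(\<lambda>s. deriv g (\<xi> s) / deriv h (1 / (2 * real (q s)))) \<longlonglongrightarrow> 0"
  shows "(\<lambda>s. 2 * (- deriv g (\<xi> s) + 8 * real (q s) * g (1 / (8 * real (q s)))) / H s) \<longlonglongrightarrow> 0"
proof -
  obtain K1 where K1: "K1 > 0" "\<And>s. - deriv h (1 / (2 * real (q s))) \<le> K1 * H s"
    using deriv_upper[of 2] by auto
  obtain K2 where K2: "K2 > 0" "\<And>s. h (1 / (8 * real (q s))) \<le> K2 * hq s"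
    using doubling[of 8] by auto
  obtain c s\<^sub>0 where c: "c > 0"
    "\<And>s. s \<ge> s\<^sub>0 \<Longrightarrow> 1 / 2 / real (q s) < 1 \<and> c * H s \<le> - deriv h (1 / 2 / real (q s))"
    using deriv_lower[of "1/2"] by auto
  have "(\<lambda>s. (deriv g (\<xi> s) / deriv h (1 / (2 * real (q s)))) * (deriv h (1 / (2 * real (q s))) / H s)) \<longlonglongrightarrow> 0"
  proof (rule lim_null_mult_right_bounded[OF lim])
    show "\<forall>\<^sub>F s in sequentially. norm (deriv h (1 / (2 * real (q s))) / H s) \<le> K1"
    proof (rule always_eventually, rule allI)
      fix s
      have "deriv h (1 / (2 * real (q s))) \<le> 0"
        using comparison_deriv_nonpos[OF h inverse_q_in[of 2 s]] by simp
      then show "norm (deriv h (1 / (2 * real (q s))) / H s) \<le> K1"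
        using K1(2)[of s] H_pos[of s] by (simp add: field_simps)
    qed
  qed
  moreover have "\<forall>\<^sub>F s in sequentially.
      (deriv g (\<xi> s) / deriv h (1 / (2 * real (q s)))) * (deriv h (1 / (2 * real (q s))) / H s) = deriv g (\<xi> s) / H s"
  proof (rule eventually_sequentiallyI[of s\<^sub>0])
    fix s assume "s \<ge> s\<^sub>0"
    then have "deriv h (1 / (2 * real (q s))) \<noteq> 0" using c(2)[of s] c(1) mult_pos_pos[OF c(1) H_pos[of s]] by auto
    then show "(deriv g (\<xi> s) / deriv h (1 / (2 * real (q s)))) * (deriv h (1 / (2 * real (q s))) / H s) = deriv g (\<xi> s) / H s"
      by simp
  qed
  ultimately have 1: "(\<lambda>s. deriv g (\<xi> s) / H s) \<longlonglongrightarrow> 0"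
    by (rule Lim_transform_eventually)
  have "filterlim (\<lambda>s. 8 * real (q s)) at_top sequentially"
    by (rule filterlim_tendsto_pos_mult_at_top[OF tendsto_const _ filterlim_q]) simp
  then have "filterlim (\<lambda>s. inverse (8 * real (q s))) (at_right 0) sequentially"
    by (rule filterlim_compose[OF filterlim_inverse_at_right_top])
  then have "(\<lambda>s. g (inverse (8 * real (q s))) / h (inverse (8 * real (q s)))) \<longlonglongrightarrow> 0"
    by (rule filterlim_compose[OF gh])
  then have lim2: "(\<lambda>s. g (1 / (8 * real (q s))) / h (1 / (8 * real (q s)))) \<longlonglongrightarrow> 0"
    by (simp only: inverse_eq_divide)
  have "(\<lambda>s. g (1 / (8 * real (q s))) / h (1 / (8 * real (q s))) * (h (1 / (8 * real (q s))) / hq s)) \<longlonglongrightarrow> 0"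
  proof (rule lim_null_mult_right_bounded[OF lim2])
    show "\<forall>\<^sub>F s in sequentially. norm (h (1 / (8 * real (q s))) / hq s) \<le> K2"
    proof (rule always_eventually, rule allI)
      fix s
      have "0 < h (1 / (8 * real (q s)))" using comparison_pos[OF h inverse_q_in[of 8 s]] by simp
      then show "norm (h (1 / (8 * real (q s))) / hq s) \<le> K2"
        using K2(2)[of s] hq_pos[of s] by (simp add: field_simps)
    qed
  qed
  moreover have "g (1 / (8 * real (q s))) / h (1 / (8 * real (q s))) * (h (1 / (8 * real (q s))) / hq s)
      = real (q s) * g (1 / (8 * real (q s))) / H s" for s
    using comparison_pos[OF h inverse_q_in[of 8 s]] q_pos[of s] by (simp add: H_def)
  ultimately have 2: "(\<lambda>s. real (q s) * g (1 / (8 * real (q s))) / H s) \<longlonglongrightarrow> 0" by simp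
  have "(\<lambda>s. 2 * (- (deriv g (\<xi> s) / H s) + 8 * (real (q s) * g (1 / (8 * real (q s))) / H s))) \<longlonglongrightarrow> 2 * (- 0 + 8 * 0)"
    by (intro tendsto_intros 1 2)
  moreover have "2 * (- (deriv g (\<xi> s) / H s) + 8 * (real (q s) * g (1 / (8 * real (q s))) / H s))
      = 2 * (- deriv g (\<xi> s) + 8 * real (q s) * g (1 / (8 * real (q s)))) / H s" for s
    using H_pos[of s] by (simp add: field_simps)
  ultimately show ?thesis by simp
qed

end

section \<open>The roof function near its singularities\<close>

text \<open>
  The singularities with indices up to \<open>v\<close> are the weak ones, with comparison functions \<open>g i\<close>,
  and the others are the strong ones.
\<close>

locale singular_roof = comparison_scale +
  fixes k v :: nat and a A B :: "nat \<Rightarrow> real" and f :: "real \<Rightarrow> real"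
    and g :: "nat \<Rightarrow> real \<Rightarrow> real" and \<xi> :: "nat \<Rightarrow> nat \<Rightarrow> real"
  assumes a_circle: "\<And>i. i \<in> {1..k} \<Longrightarrow> a i \<in> {0..<1}"
    and f_periodic: "\<And>y. f (y + 1) = f y"
    and f_smooth: "C2_on {y. frac y \<notin> a ` {1..k}} f"
    and f_pos: "\<And>y. f y > 0"
    and f_integrable: "integrable circle f"
    and f_type: "\<And>i. i \<in> {1..k} \<Longrightarrow> singularity_of_type f (a i) h (A i) (B i)"
    and v_less: "v < k"
    and E: "\<And>i. i \<in> {v+1..k} \<Longrightarrow> (A i)\<^sup>2 + (B i)\<^sup>2 > 0"
    and F_comparison: "\<And>i. i \<in> {1..v} \<Longrightarrow> comparison_function (g i)"
    and F_type: "\<And>i. i \<in> {1..v} \<Longrightarrow> \<exists>A' B'. singularity_of_type f (a i) (g i) A' B'"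
    and F_small: "\<And>i. i \<in> {1..v} \<Longrightarrow> ((\<lambda>y. g i y / h y) \<longlongrightarrow> 0) (at_right 0)"
    and F_\<xi>: "\<And>i s. i \<in> {1..v} \<Longrightarrow> \<xi> i s \<in> {0<..<1}"
    and F_\<xi>_lower: "\<And>i s. i \<in> {1..v} \<Longrightarrow> \<xi> i s > 1 / (real (q s) * h (1 / (2 * real (q s))))"
    and F_\<xi>_limit: "\<And>i. i \<in> {1..v} \<Longrightarrow>
          (\<lambda>s. deriv (g i) (\<xi> i s) / deriv h (1 / (2 * real (q s)))) \<longlonglongrightarrow> 0"
    and F_\<xi>_summable: "\<And>i. i \<in> {1..v} \<Longrightarrow> summable (\<lambda>s. real (q s) * \<xi> i s)"
    and bad: "badly_approximable \<alpha> q C (a ` {v+1..k})"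
begin

lemma f_add_of_int [simp]: "f (y + of_int m) = f y"
  by (rule periodic_add_of_int[of f, OF f_periodic])

lemma deriv_f_add_of_int [simp]: "deriv f (y + of_int m) = deriv f y"
proof -
  have "(f has_real_derivative D) (at (y + of_int m)) \<longleftrightarrow> (f has_real_derivative D) (at y)" for D
    using DERIV_shift[of f D y "of_int m"] by simp
  then show ?thesis by (simp add: deriv_def)
qed

definition regular :: "real set" where "regular = {y. frac y \<notin> a ` {1..k}}"

lemma regular_iff: "y \<in> regular \<longleftrightarrow> (\<forall>i\<in>{1..k}. 0 < circle_norm (y - a i))"
proof -
  have "frac y = a i \<longleftrightarrow> circle_norm (y - a i) = 0" if "i \<in> {1..k}" for i
  proof -
    have "frac (a i) = a i" using a_circle[OF that] by (simp add: frac_eq)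
    then have "circle_norm (y - a i) = circle_dist (frac y) (a i)"
      using circle_dist_frac[of y "a i"] by simp
    then show ?thesis
      using circle_dist_eq_0_iff[of "frac y" "a i"] a_circle[OF that] by (simp add: frac_lt_1)
  qed
  then show ?thesis unfolding regular_def using circle_norm_nonneg
    by (auto simp: less_le image_iff)
qed

lemma f_DERIV: "y \<in> regular \<Longrightarrow> (f has_real_derivative deriv f y) (at y)"
  unfolding regular_def by (rule C1_has_real_derivative[OF f_smooth])

lemma deriv_f_continuous: "continuous_on regular (deriv f)"
  unfolding regular_def by (rule C2_continuous_deriv[OF f_smooth])

definition G :: "nat \<Rightarrow> real \<Rightarrow> real" where "G i = (if i \<le> v then g i else h)"

lemma G_comparison: "i \<in> {1..k} \<Longrightarrow> comparison_function (G i)"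
  using F_comparison h by (auto simp: G_def)

lemma G_type: "i \<in> {1..k} \<Longrightarrow> \<exists>A' B'. singularity_of_type f (a i) (G i) A' B'"
  using F_type f_type by (auto simp: G_def)

text \<open>
  The constant \<open>1\<close> accounts for the part of the circle away from the singularities, where \<open>f'\<close>
  need not be small when all the \<open>G i\<close> have derivative zero.
\<close>

definition majorant :: "real \<Rightarrow> real" where
  "majorant y = 1 + (\<Sum>i\<in>{1..k}. - deriv (G i) (circle_norm (y - a i)))"

lemma G_deriv_nonneg: "i \<in> {1..k} \<Longrightarrow> y \<in> regular \<Longrightarrow> 0 \<le> - deriv (G i) (circle_norm (y - a i))"
proof -
  assume i: "i \<in> {1..k}" and "y \<in> regular"
  then have "0 < circle_norm (y - a i)" "circle_norm (y - a i) < 1"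
    using circle_norm_le_half[of "y - a i"] by (auto simp: regular_iff)
  then show ?thesis using comparison_deriv_nonpos[OF G_comparison[OF i]] by simp
qed

lemma majorant_ge: "y \<in> regular \<Longrightarrow> 1 \<le> majorant y"
  unfolding majorant_def le_add_same_cancel1 by (rule sum_nonneg) (rule G_deriv_nonneg)

lemma majorant_ge_deriv:
  assumes "i \<in> {1..k}" "y \<in> regular"
  shows "- deriv (G i) (circle_norm (y - a i)) \<le> majorant y"
proof -
  have "- deriv (G i) (circle_norm (y - a i)) \<le> (\<Sum>i\<in>{1..k}. - deriv (G i) (circle_norm (y - a i)))"
    using assms G_deriv_nonneg by (intro member_le_sum) auto
  then show ?thesis by (simp add: majorant_def)
qed

lemma one_sided_ratio_bound:
  fixes w :: "real \<Rightarrow> real"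
  assumes "((\<lambda>y. deriv f y / deriv (G i) (w y)) \<longlongrightarrow> L) F"
    and "\<forall>\<^sub>F y in F. deriv (G i) (w y) \<noteq> 0"
  shows "\<forall>\<^sub>F y in F. \<bar>deriv f y\<bar> \<le> (\<bar>L\<bar> + 1) * \<bar>deriv (G i) (w y)\<bar>"
proof -
  have "\<forall>\<^sub>F y in F. dist (deriv f y / deriv (G i) (w y)) L < 1"
    using assms(1) by (rule tendstoD) simp
  with assms(2) show ?thesis
  proof eventually_elim
    case (elim y)
    have "\<bar>deriv f y / deriv (G i) (w y)\<bar> \<le> \<bar>L\<bar> + 1" using elim(2) by (auto simp: dist_real_def)
    with elim(1) show ?case by (simp add: abs_divide field_simps)
  qed
qed

lemma deriv_bound_near_singularity:
  assumes i: "i \<in> {1..k}"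
  shows "\<exists>\<delta>>0. \<exists>K. \<forall>z\<in>regular. \<bar>z - a i\<bar> < \<delta> \<longrightarrow> \<bar>deriv f z\<bar> \<le> K * majorant z"
proof -
  obtain A' B' where "singularity_of_type f (a i) (G i) A' B'" using G_type[OF i] by blast
  then have nz: "\<forall>\<^sub>F x in at_right 0. deriv (G i) x \<noteq> 0"
    and r: "((\<lambda>x. deriv f x / deriv (G i) (x - a i)) \<longlongrightarrow> A') (at_right (a i))"
    and l: "((\<lambda>x. deriv f x / deriv (G i) (a i - x)) \<longlongrightarrow> - B') (at_left (a i))"
    by (auto simp: singularity_of_type_def)
  obtain e where e: "e > 0" "\<And>x. 0 < x \<Longrightarrow> x < e \<Longrightarrow> deriv (G i) x \<noteq> 0"
    using nz unfolding eventually_at_right[of 0 "1::real", simplified] by auto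
  have nzr: "\<forall>\<^sub>F x in at_right (a i). deriv (G i) (x - a i) \<noteq> 0"
    unfolding eventually_at_right[of "a i" "a i + 1", simplified] using e by (intro exI[of _ "a i + e"]) auto
  have nzl: "\<forall>\<^sub>F x in at_left (a i). deriv (G i) (a i - x) \<noteq> 0"
    unfolding eventually_at_left[of "a i - 1" "a i", simplified] using e by (intro exI[of _ "a i - e"]) auto
  obtain b where b: "b > a i" "\<And>y. a i < y \<Longrightarrow> y < b \<Longrightarrow> \<bar>deriv f y\<bar> \<le> (\<bar>A'\<bar> + 1) * \<bar>deriv (G i) (y - a i)\<bar>"
    using one_sided_ratio_bound[OF r nzr] unfolding eventually_at_right[of "a i" "a i + 1", simplified] by blast
  obtain c where c: "c < a i" "\<And>y. c < y \<Longrightarrow> y < a i \<Longrightarrow> \<bar>deriv f y\<bar> \<le> (\<bar>- B'\<bar> + 1) * \<bar>deriv (G i) (a i - y)\<bar>"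
    using one_sided_ratio_bound[OF l nzl] unfolding eventually_at_left[of "a i - 1" "a i", simplified] by blast
  define K where "K = \<bar>A'\<bar> + \<bar>B'\<bar> + 1"
  show ?thesis
  proof (rule exI[of _ "min (1/2) (min (b - a i) (a i - c))"], rule conjI[OF _ exI[of _ K]], goal_cases)
    case 1 then show ?case using b c by auto
  next
    case 2
    show ?case
    proof (intro ballI impI)
    fix z assume z: "z \<in> regular" "\<bar>z - a i\<bar> < min (1/2) (min (b - a i) (a i - c))"
    have n: "circle_norm (z - a i) = \<bar>z - a i\<bar>" using z by (intro circle_norm_eq_abs) auto
    have "0 < circle_norm (z - a i)" using z(1) i unfolding regular_iff by blast
    then have "z \<noteq> a i" using n by auto
    then have "\<bar>deriv f z\<bar> \<le> K * \<bar>deriv (G i) \<bar>z - a i\<bar>\<bar>"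
    proof (cases "z > a i")
      case True
      then have "\<bar>deriv f z\<bar> \<le> (\<bar>A'\<bar> + 1) * \<bar>deriv (G i) \<bar>z - a i\<bar>\<bar>" using b(2)[of z] z(2) by auto
      also have "\<dots> \<le> K * \<bar>deriv (G i) \<bar>z - a i\<bar>\<bar>" by (intro mult_right_mono) (auto simp: K_def)
      finally show ?thesis .
    next
      case False
      with \<open>z \<noteq> a i\<close> have "z < a i" by simp
      then have "\<bar>deriv f z\<bar> \<le> (\<bar>B'\<bar> + 1) * \<bar>deriv (G i) \<bar>z - a i\<bar>\<bar>" using c(2)[of z] z(2) by auto
      also have "\<dots> \<le> K * \<bar>deriv (G i) \<bar>z - a i\<bar>\<bar>" by (intro mult_right_mono) (auto simp: K_def)
      finally show ?thesis .
    qed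
    also have "\<bar>deriv (G i) \<bar>z - a i\<bar>\<bar> \<le> majorant z"
      using majorant_ge_deriv[OF i z(1)] G_deriv_nonneg[OF i z(1)] unfolding n by simp
    finally show "\<bar>deriv f z\<bar> \<le> K * majorant z" by (simp add: mult_left_mono K_def)
    qed
  qed
qed

lemma majorant_add_of_int [simp]: "majorant (y + of_int m) = majorant y"
proof -
  have "circle_norm (y + of_int m - a i) = circle_norm (y - a i)" for i
    by (rule circle_norm_cong[of _ _ m]) simp
  then show ?thesis by (simp add: majorant_def)
qed

lemma regular_add_of_int [simp]: "y + of_int m \<in> regular \<longleftrightarrow> y \<in> regular"
  by (simp add: regular_def frac_add_of_int)

text \<open>
  By compactness of the circle a local bound suffices: at regular points it is the continuity of
  \<open>f'\<close>, and at a singularity the type of the singularity.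
\<close>

lemma deriv_bound:
  obtains K where "K > 0" "\<And>z. z \<in> regular \<Longrightarrow> \<bar>deriv f z\<bar> \<le> K * majorant z"
proof -
  have local: "\<exists>\<delta>>0. \<exists>K. \<forall>z\<in>regular. \<bar>z - w\<bar> < \<delta> \<longrightarrow> \<bar>deriv f z\<bar> \<le> K * majorant z" for w
  proof (cases "w \<in> regular")
    case True
    obtain \<delta> where \<delta>: "\<delta> > 0" "\<And>z. z \<in> regular \<Longrightarrow> dist z w < \<delta> \<Longrightarrow> dist (deriv f z) (deriv f w) < 1"
      using deriv_f_continuous True unfolding continuous_on_iff by (metis zero_less_one)
    show ?thesis
    proof (rule exI[of _ \<delta>], rule conjI[OF \<delta>(1) exI[of _ "\<bar>deriv f w\<bar> + 1"]], intro ballI impI)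
      fix z assume z: "z \<in> regular" "\<bar>z - w\<bar> < \<delta>"
      then have "\<bar>deriv f z\<bar> \<le> (\<bar>deriv f w\<bar> + 1) * 1" using \<delta>(2)[of z] by (auto simp: dist_real_def)
      also have "\<dots> \<le> (\<bar>deriv f w\<bar> + 1) * majorant z" using majorant_ge[OF z(1)] by (intro mult_left_mono) auto
      finally show "\<bar>deriv f z\<bar> \<le> (\<bar>deriv f w\<bar> + 1) * majorant z" .
    qed
  next
    case False
    then obtain i where i: "i \<in> {1..k}" "frac w = a i" by (auto simp: regular_def)
    define m where "m = \<lfloor>w\<rfloor>"
    have w: "w = a i + of_int m" using i(2) by (simp add: frac_def m_def)
    obtain \<delta> K where \<delta>: "\<delta> > 0" "\<And>z. z \<in> regular \<Longrightarrow> \<bar>z - a i\<bar> < \<delta> \<Longrightarrow> \<bar>deriv f z\<bar> \<le> K * majorant z"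
      using deriv_bound_near_singularity[OF i(1)] by blast
    show ?thesis
    proof (rule exI[of _ \<delta>], rule conjI[OF \<delta>(1) exI[of _ K]], intro ballI impI)
      fix z assume z: "z \<in> regular" "\<bar>z - w\<bar> < \<delta>"
      have "\<bar>deriv f (z + of_int (- m))\<bar> \<le> K * majorant (z + of_int (- m))"
        using z by (intro \<delta>(2)) (simp_all only: regular_add_of_int, simp add: w algebra_simps)
      then show "\<bar>deriv f z\<bar> \<le> K * majorant z" by (simp only: deriv_f_add_of_int majorant_add_of_int)
    qed
  qed
  then obtain \<delta> K where \<delta>: "\<And>w. \<delta> w > 0"
    "\<And>w z. z \<in> regular \<Longrightarrow> \<bar>z - w\<bar> < \<delta> w \<Longrightarrow> \<bar>deriv f z\<bar> \<le> K w * majorant z"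
    by metis
  have cover: "{0..1} \<subseteq> (\<Union>w\<in>{0..1}. ball w (\<delta> w))"
    using \<delta>(1) by force
  obtain W where W: "finite W" "{0..1} \<subseteq> (\<Union>w\<in>W. ball w (\<delta> w))"
    by (rule compactE_image[OF compact_Icc _ cover]) auto
  show ?thesis
  proof
    show "1 + (\<Sum>w\<in>W. \<bar>K w\<bar>) > 0" by (simp add: add_pos_nonneg sum_nonneg)
    fix z assume z: "z \<in> regular"
    have fr: "frac z = z + of_int (- \<lfloor>z\<rfloor>)" by (simp add: frac_def)
    have zr: "frac z \<in> regular" using z unfolding fr regular_add_of_int .
    have "frac z \<in> {0..1}" using frac_lt_1[of z] by simp
    then obtain w where "w \<in> W" "frac z \<in> ball w (\<delta> w)" using W(2) by blast
    then have w: "w \<in> W" "\<bar>frac z - w\<bar> < \<delta> w"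
      by (simp_all add: dist_real_def abs_minus_commute)
    have "\<bar>deriv f (frac z)\<bar> \<le> K w * majorant (frac z)" by (rule \<delta>(2)[OF zr w(2)])
    also have "\<dots> \<le> (1 + (\<Sum>w\<in>W. \<bar>K w\<bar>)) * majorant (frac z)"
    proof (rule mult_right_mono)
      have "\<bar>K w\<bar> \<le> (\<Sum>w\<in>W. \<bar>K w\<bar>)" using W(1) w(1) by (intro member_le_sum) auto
      then show "K w \<le> 1 + (\<Sum>w\<in>W. \<bar>K w\<bar>)" by linarith
    qed (use majorant_ge[OF zr] in simp)
    finally show "\<bar>deriv f z\<bar> \<le> (1 + (\<Sum>w\<in>W. \<bar>K w\<bar>)) * majorant z"
      unfolding fr deriv_f_add_of_int majorant_add_of_int .
  qed
qed

text \<open>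
  At a strong singularity one of the two one-sided limits \<open>A i\<close>, \<open>B i\<close> is positive; \<open>\<sigma>\<close> is the
  sign of that side.
\<close>

lemma strong_side:
  obtains e \<sigma> c \<eta> where "e \<in> {v+1..k}" "\<sigma> = 1 \<or> \<sigma> = - (1::real)" "c > 0" "\<eta> > 0"
    "\<And>u. 0 < u \<Longrightarrow> u < \<eta> \<Longrightarrow> c * - deriv h u \<le> \<bar>deriv f (a e + \<sigma> * u)\<bar>"
proof -
  define e where "e = v + 1"
  have e: "e \<in> {v+1..k}" "e \<in> {1..k}" using v_less by (auto simp: e_def)
  have "(A e)\<^sup>2 + (B e)\<^sup>2 > 0" by (rule E[OF e(1)])
  then have ne: "A e \<noteq> 0 \<or> B e \<noteq> 0" by auto
  from f_type[OF e(2)] have AB: "0 \<le> A e" "0 \<le> B e"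
    and r: "((\<lambda>x. deriv f x / deriv h (x - a e)) \<longlongrightarrow> A e) (at_right (a e))"
    and l: "((\<lambda>x. deriv f x / deriv h (a e - x)) \<longlongrightarrow> - B e) (at_left (a e))"
    by (auto simp: singularity_of_type_def)
  have conclude: "c / 2 * - deriv h u \<le> \<bar>deriv f z\<bar>" if "c / 2 < \<bar>deriv f z / deriv h u\<bar>" "0 < u" "u < 1" for c u z
  proof -
    have "deriv h u \<le> 0" using that by (intro comparison_deriv_nonpos[OF h])
    show ?thesis
    proof (cases "deriv h u = 0")
      case False
      with \<open>deriv h u \<le> 0\<close> have "- deriv h u > 0" by simp
      moreover have "c / 2 < \<bar>deriv f z\<bar> / (- deriv h u)" using that(1) \<open>deriv h u \<le> 0\<close> by (simp add: abs_divide)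
      ultimately show ?thesis using pos_less_divide_eq[of "- deriv h u" "c / 2"] by (simp only: less_imp_le)
    qed simp
  qed
  show ?thesis
  proof (cases "A e = 0")
    case False
    with AB have Ae: "A e > 0" by simp
    then have "\<forall>\<^sub>F x in at_right (a e). A e / 2 < deriv f x / deriv h (x - a e)"
      by (intro order_tendstoD(1)[OF r]) simp
    then obtain b where b: "b > a e" "\<And>y. a e < y \<Longrightarrow> y < b \<Longrightarrow> A e / 2 < deriv f y / deriv h (y - a e)"
      unfolding eventually_at_right[of "a e" "a e + 1", simplified] by blast
    show ?thesis
    proof (rule that[of e 1 "A e / 2" "min 1 (b - a e)"])
      fix u assume u: "0 < u" "u < min 1 (b - a e)"
      have "A e / 2 < deriv f (a e + 1 * u) / deriv h u" using b(2)[of "a e + u"] u by simp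
      then have "A e / 2 < \<bar>deriv f (a e + 1 * u) / deriv h u\<bar>" by linarith
      then show "A e / 2 * - deriv h u \<le> \<bar>deriv f (a e + 1 * u)\<bar>"
        using u by (intro conclude) auto
    qed (use e Ae b in auto)
  next
    case True
    with AB ne have Be: "B e > 0" by simp
    then have "\<forall>\<^sub>F x in at_left (a e). deriv f x / deriv h (a e - x) < - (B e / 2)"
      by (intro order_tendstoD(2)[OF l]) simp
    then obtain b where b: "b < a e" "\<And>y. b < y \<Longrightarrow> y < a e \<Longrightarrow> deriv f y / deriv h (a e - y) < - (B e / 2)"
      unfolding eventually_at_left[of "a e - 1" "a e", simplified] by blast
    show ?thesis
    proof (rule that[of e "- 1" "B e / 2" "min 1 (a e - b)"])
      fix u assume u: "0 < u" "u < min 1 (a e - b)"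
      have "deriv f (a e + - 1 * u) / deriv h u < - (B e / 2)" using b(2)[of "a e - u"] u by simp
      then have "B e / 2 < \<bar>deriv f (a e + - 1 * u) / deriv h u\<bar>" by linarith
      then show "B e / 2 * - deriv h u \<le> \<bar>deriv f (a e + - 1 * u)\<bar>"
        using u by (intro conclude) auto
    qed (use e Be b in auto)
  qed
qed

text \<open>
  The infimum of \<open>f\<close> may be zero, but every orbit returns in bounded time to an interval
  on which \<open>f\<close> is bounded below.
\<close>

lemma roof_sum_linear_growth: "\<exists>c>0. \<exists>N. \<forall>n\<ge>N. \<forall>x. c * real n \<le> roof_sum \<alpha> f (int n) x"
proof -
  have "infinite {0<..<1::real}" by (simp add: infinite_Ioo)
  then obtain w where w: "w \<in> {0<..<1}" "w \<notin> a ` {1..k}"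
    by (metis finite_atLeastAtMost finite_imageI finite_subset subsetI)
  then have "w \<in> regular" by (simp add: regular_def frac_eq)
  then have "isCont f w" using f_DERIV DERIV_isCont by blast
  then have "\<forall>\<^sub>F y in at w. f w / 2 < f y" using f_pos[of w]
    by (intro order_tendstoD(1)[of f "f w"]) (auto simp: isCont_def)
  then obtain \<delta> where \<delta>: "\<delta> > 0" "\<And>y. y \<noteq> w \<Longrightarrow> dist y w < \<delta> \<Longrightarrow> f w / 2 < f y"
    unfolding eventually_at by auto
  have below: "f w / 2 \<le> f y" if "\<bar>y - w\<bar> < \<delta>" for y
    using \<delta>(2)[of y] that f_pos[of w] by (cases "y = w") (auto simp: dist_real_def)
  obtain s where s: "3 / \<delta> < real (q s)"
    using filterlim_q[unfolded filterlim_at_top_dense] by (meson eventually_sequentially order_refl)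
  define Q where "Q = q s"
  have Q: "Q > 0" "3 / real Q < \<delta>" using s q_pos[of s] \<delta>(1) by (auto simp: Q_def field_simps)
  have block: "f w / 2 \<le> roof_sum \<alpha> f (int Q) x" for x
  proof -
    obtain n m where n: "n \<in> {0..<int Q}" "w < x + of_int n * \<alpha> - of_int m" "x + of_int n * \<alpha> - of_int m < w + 3 / real Q"
      using density[of 0 s w x] by (auto simp: Q_def)
    have "f w / 2 \<le> f (x + of_int n * \<alpha> + of_int (- m))" using n Q by (intro below) auto
    then have "f w / 2 \<le> f (x + real (nat n) * \<alpha>)" using n(1) by (simp only: f_add_of_int) simp
    also have "\<dots> \<le> (\<Sum>i<Q. f (x + real i * \<alpha>))"
      using n(1) f_pos by (intro member_le_sum) (auto simp: less_imp_le)
    finally show ?thesis by (simp add: roof_sum_of_nat)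
  qed
  have mult: "f w / 2 * real j \<le> roof_sum \<alpha> f (int (j * Q)) x" for j x
  proof (induction j)
    case (Suc j)
    then show ?case using block[of "x + of_int (int (j * Q)) * \<alpha>"]
        roof_sum_add[of \<alpha> f "int (j * Q)" "int Q" x] by (simp add: algebra_simps)
  qed simp
  show ?thesis
  proof (intro exI[of _ "f w / (4 * real Q)"] conjI exI[of _ "2 * Q"] allI impI)
    show "0 < f w / (4 * real Q)" using Q f_pos[of w] by simp
    fix n x assume n: "2 * Q \<le> n"
    define j where "j = n div Q"
    have j: "j * Q \<le> n" "n \<le> j * Q + Q"
      using div_mult_mod_eq[of n Q] mod_less_divisor[OF Q(1), of n] unfolding j_def by linarith+
    have "real n \<le> 2 * real Q * real j"
    proof -
      have "n \<le> 2 * (j * Q)" using j n by linarith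
      then have "real n \<le> real (2 * (j * Q))" by (rule of_nat_mono)
      then show ?thesis by (simp add: mult_ac)
    qed
    then have "f w / (4 * real Q) * real n \<le> f w / (4 * real Q) * (2 * real Q * real j)"
      using f_pos[of w] by (intro mult_left_mono) auto
    also have "\<dots> = f w / 2 * real j" using Q by simp
    also note mult[of j x]
    also have "roof_sum \<alpha> f (int (j * Q)) x \<le> roof_sum \<alpha> f (int n) x"
      unfolding roof_sum_of_nat using j(1) f_pos by (intro sum_mono2) (auto simp: less_imp_le)
    finally show "f w / (4 * real Q) * real n \<le> roof_sum \<alpha> f (int n) x" .
  qed
qed

end

sublocale singular_roof \<subseteq> roof: rotation_roof \<alpha> f
  by unfold_locales (rule irrational f_periodic f_pos f_integrable roof_sum_linear_growth)+

section \<open>The drift of two nearby orbits\<close>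

lemma MVT_segment:
  fixes f :: "real \<Rightarrow> real"
  assumes "\<And>z. \<bar>z - u\<bar> \<le> \<bar>w - u\<bar> \<Longrightarrow> (f has_real_derivative f' z) (at z)"
  obtains z where "\<bar>z - u\<bar> \<le> \<bar>w - u\<bar>" "f w - f u = (w - u) * f' z"
proof -
  consider "u = w" | "u < w" | "w < u" by linarith
  then show ?thesis
  proof cases
    case 1 then show ?thesis by (intro that[of u]) auto
  next
    case 2
    then obtain z where "u < z" "z < w" "f w - f u = (w - u) * f' z"
      using MVT2[of u w f f'] assms by auto
    then show ?thesis by (intro that[of z]) auto
  next
    case 3
    then obtain z where "w < z" "z < u" "f u - f w = (u - w) * f' z"
      using MVT2[of w u f f'] assms by auto
    then show ?thesis by (intro that[of z]) (auto simp: algebra_simps)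
  qed
qed

lemma roof_sum_diff:
  "m \<le> n \<Longrightarrow> roof_sum \<alpha> f n x - roof_sum \<alpha> f m x = (\<Sum>i\<in>{m..<n}. f (x + of_int i * \<alpha>))"
proof (induction n rule: int_ge_induct)
  case (step n)
  then have "{m..<n + 1} = insert n {m..<n}" by auto
  then show ?case using step roof_sum_Suc[of \<alpha> f n x] by simp
qed simp

lemma div_room:
  fixes Q r :: nat
  assumes "32 * r \<le> Q"
  shows "Q div 16 + r \<le> Q div 8" "Q div 8 + Q div 16 + r \<le> Q div 4" "Q div 8 + Q div 16 \<le> Q div 2"
    "Q div 4 \<le> Q div 2"
proof -
  define e z where "e = Q div 8" and "z = Q div 16"
  have "8 * e \<le> Q" "16 * z \<le> Q" by (simp_all add: e_def z_def)
  then have "real (8 * e) \<le> real Q" "real (16 * z) \<le> real Q" "real (32 * r) \<le> real Q"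
    using assms by (simp_all only: of_nat_le_iff)
  then have e: "8 * real e \<le> real Q" and z: "16 * real z \<le> real Q" and r: "32 * real r \<le> real Q"
    by simp_all
  have "real (8 * (z + r)) \<le> real Q" using z r by (simp add: distrib_left)
  moreover have "real (4 * (e + z + r)) \<le> real Q" using e z r by (simp add: distrib_left)
  moreover have "real (2 * (e + z)) \<le> real Q" using e z by (simp add: distrib_left)
  ultimately show "Q div 16 + r \<le> Q div 8" "Q div 8 + Q div 16 + r \<le> Q div 4" "Q div 8 + Q div 16 \<le> Q div 2"
    unfolding of_nat_le_iff e_def z_def
    by (simp_all add: less_eq_div_iff_mult_less_eq mult.commute)
  show "Q div 4 \<le> Q div 2" by (rule div_le_mono2) simp_all
qed

context singular_roof
begin

abbreviation S :: "int \<Rightarrow> real \<Rightarrow> real" where "S \<equiv> roof_sum \<alpha> f"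

definition drift :: "real \<Rightarrow> real \<Rightarrow> int \<Rightarrow> real" where "drift x y n = S n y - S n x"

text \<open>
  The distances are twice the ones that are needed on the segments between the two orbits.
\<close>

definition avoids_weak :: "nat \<Rightarrow> real \<Rightarrow> int set \<Rightarrow> bool" where
  "avoids_weak s x I \<longleftrightarrow> (\<forall>n\<in>I. \<forall>i\<in>{1..v}. 2 * \<xi> i s \<le> circle_norm (x + of_int n * \<alpha> - a i))"

definition avoids_strong :: "nat \<Rightarrow> real \<Rightarrow> int set \<Rightarrow> bool" where
  "avoids_strong s x I \<longleftrightarrow>
    (\<forall>n\<in>I. \<forall>i\<in>{v+1..k}. 1 / (2 * C * real (q s)) < circle_norm (x + of_int n * \<alpha> - a i))"

lemma avoids_weak_mono: "avoids_weak s x I \<Longrightarrow> J \<subseteq> I \<Longrightarrow> avoids_weak s x J"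
  by (auto simp: avoids_weak_def)

lemma avoids_strong_mono: "avoids_strong s x I \<Longrightarrow> J \<subseteq> I \<Longrightarrow> avoids_strong s x J"
  by (auto simp: avoids_strong_def)

text \<open>
  The distance of \<open>x\<close> and \<open>y\<close> is less than half of the distances kept by the orbit of \<open>x\<close>, so that
  the mean value theorem applies between corresponding points of the two orbits.
\<close>

lemma avoid_segment:
  assumes weak: "avoids_weak s x I" and strong: "avoids_strong t x I"
    and \<Delta>: "\<bar>y - x\<bar> \<le> 1 / H s" "\<bar>y - x\<bar> \<le> 1 / (4 * C * real (q t))"
    and n: "n \<in> I" and z: "\<bar>z - (x + of_int n * \<alpha>)\<bar> \<le> \<bar>y - x\<bar>"
  shows "i \<in> {1..v} \<Longrightarrow> \<xi> i s \<le> circle_norm (z - a i)"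
    and "i \<in> {v+1..k} \<Longrightarrow> 1 / (4 * C * real (q t)) \<le> circle_norm (z - a i)"
    and "z \<in> regular"
proof -
  have near: "circle_norm (x + of_int n * \<alpha> - a i) \<le> circle_norm (z - a i) + \<bar>y - x\<bar>" for i
    using circle_norm_triangle_diff[of "x + of_int n * \<alpha> - a i" "z - a i"] z by (simp add: abs_minus_commute)
  show 1: "\<xi> i s \<le> circle_norm (z - a i)" if i: "i \<in> {1..v}" for i
  proof -
    have "2 * \<xi> i s \<le> circle_norm (x + of_int n * \<alpha> - a i)" using weak n i by (auto simp: avoids_weak_def)
    moreover have "1 / H s < \<xi> i s" using F_\<xi>_lower[OF i, of s] by (simp add: H_def hq_def)
    ultimately show ?thesis using near[of i] \<Delta>(1) by linarith
  qed
  show 2: "1 / (4 * C * real (q t)) \<le> circle_norm (z - a i)" if i: "i \<in> {v+1..k}" for i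
  proof -
    have "1 / (2 * C * real (q t)) < circle_norm (x + of_int n * \<alpha> - a i)"
      using strong n i by (auto simp: avoids_strong_def)
    moreover have "1 / (2 * C * real (q t)) = 2 * (1 / (4 * C * real (q t)))" by simp
    ultimately show ?thesis using near[of i] \<Delta>(2) by linarith
  qed
  show "z \<in> regular"
    unfolding regular_iff
  proof
    fix i assume i: "i \<in> {1..k}"
    show "0 < circle_norm (z - a i)"
    proof (cases "i \<le> v")
      case True
      then show ?thesis using 1[of i] F_\<xi>[of i s] i by force
    next
      case False
      with i have "i \<in> {v+1..k}" by auto
      then have "1 / (4 * C * real (q t)) \<le> circle_norm (z - a i)" by (rule 2)
      moreover have "0 < 1 / (4 * C * real (q t))" using C q_pos[of t] by simp
      ultimately show ?thesis by linarith
    qed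
  qed
qed

text \<open>The contribution to a derivative sum of everything except the strong singularities.\<close>

definition weak_part :: "nat \<Rightarrow> real" where
  "weak_part s = real (q s) +
     (\<Sum>i\<in>{1..v}. 2 * (- deriv (g i) (\<xi> i s) + 8 * real (q s) * g i (1 / (8 * real (q s)))))"

lemma weak_part_negligible: "(\<lambda>s. weak_part s / H s) \<longlonglongrightarrow> 0"
proof -
  have 1: "(\<lambda>s. real (q s) / H s) \<longlonglongrightarrow> 0"
  proof -
    have "real (q s) / H s = inverse (hq s)" for s
      using q_pos[of s] hq_pos[of s] by (simp add: H_def field_simps)
    then show ?thesis using tendsto_inverse_0_at_top[OF hq_at_top] by simp
  qed
  have "(\<lambda>s. real (q s) / H s + (\<Sum>i\<in>{1..v}.
      2 * (- deriv (g i) (\<xi> i s) + 8 * real (q s) * g i (1 / (8 * real (q s)))) / H s)) \<longlonglongrightarrow> 0 + (\<Sum>i\<in>{1..v}. 0)"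
    by (intro tendsto_intros 1 negligible_sum F_comparison F_small F_\<xi>_limit)
  then show ?thesis by (simp add: weak_part_def add_divide_distrib sum_divide_distrib)
qed

text \<open>
  The mean value theorem at each time turns the change of the drift into a sum of \<open>f'\<close> along
  a perturbed orbit. The strong singularities may be taken at a smaller scale \<open>t\<close>, when
  the block of times has length at most \<open>q\<^sub>t\<close>.
\<close>

lemma drift_le:
  assumes K: "K > 0" "\<And>z. z \<in> regular \<Longrightarrow> \<bar>deriv f z\<bar> \<le> K * majorant z"
    and K': "K' > 0"
      "\<And>s. 2 * (- deriv h (1 / (4 * C * real (q s))) + 8 * real (q s) * h (1 / (8 * real (q s)))) \<le> K' * H s"
    and weak: "avoids_weak s x {m..<m'}" and strong: "avoids_strong t x {m..<m'}"
    and \<Delta>: "\<bar>y - x\<bar> \<le> 1 / H s" "\<bar>y - x\<bar> \<le> 1 / (8 * real (q s))" "\<bar>y - x\<bar> \<le> 1 / (4 * C * real (q s))"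
    and m: "m \<le> m'" "m' - m \<le> int (q t)" and t: "t \<le> s"
  shows "\<bar>drift x y m' - drift x y m\<bar> \<le> K * (weak_part s / H s + real k * K' * (H t / H s))"
proof -
  have qts: "real (q t) \<le> real (q s)" using q_le[OF t] by simp
  have "1 / (4 * C * real (q s)) \<le> 1 / (4 * C * real (q t))"
    using qts C q_pos[of t] q_pos[of s] by (intro divide_left_mono) auto
  with \<Delta>(3) have \<Delta>4: "\<bar>y - x\<bar> \<le> 1 / (4 * C * real (q t))" by linarith
  have "1 / (8 * real (q s)) \<le> 1 / (8 * real (q t))"
    using qts q_pos[of t] q_pos[of s] by (intro divide_left_mono) auto
  with \<Delta>(2) have \<Delta>5: "\<bar>y - x\<bar> \<le> 1 / (8 * real (q t))" by linarith
  note seg = avoid_segment[OF weak strong \<Delta>(1) \<Delta>4]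
  let ?I = "{m..<m'}"
  have "\<exists>z. \<bar>z - (x + of_int n * \<alpha>)\<bar> \<le> \<bar>y - x\<bar> \<and>
      f (y + of_int n * \<alpha>) - f (x + of_int n * \<alpha>) = (y - x) * deriv f z" if n: "n \<in> ?I" for n
  proof -
    have "\<bar>(y + of_int n * \<alpha>) - (x + of_int n * \<alpha>)\<bar> = \<bar>y - x\<bar>" by simp
    then show ?thesis
      using MVT_segment[of "x + of_int n * \<alpha>" "y + of_int n * \<alpha>" f "deriv f"] f_DERIV seg(3)[OF n]
      by (metis add_diff_cancel_right)
  qed
  then obtain \<theta> where \<theta>: "\<And>n. n \<in> ?I \<Longrightarrow> \<bar>\<theta> n - (x + of_int n * \<alpha>)\<bar> \<le> \<bar>y - x\<bar>"
    "\<And>n. n \<in> ?I \<Longrightarrow> f (y + of_int n * \<alpha>) - f (x + of_int n * \<alpha>) = (y - x) * deriv f (\<theta> n)"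
    by metis
  have reg: "\<theta> n \<in> regular" if "n \<in> ?I" for n by (rule seg(3)[OF that \<theta>(1)[OF that]])
  have block: "\<bar>n - n'\<bar> < int (q t)" "\<bar>n - n'\<bar> < int (q s)" if "n \<in> ?I" "n' \<in> ?I" for n n'
  proof -
    show *: "\<bar>n - n'\<bar> < int (q t)" using that m(2) by auto
    show "\<bar>n - n'\<bar> < int (q s)" using * q_le[OF t] by linarith
  qed
  have weak_sum: "(\<Sum>n\<in>?I. - deriv (G i) (circle_norm (\<theta> n - a i)))
      \<le> 2 * (- deriv (g i) (\<xi> i s) + 8 * real (q s) * g i (1 / (8 * real (q s))))" if i: "i \<in> {1..v}" for i
  proof -
    have "(\<Sum>n\<in>?I. - deriv (g i) (circle_norm (\<theta> n - a i)))
      \<le> 2 * (- deriv (g i) (\<xi> i s) + 8 * real (q s) * g i (1 / (8 * real (q s))))"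
    proof (rule orbit_deriv_sum[OF F_comparison[OF i]])
      fix n assume n: "n \<in> ?I"
      show "\<bar>\<theta> n - (x + of_int n * \<alpha>)\<bar> \<le> 1 / (8 * real (q s))" using \<theta>(1)[OF n] \<Delta>(2) by linarith
      show "\<xi> i s \<le> circle_norm (\<theta> n - a i)" by (rule seg(1)[OF n \<theta>(1)[OF n] i])
    qed (use F_\<xi>[OF i, of s] block in auto)
    then show ?thesis using i by (simp add: G_def)
  qed
  have strong_sum: "(\<Sum>n\<in>?I. - deriv (G i) (circle_norm (\<theta> n - a i))) \<le> K' * H t" if i: "i \<in> {v+1..k}" for i
  proof -
    have C4: "1 < 4 * C" using C by simp
    have "(\<Sum>n\<in>?I. - deriv h (circle_norm (\<theta> n - a i)))
      \<le> 2 * (- deriv h (1 / (4 * C * real (q t))) + 8 * real (q t) * h (1 / (8 * real (q t))))"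
    proof (rule orbit_deriv_sum[OF h])
      fix n assume n: "n \<in> ?I"
      show "\<bar>\<theta> n - (x + of_int n * \<alpha>)\<bar> \<le> 1 / (8 * real (q t))" using \<theta>(1)[OF n] \<Delta>5 by linarith
      show "1 / (4 * C * real (q t)) \<le> circle_norm (\<theta> n - a i)" by (rule seg(2)[OF n \<theta>(1)[OF n] i])
    qed (use block inverse_q_in[OF C4, of t] in auto)
    then show ?thesis using i K'(2)[of t] by (auto simp: G_def)
  qed
  have majorant_sum: "(\<Sum>n\<in>?I. majorant (\<theta> n)) \<le> weak_part s + real k * (K' * H t)"
  proof -
    have "(\<Sum>n\<in>?I. majorant (\<theta> n)) = real (card ?I) + (\<Sum>i\<in>{1..k}. \<Sum>n\<in>?I. - deriv (G i) (circle_norm (\<theta> n - a i)))"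
      unfolding majorant_def sum.distrib by (subst sum.swap) simp
    also have "{1..k} = {1..v} \<union> {v+1..k}" using v_less by auto
    also have "(\<Sum>i\<in>{1..v} \<union> {v+1..k}. \<Sum>n\<in>?I. - deriv (G i) (circle_norm (\<theta> n - a i)))
        = (\<Sum>i\<in>{1..v}. \<Sum>n\<in>?I. - deriv (G i) (circle_norm (\<theta> n - a i)))
        + (\<Sum>i\<in>{v+1..k}. \<Sum>n\<in>?I. - deriv (G i) (circle_norm (\<theta> n - a i)))"
      by (rule sum.union_disjoint) auto
    also have "(\<Sum>i\<in>{1..v}. \<Sum>n\<in>?I. - deriv (G i) (circle_norm (\<theta> n - a i)))
        \<le> (\<Sum>i\<in>{1..v}. 2 * (- deriv (g i) (\<xi> i s) + 8 * real (q s) * g i (1 / (8 * real (q s)))))"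
      by (rule sum_mono[OF weak_sum])
    also have "(\<Sum>i\<in>{v+1..k}. \<Sum>n\<in>?I. - deriv (G i) (circle_norm (\<theta> n - a i))) \<le> (\<Sum>i\<in>{v+1..k}. K' * H t)"
      by (rule sum_mono[OF strong_sum])
    also have "(\<Sum>i\<in>{v+1..k}. K' * H t) = real (k - v) * (K' * H t)" by simp
    also have "\<dots> \<le> real k * (K' * H t)" using K'(1) H_pos[of t] by (intro mult_right_mono) auto
    also have "real (card ?I) \<le> real (q s)" using m q_le[OF t] by simp
    finally show ?thesis by (simp add: weak_part_def)
  qed
  have "\<bar>drift x y m' - drift x y m\<bar> = \<bar>\<Sum>n\<in>?I. f (y + of_int n * \<alpha>) - f (x + of_int n * \<alpha>)\<bar>"
    using roof_sum_diff[OF m(1), of \<alpha> f x] roof_sum_diff[OF m(1), of \<alpha> f y]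
    by (simp add: drift_def sum_subtractf)
  also have "\<dots> \<le> (\<Sum>n\<in>?I. \<bar>f (y + of_int n * \<alpha>) - f (x + of_int n * \<alpha>)\<bar>)" by (rule sum_abs)
  also have "\<dots> \<le> (\<Sum>n\<in>?I. \<bar>y - x\<bar> * (K * majorant (\<theta> n)))"
  proof (rule sum_mono)
    fix n assume n: "n \<in> ?I"
    have "\<bar>f (y + of_int n * \<alpha>) - f (x + of_int n * \<alpha>)\<bar> = \<bar>y - x\<bar> * \<bar>deriv f (\<theta> n)\<bar>"
      unfolding \<theta>(2)[OF n] by (rule abs_mult)
    then show "\<bar>f (y + of_int n * \<alpha>) - f (x + of_int n * \<alpha>)\<bar> \<le> \<bar>y - x\<bar> * (K * majorant (\<theta> n))"
      using K(2)[OF reg[OF n]] by (simp add: mult_left_mono)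
  qed
  also have "\<dots> = \<bar>y - x\<bar> * (K * (\<Sum>n\<in>?I. majorant (\<theta> n)))" by (simp add: sum_distrib_left)
  also have "\<dots> \<le> 1 / H s * (K * (weak_part s + real k * (K' * H t)))"
  proof (rule mult_mono[OF \<Delta>(1)])
    show "K * (\<Sum>n\<in>?I. majorant (\<theta> n)) \<le> K * (weak_part s + real k * (K' * H t))"
      using majorant_sum K(1) by (intro mult_left_mono) auto
    show "0 \<le> K * (\<Sum>n\<in>?I. majorant (\<theta> n))"
      using K(1) majorant_ge reg by (intro mult_nonneg_nonneg sum_nonneg) force+
  qed (use H_pos[of s] in auto)
  also have "\<dots> = K * (weak_part s / H s + real k * K' * (H t / H s))"
    using H_pos[of s] by (simp add: field_simps)
  finally show ?thesis .
qed

text \<open>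
  Bad approximability, in the form in which it is used: two different times less than \<open>q\<^sub>s\<close>
  apart cannot both bring the orbit close to the strong singularities.
\<close>

lemma strong_visit_unique:
  assumes "i \<in> {v+1..k}" "circle_norm (x + of_int n * \<alpha> - a i) \<le> 1 / (2 * C * real (q s))"
    and "j \<in> {v+1..k}" "circle_norm (x + of_int m * \<alpha> - a j) \<le> 1 / (2 * C * real (q s))"
    and "\<bar>n - m\<bar> < int (q s)"
  shows "n = m"
proof -
  define l where "l = min n m"
  define x' where "x' = x + of_int l * \<alpha>"
  have x': "x' + real (nat (p - l)) * \<alpha> = x + of_int p * \<alpha>" if "l \<le> p" for p
    using that by (simp add: x'_def algebra_simps)
  have "\<exists>\<^sub>\<le>\<^sub>1 i. i < q s \<and> (\<exists>b\<in>a ` {v+1..k}. circle_dist (x' + real i * \<alpha>) b \<le> 1 / (2 * C * real (q s)))"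
    using bad by (simp add: badly_approximable_def)
  moreover have "nat (n - l) < q s \<and> (\<exists>b\<in>a ` {v+1..k}. circle_dist (x' + real (nat (n - l)) * \<alpha>) b \<le> 1 / (2 * C * real (q s)))"
    using assms(1,2,5) x'[of n] by (auto simp: l_def circle_dist_def)
  moreover have "nat (m - l) < q s \<and> (\<exists>b\<in>a ` {v+1..k}. circle_dist (x' + real (nat (m - l)) * \<alpha>) b \<le> 1 / (2 * C * real (q s)))"
    using assms(3,4,5) x'[of m] by (auto simp: l_def circle_dist_def)
  ultimately have "nat (n - l) = nat (m - l)" by (rule Uniq_D)
  then show ?thesis by (auto simp: l_def)
qed

text \<open>
  The past and the future of length \<open>q s div 2\<close> together form a block of at most \<open>q s\<close> times, in
  which there is at most one close visit.
\<close>

lemma avoids_strong_switch: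
  obtains b where "b = 0 \<or> b = - int (q s div 2)" "avoids_strong s x {b..<b + int (q s div 2)}"
proof (rule ccontr)
  assume "\<not> thesis"
  then have no: "\<not> avoids_strong s x {0..<int (q s div 2)}" "\<not> avoids_strong s x {- int (q s div 2)..<0}"
    using that[of 0] that[of "- int (q s div 2)"] by auto
  from no(1) obtain n i where n: "n \<in> {0..<int (q s div 2)}" "i \<in> {v+1..k}"
    "circle_norm (x + of_int n * \<alpha> - a i) \<le> 1 / (2 * C * real (q s))"
    unfolding avoids_strong_def by (meson not_less)
  from no(2) obtain m j where m: "m \<in> {- int (q s div 2)..<0}" "j \<in> {v+1..k}"
    "circle_norm (x + of_int m * \<alpha> - a j) \<le> 1 / (2 * C * real (q s))"
    unfolding avoids_strong_def by (meson not_less)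
  have "n = m" by (rule strong_visit_unique[OF n(2,3) m(2,3)]) (use n(1) m(1) in auto)
  with n(1) m(1) show False by auto
qed

section \<open>Jumps and slow windows of the drift\<close>

text \<open>
  A direction of time, forward or backward, in which the orbit of \<open>x\<close> has no close visits, and a
  point \<open>y\<close> at the distance from \<open>x\<close> which belongs to the scale \<open>s\<close>.
\<close>

definition admissible :: "nat \<Rightarrow> real \<Rightarrow> real \<Rightarrow> int \<Rightarrow> bool" where
  "admissible s x y b \<longleftrightarrow> (b = 0 \<or> b = - int (q s div 2)) \<and>
     avoids_weak s x {b..<b + int (q s div 2)} \<and> avoids_strong s x {b..<b + int (q s div 2)} \<and>
     1 / H (Suc s) < \<bar>y - x\<bar> \<and> \<bar>y - x\<bar> \<le> 1 / H s"

text \<open>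
  The fractions of \<open>q\<^sub>s\<close> place the visit in the interior of the block of admissible times, so that a
  window on either side of it still lies in the block and far from time zero.
\<close>

definition separates :: "real \<Rightarrow> real \<Rightarrow> nat \<Rightarrow> real \<Rightarrow> real \<Rightarrow> int \<Rightarrow> bool" where
  "separates c L s x y b \<longleftrightarrow>
     (\<exists>n\<in>{b + int (q s div 8)..<b + int (q s div 8 + q s div 16)}. \<exists>i\<in>{v+1..k}.
        circle_norm (x + of_int n * \<alpha> - a i) \<le> L / real (q s) \<and>
        c \<le> \<bar>f (y + of_int n * \<alpha>) - f (x + of_int n * \<alpha>)\<bar>)"

text \<open>
  Within a bounded fraction of \<open>q\<^sub>s\<close> steps, an orbit which avoids the strong singularities at
  scale \<open>s\<close> still comes to a distance of order \<open>1 / q\<^sub>s\<close> from one of them, on its strong side,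
  by density. There \<open>f'\<close> has the order \<open>H s\<close>, the inverse of the distance of the two points.
\<close>

lemma jump:
  obtains c L where "c > 0" "L > 0"
    "\<forall>\<^sub>F s in sequentially. \<forall>x y b. admissible s x y b \<longrightarrow> separates c L s x y b"
proof -
  obtain e \<sigma> c \<eta> where e: "e \<in> {v+1..k}" "\<sigma> = 1 \<or> \<sigma> = - (1::real)" "c > 0" "\<eta> > 0"
    "\<And>u. 0 < u \<Longrightarrow> u < \<eta> \<Longrightarrow> c * - deriv h u \<le> \<bar>deriv f (a e + \<sigma> * u)\<bar>"
    using strong_side by blast
  define L where "L = 96 * R"
  have L: "L > 0" using R_pos by (simp add: L_def)
  obtain c1 s1 where c1: "c1 > 0"
    "\<And>s. s \<ge> s1 \<Longrightarrow> (L + 1) / real (q s) < 1 \<and> c1 * H s \<le> - deriv h ((L + 1) / real (q s))"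
    using deriv_lower[of "L + 1"] L by auto
  define J where "J = c * c1 * (D / R)"
  have J: "J > 0" using e c1 D R_pos by (simp add: J_def)
  have big: "\<forall>\<^sub>F s in sequentially. max 16 ((L + 1) / \<eta>) < real (q s)"
    by (rule filterlim_at_top_dense[THEN iffD1, OF filterlim_q, rule_format])
  have big': "\<forall>\<^sub>F s in sequentially. 4 * C < hq s"
    by (rule filterlim_at_top_dense[THEN iffD1, OF hq_at_top, rule_format])
  show ?thesis
  proof (rule that[OF J L], use big big' eventually_ge_at_top[of s1] in eventually_elim, intro allI impI)
    fix s x y b
    assume s: "max 16 ((L + 1) / \<eta>) < real (q s)" "4 * C < hq s" "s1 \<le> s"
      and adm: "admissible s x y b"
    from adm have weak: "avoids_weak s x {b..<b + int (q s div 2)}"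
      and strong: "avoids_strong s x {b..<b + int (q s div 2)}"
      and \<Delta>: "1 / H (Suc s) < \<bar>y - x\<bar>" "\<bar>y - x\<bar> \<le> 1 / H s"
      by (auto simp: admissible_def)
    have q16: "16 \<le> q s" using s(1) by simp
    have \<Delta>C: "\<bar>y - x\<bar> \<le> 1 / (4 * C * real (q s))"
    proof -
      have "4 * C * real (q s) \<le> H s"
        using mult_right_mono[of "4 * C" "hq s" "real (q s)"] s(2) by (simp add: H_def mult.commute)
      then have "1 / H s \<le> 1 / (4 * C * real (q s))" using C q_pos[of s] H_pos[of s] by (intro divide_left_mono) auto
      with \<Delta>(2) show ?thesis by linarith
    qed
    have q1: "1 \<le> real (q s div 16)" using q16 by simp
    then obtain t where t: "real (q t) \<le> real (q s div 16)" "real (q s div 16) < real (q (Suc t))"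
      using q_bracket by blast
    have "1 \<le> q s div 16" using q16 by simp
    then have "q s < 32 * (q s div 16)"
      using div_mult_mod_eq[of "q s" 16] mod_less_divisor[of 16 "q s"] by linarith
    then have "real (q s) < 32 * real (q s div 16)" by linarith
    \<comment> \<open>Density at scale \<open>t\<close> gives a visit at distance less than \<open>3 / q\<^sub>t\<close>; the division rounds \<open>q\<^sub>s / 16\<close> down.\<close>
    define n\<^sub>0 where "n\<^sub>0 = b + int (q s div 8)"
    define p where "p = (if \<sigma> = 1 then a e else a e - 3 / real (q t))"
    obtain n m where n: "n \<in> {n\<^sub>0..<n\<^sub>0 + int (q t)}"
      "p < x + of_int n * \<alpha> - of_int m" "x + of_int n * \<alpha> - of_int m < p + 3 / real (q t)"
      using density[of n\<^sub>0 t p x] by blast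
    define u where "u = \<sigma> * (x + of_int n * \<alpha> - of_int m - a e)"
    have xu: "x + of_int n * \<alpha> = a e + \<sigma> * u + of_int m" using e(2) by (auto simp: u_def)
    have nI: "n \<in> {b + int (q s div 8)..<b + int (q s div 8 + q s div 16)}"
      using n(1) t(1) by (auto simp: n\<^sub>0_def)
    have nI2: "n \<in> {b..<b + int (q s div 2)}"
    proof -
      have "q s div 8 + q s div 16 \<le> q s div 2" using div_room(3)[of 0 "q s"] by simp
      then show ?thesis using nI by auto
    qed
    have u_less: "0 < u" "u < 3 / real (q t)" using n(2,3) e(2) by (auto simp: u_def p_def split: if_splits)
    have "3 / real (q t) \<le> L / real (q s)"
    proof -
      have "real (q s) \<le> 32 * (R * real (q t))"
        using \<open>real (q s) < 32 * real (q s div 16)\<close> t(2) R[of t] by linarith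
      then show ?thesis using q_pos[of t] q_pos[of s] by (simp add: L_def field_simps)
    qed
    then have u_le: "u \<le> L / real (q s)" using u_less by linarith
    have "circle_norm (x + of_int n * \<alpha> - a e) \<le> \<bar>x + of_int n * \<alpha> - a e - of_int m\<bar>"
      by (rule circle_norm_le)
    also have "\<dots> = u" using u_less(1) e(2) by (auto simp: xu)
    finally have norm_u: "circle_norm (x + of_int n * \<alpha> - a e) \<le> u" .
    have u_ge: "1 / (2 * C * real (q s)) < u"
      using strong nI2 e(1) norm_u unfolding avoids_strong_def by fastforce
    have "\<bar>(y + of_int n * \<alpha>) - (x + of_int n * \<alpha>)\<bar> = \<bar>y - x\<bar>" by simp
    then obtain \<theta> where \<theta>: "\<bar>\<theta> - (x + of_int n * \<alpha>)\<bar> \<le> \<bar>y - x\<bar>"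
      "f (y + of_int n * \<alpha>) - f (x + of_int n * \<alpha>) = (y - x) * deriv f \<theta>"
      using MVT_segment[of "x + of_int n * \<alpha>" "y + of_int n * \<alpha>" f "deriv f"] f_DERIV
        avoid_segment(3)[OF weak strong \<Delta>(2) \<Delta>C nI2]
      by (metis add_diff_cancel_right)
    define u' where "u' = \<sigma> * (\<theta> - of_int m - a e)"
    have \<theta>u: "\<theta> = a e + \<sigma> * u' + of_int m" using e(2) by (auto simp: u'_def)
    have uu: "\<bar>u' - u\<bar> \<le> \<bar>y - x\<bar>" using \<theta>(1) e(2) unfolding \<theta>u xu by auto
    have "1 / (2 * C * real (q s)) = 2 * (1 / (4 * C * real (q s)))" by simp
    moreover have "0 < 1 / (4 * C * real (q s))" using C q_pos[of s] by simp
    ultimately have u'_pos: "0 < u'" using uu u_ge \<Delta>C by linarith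
    have "1 / (4 * C * real (q s)) \<le> 1 / real (q s)"
      using C q_pos[of s] by (intro divide_left_mono) auto
    then have u'_le: "u' \<le> (L + 1) / real (q s)" using uu u_le \<Delta>C by (simp add: add_divide_distrib)
    have "(L + 1) / real (q s) < \<eta>" using s(1) e(4) q_pos[of s] by (simp add: field_simps)
    then have u'_\<eta>: "u' < \<eta>" using u'_le by linarith
    have "c1 * H s \<le> - deriv h u'"
      using c1(2)[OF s(3)] comparison_deriv_mono[OF h u'_pos u'_le] by linarith
    then have "c * (c1 * H s) \<le> c * - deriv h u'" using e(3) by (intro mult_left_mono) auto
    also have "\<dots> \<le> \<bar>deriv f (a e + \<sigma> * u')\<bar>" by (rule e(5)[OF u'_pos u'_\<eta>])
    also have "deriv f (a e + \<sigma> * u') = deriv f \<theta>" unfolding \<theta>u by simp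
    finally have d: "c * c1 * H s \<le> \<bar>deriv f \<theta>\<bar>" by (simp add: mult.assoc)
    have "J \<le> 1 / H (Suc s) * (c * c1 * H s)"
    proof -
      have "c * c1 * (D / R * H (Suc s)) \<le> c * c1 * H s"
        using e(3) c1(1) H_ratio[of s] by (intro mult_left_mono) auto
      then show ?thesis using H_pos[of "Suc s"] by (simp add: J_def field_simps)
    qed
    also have "\<dots> \<le> \<bar>y - x\<bar> * \<bar>deriv f \<theta>\<bar>"
      using \<Delta>(1) d e(3) c1(1) H_pos[of s] by (intro mult_mono) auto
    also have "\<dots> = \<bar>f (y + of_int n * \<alpha>) - f (x + of_int n * \<alpha>)\<bar>" unfolding \<theta>(2) by (simp add: abs_mult)
    finally have "J \<le> \<bar>f (y + of_int n * \<alpha>) - f (x + of_int n * \<alpha>)\<bar>" .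
    then show "separates J L s x y b"
      unfolding separates_def
      using nI e(1) norm_u u_le by (intro bexI[of _ n] bexI[of _ e] conjI) auto
  qed
qed

text \<open>
  A block of times, of length comparable to \<open>\<kappa> q\<^sub>s\<close> and at a distance of order \<open>q\<^sub>s\<close> from time
  zero, during which the drift stays near one value in \<open>Q\<close>.
\<close>

definition slow_window :: "real \<Rightarrow> real \<Rightarrow> real set \<Rightarrow> nat \<Rightarrow> real \<Rightarrow> real \<Rightarrow> int \<Rightarrow> bool" where
  "slow_window \<kappa> \<epsilon> Q s x y b \<longleftrightarrow>
     (\<exists>m n. \<exists>p\<in>Q. b + int (q s div 16) \<le> m \<and> n \<le> b + int (q s div 4) \<and>
        \<kappa> * real (q s) \<le> 2 * R * real_of_int (n - m) \<and> (\<forall>l\<in>{m..n}. \<bar>drift x y l - p\<bar> \<le> \<epsilon>))"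

text \<open>
  The drift is bounded before and after the jump, so at least on one side of it the drift is
  not small; and bad approximability at a smaller scale \<open>r\<close> shows that there it changes little
  for another \<open>q\<^sub>r\<close> steps. Since \<open>h\<close> grows like a power, this change is small even
  compared with \<open>q\<^sub>r / q\<^sub>s\<close>, whence the bound \<open>\<rho> \<kappa>\<close>.
\<close>

lemma drift_window:
  obtains c M where "0 < c"
    "\<forall>\<rho>>0. \<exists>\<kappa>>0. \<kappa> \<le> 1 \<and> (\<forall>\<^sub>F s in sequentially. \<forall>x y b.
       admissible s x y b \<longrightarrow> slow_window \<kappa> (\<rho> * \<kappa>) {p. c \<le> \<bar>p\<bar> \<and> \<bar>p\<bar> \<le> M} s x y b)"
proof -
  obtain K where K: "K > 0" "\<And>z. z \<in> regular \<Longrightarrow> \<bar>deriv f z\<bar> \<le> K * majorant z"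
    using deriv_bound by blast
  obtain K' where K': "K' > 0"
      "\<And>s. 2 * (- deriv h (1 / (4 * C * real (q s))) + 8 * real (q s) * h (1 / (8 * real (q s)))) \<le> K' * H s"
    using scale_sum_bound by blast
  obtain c L where cL: "c > 0" "L > 0" and jump_ev:
    "\<forall>\<^sub>F s in sequentially. \<forall>x y b. admissible s x y b \<longrightarrow> separates c L s x y b"
    by (rule jump) (rule that)
  define M where "M = K * (1 + real k * K')"
  have main: "\<exists>\<kappa>>0. \<kappa> \<le> 1 \<and> (\<forall>\<^sub>F s in sequentially. \<forall>x y b.
       admissible s x y b \<longrightarrow> slow_window \<kappa> (\<rho> * \<kappa>) {p. c / 2 \<le> \<bar>p\<bar> \<and> \<bar>p\<bar> \<le> M} s x y b)" if \<rho>: "\<rho> > 0" for \<rho>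
  proof -
    have k1: "real k \<ge> 1" using v_less by simp
    define \<rho>' where "\<rho>' = \<rho> / (2 * K * real k * K')"
    have \<rho>': "\<rho>' > 0" using \<rho> K(1) K'(1) k1 by (simp add: \<rho>'_def)
    obtain Kd where Kd: "Kd > 0" "\<And>r s. Kd * real (q r) \<le> real (q s) \<Longrightarrow> hq r \<le> \<rho>' * hq s"
      using decay[OF \<rho>'] by blast
    define \<kappa> where "\<kappa> = min (1 / 32) (min (1 / (2 * C * L)) (1 / Kd))"
    have \<kappa>: "\<kappa> > 0" "\<kappa> \<le> 1 / 32" "\<kappa> \<le> 1 / (2 * C * L)" "\<kappa> \<le> 1 / Kd"
      using cL C Kd(1) by (auto simp: \<kappa>_def)
    have ev1: "\<forall>\<^sub>F s in sequentially. max 64 (2 * R / \<kappa>) < real (q s)"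
      by (rule filterlim_at_top_dense[THEN iffD1, OF filterlim_q, rule_format])
    have ev2: "\<forall>\<^sub>F s in sequentially. max 8 (4 * C) < hq s"
      by (rule filterlim_at_top_dense[THEN iffD1, OF hq_at_top, rule_format])
    have "0 < min 1 (\<rho> * \<kappa> / (2 * K))" using \<rho> \<kappa>(1) K(1) by simp
    then have ev3: "\<forall>\<^sub>F s in sequentially. weak_part s / H s < min 1 (\<rho> * \<kappa> / (2 * K))"
      by (rule order_tendstoD(2)[OF weak_part_negligible])
    have "\<kappa> \<le> 1" using \<kappa>(2) by linarith
    show ?thesis
    proof (rule exI[of _ \<kappa>], intro conjI \<kappa>(1) \<open>\<kappa> \<le> 1\<close>, use jump_ev ev1 ev2 ev3 in eventually_elim, intro allI impI)
      fix s x y b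
      assume jump: "\<forall>x y b. admissible s x y b \<longrightarrow> separates c L s x y b"
        and s: "max 64 (2 * R / \<kappa>) < real (q s)" "max 8 (4 * C) < hq s"
          "weak_part s / H s < min 1 (\<rho> * \<kappa> / (2 * K))"
        and adm: "admissible s x y b"
      from adm have b: "b = 0 \<or> b = - int (q s div 2)"
        and weak: "avoids_weak s x {b..<b + int (q s div 2)}" and strong: "avoids_strong s x {b..<b + int (q s div 2)}"
        and \<Delta>: "1 / H (Suc s) < \<bar>y - x\<bar>" "\<bar>y - x\<bar> \<le> 1 / H s"
        by (auto simp: admissible_def)
      have q64: "64 \<le> q s" using s(1) by simp
      have \<Delta>': "\<bar>y - x\<bar> \<le> 1 / (8 * real (q s))" "\<bar>y - x\<bar> \<le> 1 / (4 * C * real (q s))"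
      proof -
        have le: "\<bar>y - x\<bar> \<le> 1 / (B * real (q s))" if "0 < B" "B \<le> hq s" for B
        proof -
          have "B * real (q s) \<le> H s"
            using mult_right_mono[of B "hq s" "real (q s)"] that by (simp add: H_def mult.commute)
          then have "1 / H s \<le> 1 / (B * real (q s))" using that q_pos[of s] H_pos[of s] by (intro divide_left_mono) auto
          with \<Delta>(2) show ?thesis by linarith
        qed
        show "\<bar>y - x\<bar> \<le> 1 / (8 * real (q s))" "\<bar>y - x\<bar> \<le> 1 / (4 * C * real (q s))"
          using s(2) C by (auto intro!: le)
      qed
      note dl = drift_le[OF K K' _ _ \<Delta>(2) \<Delta>']
      let ?W = "{b..<b + int (q s div 2)}"
      have bounded: "\<bar>drift x y l\<bar> \<le> M" if l: "b \<le> l" "l \<le> b + int (q s div 2)" for l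
      proof -
        have "\<bar>drift x y l - drift x y 0\<bar> \<le> K * (weak_part s / H s + real k * K' * (H s / H s))"
        proof (cases "b = 0")
          case True
          then show ?thesis
            using dl[where m = 0 and m' = l and t = s] avoids_weak_mono[OF weak, of "{0..<l}"] avoids_strong_mono[OF strong, of "{0..<l}"] l
            by auto
        next
          case False
          with b have "b = - int (q s div 2)" by simp
          then have "\<bar>drift x y 0 - drift x y l\<bar> \<le> K * (weak_part s / H s + real k * K' * (H s / H s))"
            using dl[where m = l and m' = 0 and t = s] avoids_weak_mono[OF weak, of "{l..<0}"] avoids_strong_mono[OF strong, of "{l..<0}"] l
            by auto
          then show ?thesis by (simp only: abs_minus_commute)
        qed
        also have "\<dots> \<le> K * (1 + real k * K')" using s(3) H_pos[of s] K(1) by (intro mult_left_mono) auto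
        finally show ?thesis by (simp add: drift_def M_def)
      qed
      \<comment> \<open>The scale \<open>r\<close> of the window: the largest denominator up to \<open>\<kappa> q\<^sub>s\<close>.\<close>
      have "1 \<le> \<kappa> * real (q s)" using s(1) \<kappa>(1) R_pos by (simp add: field_simps)
      then obtain r where r: "real (q r) \<le> \<kappa> * real (q s)" "\<kappa> * real (q s) < real (q (Suc r))"
        using q_bracket by blast
      have qr32: "32 * q r \<le> q s"
      proof -
        have "\<kappa> * real (q s) \<le> 1 / 32 * real (q s)" using \<kappa>(2) by (intro mult_right_mono) auto
        then have "32 * real (q r) \<le> real (q s)" using r(1) by simp
        then show ?thesis by linarith
      qed
      then have rs: "r \<le> s" using q_less[of s r] q_pos[of r] by (cases "r \<le> s") auto
      have qr_lower: "\<kappa> * real (q s) < R * real (q r)" using r(2) R[of r] by linarith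
      have qr2: "2 \<le> q r"
      proof -
        have "2 * R < \<kappa> * real (q s)" using s(1) \<kappa>(1) by (simp add: field_simps)
        then have "R * 2 < R * real (q r)" using qr_lower by linarith
        then show ?thesis using R_pos by simp
      qed
      have window_length: "\<kappa> * real (q s) \<le> 2 * R * real_of_int (int (q r) - 1)"
      proof -
        have "R * real (q r) \<le> R * (2 * (real (q r) - 1))" using qr2 R_pos by (intro mult_left_mono) auto
        then show ?thesis using qr_lower by (simp add: algebra_simps)
      qed
      have slow: "K * (weak_part s / H s + real k * K' * (H r / H s)) \<le> \<rho> * \<kappa>"
      proof -
        have "Kd * real (q r) \<le> real (q s)"
        proof -
          have "Kd * real (q r) \<le> Kd * (1 / Kd * real (q s))"
            using r(1) \<kappa>(4) Kd(1) by (intro mult_left_mono order_trans[OF r(1) mult_right_mono]) auto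
          then show ?thesis using Kd(1) by simp
        qed
        then have "hq r \<le> \<rho>' * hq s" by (rule Kd(2))
        then have "H r \<le> (\<kappa> * real (q s)) * (\<rho>' * hq s)"
          unfolding H_def using r(1) hq_pos[of r] \<kappa>(1) by (intro mult_mono) auto
        then have "H r / H s \<le> \<kappa> * \<rho>'" using H_pos[of s] by (simp add: H_def field_simps)
        then have "real k * K' * (H r / H s) \<le> real k * K' * (\<kappa> * \<rho>')" using K'(1) by (intro mult_left_mono) auto
        also have "\<dots> = \<rho> * \<kappa> / (2 * K)" using K(1) K'(1) k1 by (simp add: \<rho>'_def field_simps)
        finally have "real k * K' * (H r / H s) \<le> \<rho> * \<kappa> / (2 * K)" .
        then have "weak_part s / H s + real k * K' * (H r / H s) \<le> \<rho> * \<kappa> / (2 * K) + \<rho> * \<kappa> / (2 * K)"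
          using s(3) by (intro add_mono) auto
        also have "\<dots> = \<rho> * \<kappa> / K" by simp
        finally have "weak_part s / H s + real k * K' * (H r / H s) \<le> \<rho> * \<kappa> / K" .
        then have "K * (weak_part s / H s + real k * K' * (H r / H s)) \<le> K * (\<rho> * \<kappa> / K)" using K(1) by (intro mult_left_mono) auto
        then show ?thesis using K(1) by simp
      qed
      obtain n i where n: "n \<in> {b + int (q s div 8)..<b + int (q s div 8 + q s div 16)}" "i \<in> {v+1..k}"
        "circle_norm (x + of_int n * \<alpha> - a i) \<le> L / real (q s)"
        "c \<le> \<bar>f (y + of_int n * \<alpha>) - f (x + of_int n * \<alpha>)\<bar>"
        using jump adm unfolding separates_def by blast
      have near: "circle_norm (x + of_int n * \<alpha> - a i) \<le> 1 / (2 * C * real (q r))"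
      proof -
        have "real (q r) * (2 * C * L) \<le> 1 / (2 * C * L) * real (q s) * (2 * C * L)"
          using r(1) \<kappa>(3) C cL by (intro mult_right_mono order_trans[OF r(1) mult_right_mono]) auto
        then have "L * (2 * C * real (q r)) \<le> real (q s)" using C cL by (simp add: mult_ac)
        then have "L / real (q s) \<le> 1 / (2 * C * real (q r))"
          using C q_pos[of r] q_pos[of s] by (simp add: field_simps)
        with n(3) show ?thesis by linarith
      qed
      have avoid_r: "avoids_strong r x I" if "\<And>l. l \<in> I \<Longrightarrow> l \<noteq> n \<and> \<bar>n - l\<bar> < int (q r)" for I
        unfolding avoids_strong_def
      proof (intro ballI, rule ccontr)
        fix l j assume "l \<in> I" "j \<in> {v+1..k}" "\<not> 1 / (2 * C * real (q r)) < circle_norm (x + of_int l * \<alpha> - a j)"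
        then show False using strong_visit_unique[OF n(2) near, of j l] that[of l] by auto
      qed
      note div = div_room[OF qr32]
      have change: "drift x y (n + 1) - drift x y n = f (y + of_int n * \<alpha>) - f (x + of_int n * \<alpha>)"
        by (simp add: drift_def roof_sum_Suc)
      show "slow_window \<kappa> (\<rho> * \<kappa>) {p. c / 2 \<le> \<bar>p\<bar> \<and> \<bar>p\<bar> \<le> M} s x y b"
      proof (cases "c / 2 \<le> \<bar>drift x y (n + 1)\<bar>")
        case True
        have "\<bar>drift x y l - drift x y (n + 1)\<bar> \<le> \<rho> * \<kappa>" if l: "l \<in> {n + 1..n + int (q r)}" for l
        proof -
          have "\<bar>drift x y l - drift x y (n + 1)\<bar> \<le> K * (weak_part s / H s + real k * K' * (H r / H s))"
          proof (rule dl)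
            show "avoids_weak s x {n + 1..<l}" by (rule avoids_weak_mono[OF weak]) (use n(1) l div in auto)
            show "avoids_strong r x {n + 1..<l}" by (rule avoid_r) (use l in auto)
          qed (use l rs in auto)
          with slow show ?thesis by linarith
        qed
        moreover have "\<bar>drift x y (n + 1)\<bar> \<le> M" by (rule bounded) (use n(1) div in auto)
        ultimately show ?thesis unfolding slow_window_def using True n(1) div window_length
          by (intro exI[of _ "n + 1"] exI[of _ "n + int (q r)"] bexI[of _ "drift x y (n + 1)"]) auto
      next
        case False
        then have big: "c / 2 \<le> \<bar>drift x y n\<bar>" using n(4) change by linarith
        have "\<bar>drift x y l - drift x y n\<bar> \<le> \<rho> * \<kappa>" if l: "l \<in> {n + 1 - int (q r)..n}" for l
        proof -
          have "\<bar>drift x y n - drift x y l\<bar> \<le> K * (weak_part s / H s + real k * K' * (H r / H s))"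
          proof (rule dl)
            show "avoids_weak s x {l..<n}" by (rule avoids_weak_mono[OF weak]) (use n(1) l div in auto)
            show "avoids_strong r x {l..<n}" by (rule avoid_r) (use l in auto)
          qed (use l rs in auto)
          with slow show ?thesis by linarith
        qed
        moreover have "\<bar>drift x y n\<bar> \<le> M" by (rule bounded) (use n(1) div in auto)
        ultimately show ?thesis unfolding slow_window_def using big n(1) div window_length
          by (intro exI[of _ "n + 1 - int (q r)"] exI[of _ n] bexI[of _ "drift x y n"]) auto
      qed
    qed
  qed
  show ?thesis by (rule that[of "c / 2" M]) (use cL main in auto)
qed

end

section \<open>From the rotation to the flow\<close>

context rotation_roof
begin

text \<open>The points which are about to change laps, in the past or in the future.\<close>

definition near_ends :: "real \<Rightarrow> (real \<times> real) set" where
  "near_ends \<eta> = {p \<in> X. snd p < \<eta> \<or> f (fst p) - \<eta> \<le> snd p}"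

text \<open>
  If the drift stays near \<open>d\<close> during the laps \<open>m, \<dots>, n\<close>, then delaying the second point by
  \<open>d\<close> keeps both points in the same lap, except when the first one is about to change laps.
\<close>

lemma flow_matching:
  assumes p: "(x, u) \<in> X" "(y, w) \<in> X"
    and t: "S m x \<le> t + u" "t + u < S n x"
    and d: "\<And>l. l \<in> {m..n} \<Longrightarrow> \<bar>S l y - S l x - d\<bar> \<le> \<epsilon>" and uw: "\<bar>u - w\<bar> \<le> \<epsilon>"
    and ends: "flow t (x, u) \<notin> near_ends (2 * \<epsilon>)"
  shows "special_flow_dist circle_dist (flow t (x, u)) (flow (t + d) (y, w)) \<le> circle_norm (x - y) + 2 * \<epsilon>"
proof -
  have xy: "x \<in> {0..<1}" "y \<in> {0..<1}" using p by (auto simp: mem_X)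
  define l where "l = lap x (t + u)"
  have l: "S l x \<le> t + u" "t + u < S (l + 1) x" using lap[where x = x and u = "t + u"] by (auto simp: l_def)
  have "S m x < S (l + 1) x" "S l x < S n x" using l t by linarith+
  then have "m < l + 1" "l < n" by (simp_all only: S_less_iff)
  then have mem: "l \<in> {m..n}" "l + 1 \<in> {m..n}" by auto
  have fx: "flow t (x, u) = (frac (x + of_int l * \<alpha>), t + u - S l x)"
    by (rule flow_eqI[OF xy(1) l])
  have "2 * \<epsilon> \<le> t + u - S l x" "t + u - S l x < f (x + of_int l * \<alpha>) - 2 * \<epsilon>"
    using ends flow_in_X[OF p(1), of t] unfolding near_ends_def fx by (auto simp: not_le)
  then have e: "2 * \<epsilon> \<le> t + u - S l x" "t + u + 2 * \<epsilon> < S (l + 1) x"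
    using roof_sum_Suc[of \<alpha> f l x] by linarith+
  have fy: "flow (t + d) (y, w) = (frac (y + of_int l * \<alpha>), t + d + w - S l y)"
    using d[OF mem(1)] d[OF mem(2)] uw e by (intro flow_eqI xy) linarith+
  have "\<bar>t + u - S l x - (t + d + w - S l y)\<bar> \<le> 2 * \<epsilon>" using d[OF mem(1)] uw by linarith
  then show ?thesis by (simp add: fx fy special_flow_dist_def)
qed

text \<open>
  The conclusion of the switchable property for one pair of points, with the frequency and
  the distance measured by the same \<open>e\<close>.
\<close>

definition synchronized ::
    "real \<Rightarrow> real set \<Rightarrow> real \<Rightarrow> real \<Rightarrow> nat \<Rightarrow> real \<times> real \<Rightarrow> real \<times> real \<Rightarrow> bool" where
  "synchronized t Q \<kappa> e N z z' \<longleftrightarrow>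
     (\<exists>(K::nat) (L::nat). \<exists>p\<in>Q. K > N \<and> L > N \<and> real L / real K \<ge> \<kappa> \<and>
        (real (card {n\<in>{K..K + L}. special_flow_dist circle_dist
           (flow (real n * t) z) (flow (real n * t + p) z') < e}) / real L > 1 - e \<or>
         real (card {n\<in>{K..K + L}. special_flow_dist circle_dist
           (flow (- real n * t) z) (flow (- real n * t + p) z') < e}) / real L > 1 - e))"

lemma synchronized_mono:
  assumes "synchronized t Q \<kappa> e N z z'" "e \<le> \<epsilon>"
  shows "synchronized t Q \<kappa> \<epsilon> N z z'"
proof -
  have weaken: "1 - \<epsilon> < real (card {n\<in>{K..K + L}. D n < \<epsilon>}) / real L"
    if "1 - e < real (card {n\<in>{K..K + L}. D n < e}) / real L" for D :: "nat \<Rightarrow> real" and K L :: nat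
  proof -
    have "card {n\<in>{K..K + L}. D n < e} \<le> card {n\<in>{K..K + L}. D n < \<epsilon>}"
      using assms(2) by (intro card_mono) auto
    then have "real (card {n\<in>{K..K + L}. D n < e}) / real L \<le> real (card {n\<in>{K..K + L}. D n < \<epsilon>}) / real L"
      by (intro divide_right_mono) auto
    with that assms(2) show ?thesis by linarith
  qed
  from assms(1) show ?thesis
    unfolding synchronized_def Bex_def by (elim ex_forward conj_forward disj_forward weaken)
qed

lemma flow_funpow: "p \<in> X \<Longrightarrow> (flow t ^^ n) p = flow (real n * t) p"
proof (induction n)
  case (Suc n)
  then have "(flow t ^^ Suc n) p = flow t (flow (real n * t) p)" by simp
  also have "\<dots> = flow (t + real n * t) p" by (rule flow_add[symmetric, OF Suc.prems])
  finally show ?case by (simp add: algebra_simps)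
qed (simp add: flow_0)

lemma same_fibre_same_orbit: "(x, u) \<in> X \<Longrightarrow> (x, w) \<in> X \<Longrightarrow> \<exists>t. (x, u) = flow t (x, w)"
  using flow_eqI[of x 0 "u - w" w] roof_sum_Suc[of \<alpha> f 0 x] by (intro exI[of _ "u - w"]) (simp add: mem_X frac_eq)

lemma near_ends_sets: "near_ends \<eta> \<in> sets \<mu>"
proof -
  have "near_ends \<eta> = {p \<in> space P. p \<in> X \<and> (snd p < \<eta> \<or> f (fst p) - \<eta> \<le> snd p)}"
    using sets.sets_into_space[OF X_sets] by (auto simp: near_ends_def)
  moreover have "\<dots> \<in> sets P" by measurable
  ultimately have "near_ends \<eta> \<in> sets P" by simp
  then show ?thesis by (simp only: sets_\<mu>) (auto simp: near_ends_def)
qed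

lemma measure_\<mu>: "A \<in> sets \<mu> \<Longrightarrow> emeasure P A \<le> ennreal b \<Longrightarrow> 0 \<le> b \<Longrightarrow> measure \<mu> A \<le> b / area"
proof -
  assume A: "A \<in> sets \<mu>" and b: "emeasure P A \<le> ennreal b" "0 \<le> b"
  have "emeasure \<mu> A \<le> ennreal b / ennreal area"
    unfolding emeasure_\<mu>[OF A] by (rule divide_right_mono_ennreal[OF b(1)])
  also have "\<dots> = ennreal (b / area)" using area_pos b(2) by (simp add: divide_ennreal)
  finally show ?thesis unfolding measure_def
    using area_pos b(2) enn2real_mono[of "emeasure \<mu> A" "ennreal (b / area)"] by simp
qed

lemma measure_near_ends:
  assumes "0 \<le> \<eta>"
  shows "measure \<mu> (near_ends \<eta>) \<le> 2 * \<eta> / area"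
proof (rule measure_\<mu>[OF near_ends_sets])
  have sP: "near_ends \<eta> \<in> sets P" using near_ends_sets sets_\<mu> by blast
  have "emeasure P (near_ends \<eta>) \<le> (\<integral>\<^sup>+x. ennreal (2 * \<eta>) \<partial>circle)"
    unfolding emeasure_P[OF sP]
  proof (rule nn_integral_mono)
    fix x assume "x \<in> space circle"
    have "emeasure lborel (Pair x -` near_ends \<eta>) \<le> emeasure lborel ({0..\<eta>} \<union> {f x - \<eta>..f x})"
      by (intro emeasure_mono) (auto simp: near_ends_def mem_X)
    also have "\<dots> \<le> emeasure lborel {0..\<eta>} + emeasure lborel {f x - \<eta>..f x}"
      by (rule emeasure_subadditive) auto
    also have "\<dots> = ennreal (2 * \<eta>)" using assms by (simp flip: ennreal_plus)
    finally show "emeasure lborel (Pair x -` near_ends \<eta>) \<le> ennreal (2 * \<eta>)" .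
  qed
  also have "\<dots> = ennreal (2 * \<eta>)"
    using prob_space.emeasure_space_1[OF prob_space_circle] by (simp del: space_circle)
  finally show "emeasure P (near_ends \<eta>) \<le> ennreal (2 * \<eta>)" .
qed (use assms in simp)

text \<open>The maximal inequality, for the number of visits to \<open>near_ends \<eta>\<close> at the times \<open>i t\<close>.\<close>

definition often_near_ends :: "real \<Rightarrow> real \<Rightarrow> real \<Rightarrow> (real \<times> real) set" where
  "often_near_ends t \<eta> \<theta> =
    {p \<in> X. \<exists>n\<ge>1. real (card {i. i < n \<and> flow (real i * t) p \<in> near_ends \<eta>}) > \<theta> * real n}"

lemma often_near_ends:
  assumes "0 \<le> \<eta>" "0 < \<theta>"
  shows "often_near_ends t \<eta> \<theta> \<in> sets \<mu>" "measure \<mu> (often_near_ends t \<eta> \<theta>) \<le> 2 * \<eta> / area / \<theta>"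
proof -
  interpret prob_space \<mu> by (rule prob_space_\<mu>)
  let ?g = "indicator (near_ends \<eta>) :: real \<times> real \<Rightarrow> real"
  have int: "integrable \<mu> ?g"
    by (rule integrable_const_bound[of _ 1, OF _ borel_measurable_indicator[OF near_ends_sets]])
      (simp add: indicator_def)
  have eq: "often_near_ends t \<eta> \<theta> = {p \<in> space \<mu>. \<exists>n\<ge>1. (\<Sum>i<n. ?g ((flow t ^^ i) p)) > \<theta> * real n}"
  proof -
    have "(\<Sum>i<n. ?g ((flow t ^^ i) p)) = real (card {i. i < n \<and> flow (real i * t) p \<in> near_ends \<eta>})"
      if "p \<in> X" for n p
    proof -
      have "(\<Sum>i<n. ?g ((flow t ^^ i) p)) = (\<Sum>i<n. if flow (real i * t) p \<in> near_ends \<eta> then 1 else 0)"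
        using that by (intro sum.cong) (auto simp: flow_funpow indicator_def)
      also have "\<dots> = real (card ({..<n} \<inter> {i. flow (real i * t) p \<in> near_ends \<eta>}))"
        by (simp add: sum.If_cases)
      also have "{..<n} \<inter> {i. flow (real i * t) p \<in> near_ends \<eta>} = {i. i < n \<and> flow (real i * t) p \<in> near_ends \<eta>}"
        by auto
      finally show ?thesis .
    qed
    then show ?thesis by (auto simp: often_near_ends_def)
  qed
  note mi = maximal_inequality[OF finite_measure_axioms flow_t_measurable distr_flow int _ assms(2), of t]
  show "often_near_ends t \<eta> \<theta> \<in> sets \<mu>" unfolding eq by (rule mi(1)) simp
  have "measure \<mu> (often_near_ends t \<eta> \<theta>) \<le> (\<integral>p. ?g p \<partial>\<mu>) / \<theta>" unfolding eq by (rule mi(2)) simp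
  also have "(\<integral>p. ?g p \<partial>\<mu>) = measure \<mu> (near_ends \<eta> \<inter> space \<mu>)" by simp
  also have "near_ends \<eta> \<inter> space \<mu> = near_ends \<eta>" by (auto simp: near_ends_def)
  also have "measure \<mu> (near_ends \<eta>) / \<theta> \<le> 2 * \<eta> / area / \<theta>"
    using measure_near_ends[OF assms(1)] assms(2) by (intro divide_right_mono) auto
  finally show "measure \<mu> (often_near_ends t \<eta> \<theta>) \<le> 2 * \<eta> / area / \<theta>" .
qed

text \<open>
  Where \<open>f\<close> is large, a small set of base points may carry a large part of the flow measure. For
  decreasing sets with null intersection, continuity of the measure is enough.
\<close>

lemma measure_strip_tendsto_0:
  assumes W: "\<And>n. W n \<in> sets circle" "decseq W" "(\<Inter>n. W n) \<in> null_sets circle"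
  shows "(\<lambda>n. measure \<mu> (strip (W n))) \<longlonglongrightarrow> 0"
proof -
  interpret prob_space \<mu> by (rule prob_space_\<mu>)
  have "(\<lambda>n. measure \<mu> (strip (W n))) \<longlonglongrightarrow> measure \<mu> (\<Inter>n. strip (W n))"
  proof (rule finite_Lim_measure_decseq)
    show "decseq (\<lambda>n. strip (W n))" using W(2) by (auto simp: decseq_def strip_def)
  qed (use strip_sets W(1) in auto)
  also have "(\<Inter>n. strip (W n)) = strip (\<Inter>n. W n)" by (auto simp: strip_def)
  also have "measure \<mu> (strip (\<Inter>n. W n)) = 0"
    using emeasure_\<mu>[OF strip_sets[of "\<Inter>n. W n"]] emeasure_strip_null[OF W(3)] W(3) by (auto simp: measure_def)
  finally show ?thesis .
qed

text \<open>
  Outside this set, \<open>n\<close> laps take at most the time \<open>K n\<close>. The two directions of time are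
  \<open>\<beta> = \<alpha>\<close> and \<open>\<beta> = - \<alpha>\<close>.
\<close>

definition steep :: "real \<Rightarrow> real \<Rightarrow> real set" where
  "steep \<beta> K = {x \<in> space circle. \<exists>n\<ge>1. (\<Sum>i<n. f (x + real i * \<beta>)) > K * real n}"

lemma steep_sets_measure:
  assumes "K > 0"
  shows "steep \<beta> K \<in> sets circle" "measure circle (steep \<beta> K) \<le> area / K"
proof -
  interpret prob_space circle by (rule prob_space_circle)
  have eq: "steep \<beta> K = {x \<in> space circle. \<exists>n\<ge>1. (\<Sum>i<n. f ((rotation \<beta> ^^ i) x)) > K * real n}"
    by (auto simp: steep_def rotation_funpow)
  have rot: "rotation \<beta> \<in> circle \<rightarrow>\<^sub>M circle" "distr circle circle (rotation \<beta>) = circle"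
    using measurable_rotation[of \<beta>] distr_circle_rotation[of \<beta>] by (simp_all add: rotation_def[abs_def])
  show "steep \<beta> K \<in> sets circle" "measure circle (steep \<beta> K) \<le> area / K"
    unfolding eq area_def by (rule maximal_inequality[OF finite_measure_axioms rot integrable less_imp_le[OF pos] assms])+
qed

lemmas steep_sets = steep_sets_measure(1)

lemma measure_strip_steep: "(\<lambda>n. measure \<mu> (strip (steep \<beta> (real (Suc n))))) \<longlonglongrightarrow> 0"
proof (rule measure_strip_tendsto_0)
  interpret prob_space circle by (rule prob_space_circle)
  show sets: "steep \<beta> (real (Suc n)) \<in> sets circle" for n by (rule steep_sets) simp
  show "decseq (\<lambda>n. steep \<beta> (real (Suc n)))"
  proof (rule decseq_SucI, rule subsetI)
    fix n x assume "x \<in> steep \<beta> (real (Suc (Suc n)))"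
    then obtain j where j: "x \<in> space circle" "j \<ge> 1" "real (Suc (Suc n)) * real j < (\<Sum>i<j. f (x + real i * \<beta>))"
      by (auto simp: steep_def)
    have "real (Suc n) * real j \<le> real (Suc (Suc n)) * real j" by (intro mult_right_mono) auto
    then have "real (Suc n) * real j < (\<Sum>i<j. f (x + real i * \<beta>))" using j(3) by linarith
    with j show "x \<in> steep \<beta> (real (Suc n))" unfolding steep_def by blast
  qed
  let ?I = "\<Inter>n. steep \<beta> (real (Suc n))"
  have I: "?I \<in> sets circle" using sets by blast
  have "measure circle ?I \<le> 0"
  proof (rule LIMSEQ_le_const)
    show "(\<lambda>n. area / real (Suc n)) \<longlonglongrightarrow> 0"
      by (rule LIMSEQ_Suc[OF lim_const_over_n])
    have "measure circle ?I \<le> area / real (Suc n)" for n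
      using finite_measure_mono[of ?I "steep \<beta> (real (Suc n))"] sets[of n] steep_sets_measure(2)[of "real (Suc n)" \<beta>] by force
    then show "\<exists>N. \<forall>n\<ge>N. measure circle ?I \<le> area / real (Suc n)" by blast
  qed
  then have "measure circle ?I = 0" by (simp add: measure_le_0_iff)
  then show "?I \<in> null_sets circle" using I by (simp add: null_sets_def emeasure_eq_measure)
qed

end

lemma emeasure_circle_norm_less:
  assumes "0 < l"
  shows "{x \<in> space circle. circle_norm (x - c) < l} \<in> sets circle"
    and "emeasure circle {x \<in> space circle. circle_norm (x - c) < l} \<le> ennreal (2 * l)"
proof -
  let ?B = "{z \<in> space circle. circle_norm z < l}"
  have m: "circle_norm \<in> borel_measurable borel"
  proof -
    have "continuous_on UNIV circle_norm"
      unfolding continuous_on_iff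
    proof (intro ballI allI impI)
      fix z e :: real assume "0 < e"
      have "\<bar>circle_norm w - circle_norm z\<bar> \<le> \<bar>w - z\<bar>" for w
        using circle_norm_triangle_diff[of w z] circle_norm_triangle_diff[of z w] by linarith
      then show "\<exists>d>0. \<forall>w\<in>UNIV. dist w z < d \<longrightarrow> dist (circle_norm w) (circle_norm z) < e"
        using \<open>0 < e\<close> by (intro exI[of _ e]) (auto simp: dist_real_def intro: le_less_trans)
    qed
    then show ?thesis by (rule borel_measurable_continuous_onI)
  qed
  have B: "?B \<in> sets circle"
    using measurable_circle_borel[OF m] by measurable
  have eq: "{x \<in> space circle. circle_norm (x - c) < l} = (\<lambda>x. frac (x + - c)) -` ?B \<inter> space circle"
  proof -
    have "circle_norm (frac z) = circle_norm z" for z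
      using circle_norm_diff_of_int[of z "\<lfloor>z\<rfloor>"] by (simp add: frac_def)
    then show ?thesis by (auto simp: frac_lt_1)
  qed
  show "{x \<in> space circle. circle_norm (x - c) < l} \<in> sets circle"
    unfolding eq by (rule measurable_sets[OF measurable_rotation B])
  have "emeasure circle {x \<in> space circle. circle_norm (x - c) < l}
      = emeasure (distr circle circle (\<lambda>x. frac (x + - c))) ?B"
    unfolding eq by (rule emeasure_distr[symmetric, OF measurable_rotation B])
  also have "\<dots> = emeasure lborel ?B" unfolding distr_circle_rotation by (rule emeasure_circle[OF B])
  also have "\<dots> \<le> emeasure lborel ({0..l} \<union> {1 - l..1})"
  proof (rule emeasure_mono)
    show "?B \<subseteq> {0..l} \<union> {1 - l..1}"
    proof
      fix z assume z: "z \<in> ?B"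
      then have z01: "0 \<le> z" "z < 1" "circle_norm z < l" by auto
      obtain j :: int where j: "circle_norm z = \<bar>z - of_int j\<bar>" by (rule circle_norm_obtain)
      have "j \<le> 0 \<or> 1 \<le> j" by linarith
      then have "real_of_int j \<le> 0 \<or> 1 \<le> real_of_int j" by linarith
      then show "z \<in> {0..l} \<union> {1 - l..1}" using z01 j by auto
    qed
  qed simp
  also have "\<dots> \<le> emeasure lborel {0..l} + emeasure lborel {1 - l..1}" by (rule emeasure_subadditive) auto
  also have "\<dots> = ennreal (2 * l)" using assms by (simp flip: ennreal_plus)
  finally show "emeasure circle {x \<in> space circle. circle_norm (x - c) < l} \<le> ennreal (2 * l)" .
qed

text \<open>
  The times \<open>n t\<close> in a window \<open>(A, B)\<close>. Bad times are rare among all times up to \<open>T\<close>, hence also in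
  the window, because its length is not small compared with \<open>T\<close>.
\<close>

lemma window_count:
  fixes good bad :: "nat \<Rightarrow> bool" and N :: nat
  assumes t: "0 < t" and e: "0 < e"
    and AB: "0 < A" "real N * t \<le> A" "len \<le> B - A" "B \<le> T"
    and ln: "6 * t \<le> len" "2 * real N * t < len" "2 * \<kappa> * T \<le> len" "8 * \<theta> * T \<le> e * len" "0 < \<theta>"
    and bad: "\<And>n. n \<ge> 1 \<Longrightarrow> real (card {i. i < n \<and> bad i}) \<le> \<theta> * real n"
    and good: "\<And>n. A < real n * t \<Longrightarrow> real n * t < B \<Longrightarrow> \<not> bad n \<Longrightarrow> good n"
  shows "\<exists>K L. K > N \<and> L > N \<and> real L / real K \<ge> \<kappa> \<and> real (card {n \<in> {K..K + L}. good n}) / real L > 1 - e"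
proof -
  define K where "K = nat \<lfloor>A / t\<rfloor> + 1"
  define L where "L = nat \<lfloor>len / t\<rfloor> - 2"
  have K: "A / t < real K" "real K \<le> A / t + 1"
  proof -
    have "0 \<le> \<lfloor>A / t\<rfloor>" using AB(1) t by simp
    then have "real K = of_int \<lfloor>A / t\<rfloor> + 1" by (simp add: K_def)
    then show "A / t < real K" "real K \<le> A / t + 1" by linarith+
  qed
  have L: "len / t - 3 < real L" "real L \<le> len / t - 2"
  proof -
    have "6 \<le> len / t" using ln(1) t by (simp add: field_simps)
    then have "6 \<le> \<lfloor>len / t\<rfloor>" by linarith
    then have "int L = \<lfloor>len / t\<rfloor> - 2" unfolding L_def by linarith
    then have "real L = of_int \<lfloor>len / t\<rfloor> - 2" by (metis of_int_diff of_int_numeral of_int_of_nat_eq)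
    then show "len / t - 3 < real L" "real L \<le> len / t - 2" by linarith+
  qed
  have L2: "len / t \<le> 2 * real L" using L ln(1) t by (simp add: field_simps)
  have lenpos: "0 < len" using ln(1) t by linarith
  have Bt: "A / t + len / t \<le> B / t"
    using divide_right_mono[of "A + len" B t] AB(3) t by (simp add: add_divide_distrib)
  have KL: "real (K + L) < B / t" using K(2) L(2) Bt by linarith
  have BT: "B / t \<le> T / t" using AB(4) t by (intro divide_right_mono) auto
  have KN: "N < K"
  proof -
    have "real N \<le> A / t" using AB(2) t by (simp add: field_simps)
    then show ?thesis using K(1) by linarith
  qed
  have LN: "N < L"
  proof -
    have "2 * real N < len / t" using ln(2) t by (simp add: field_simps)
    then show ?thesis using L2 by linarith
  qed
  have Tpos: "0 < T" using AB lenpos by linarith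
  have ratio: "\<kappa> \<le> real L / real K"
  proof (cases "\<kappa> \<le> 0")
    case False
    have "\<kappa> * real K \<le> \<kappa> * (T / t)" using KL BT False by (intro mult_left_mono) auto
    also have "\<dots> \<le> len / t / 2" using ln(3) t by (simp add: field_simps)
    also have "\<dots> \<le> real L" using L2 by simp
    finally show ?thesis using KN by (simp add: field_simps)
  next
    case True
    then show ?thesis by (meson divide_nonneg_nonneg of_nat_0_le_iff order_trans)
  qed
  have good': "good n" if "n \<in> {K..K + L}" "\<not> bad n" for n
  proof (rule good[OF _ _ that(2)])
    have "A / t < real n" using K(1) that(1) by auto
    then show "A < real n * t" using t by (simp add: field_simps)
    have "real n < B / t" using KL that(1) by auto
    then show "real n * t < B" using t by (simp add: field_simps)
  qed
  have Lpos: "0 < real L" using LN by simp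
  have few: "real (card {n \<in> {K..K + L}. bad n}) \<le> e / 2 * real L"
  proof -
    have "card {n \<in> {K..K + L}. bad n} \<le> card {i. i < K + L + 1 \<and> bad i}"
      by (rule card_mono) auto
    then have "real (card {n \<in> {K..K + L}. bad n}) \<le> \<theta> * real (K + L + 1)"
      using bad[of "K + L + 1"] by linarith
    also have "\<dots> \<le> \<theta> * (2 * (T / t))"
      using ln(5) KL BT KN by (intro mult_left_mono) auto
    also have "\<dots> \<le> e / 4 * (len / t)" using ln(4) t by (simp add: field_simps)
    also have "\<dots> \<le> e / 4 * (2 * real L)" using L2 e by (intro mult_left_mono) auto
    finally show ?thesis by simp
  qed
  have "card {K..K + L} \<le> card ({n \<in> {K..K + L}. good n} \<union> {n \<in> {K..K + L}. bad n})"
    using good' by (intro card_mono) auto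
  also have "\<dots> \<le> card {n \<in> {K..K + L}. good n} + card {n \<in> {K..K + L}. bad n}" by (rule card_Un_le)
  finally have "real L + 1 \<le> real (card {n \<in> {K..K + L}. good n}) + real (card {n \<in> {K..K + L}. bad n})"
    by simp
  then have "real L + 1 - e / 2 * real L \<le> real (card {n \<in> {K..K + L}. good n})" using few by linarith
  moreover have "(1 - e) * real L < real L + 1 - e / 2 * real L"
    using e Lpos by (simp add: algebra_simps add_pos_pos)
  ultimately have "(1 - e) * real L < real (card {n \<in> {K..K + L}. good n})" by linarith
  then have "1 - e < real (card {n \<in> {K..K + L}. good n}) / real L" using Lpos by (simp add: field_simps)
  with KN LN ratio show ?thesis by blast
qed

context singular_roof
begin

section \<open>The SWR-property\<close>

text \<open>
  Both directions of time are included, because the one in which the strong singularities are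
  avoided depends on the pair of points and on the scale.
\<close>

definition weak_visit :: "nat \<Rightarrow> real set" where
  "weak_visit s = (\<Union>n\<in>{- int (q s)..int (q s)}. \<Union>i\<in>{1..v}.
     {x \<in> space circle. circle_norm (x - (a i - of_int n * \<alpha>)) < 2 * \<xi> i s})"

lemma avoids_weak_if_not_visit:
  assumes "x \<in> space circle" "x \<notin> weak_visit s"
  shows "avoids_weak s x {- int (q s)..int (q s)}"
  unfolding avoids_weak_def
proof (intro ballI, rule ccontr)
  fix n i assume n: "n \<in> {- int (q s)..int (q s)}" "i \<in> {1..v}" "\<not> 2 * \<xi> i s \<le> circle_norm (x + of_int n * \<alpha> - a i)"
  then have "circle_norm (x - (a i - of_int n * \<alpha>)) < 2 * \<xi> i s" by (simp add: algebra_simps)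
  with n assms show False unfolding weak_visit_def by blast
qed

lemma weak_visit_sets: "weak_visit s \<in> sets circle"
proof -
  have "0 < 2 * \<xi> i s" if "i \<in> {1..v}" for i using F_\<xi>[OF that, of s] by simp
  then show ?thesis
    unfolding weak_visit_def using emeasure_circle_norm_less(1) by (intro sets.finite_UN) auto
qed

text \<open>The summability condition on the \<open>\<xi> i s\<close>, through the Borel-Cantelli lemma.\<close>

lemma measure_strip_weak_visit: "(\<lambda>n. measure roof.\<mu> (roof.strip (\<Union>s\<in>{n..}. weak_visit s))) \<longlonglongrightarrow> 0"
proof (rule roof.measure_strip_tendsto_0)
  interpret circle: prob_space circle by (rule prob_space_circle)
  have \<xi>_pos: "0 < 2 * \<xi> i s" if "i \<in> {1..v}" for i s using F_\<xi>[OF that, of s] by simp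
  note sets = weak_visit_sets
  show "(\<Union>s\<in>{n..}. weak_visit s) \<in> sets circle" for n using sets by auto
  show "decseq (\<lambda>n. \<Union>s\<in>{n..}. weak_visit s)" by (force simp: decseq_def)
  define b where "b s = (\<Sum>i\<in>{1..v}. 12 * (real (q s) * \<xi> i s))" for s
  have "summable b" unfolding b_def[abs_def] by (intro summable_sum summable_mult F_\<xi>_summable)
  have le: "measure circle (weak_visit s) \<le> b s" for s
  proof -
    let ?J = "{- int (q s)..int (q s)}"
    let ?B = "\<lambda>n i. {x \<in> space circle. circle_norm (x - (a i - of_int n * \<alpha>)) < 2 * \<xi> i s}"
    have B: "?B n i \<in> sets circle" "measure circle (?B n i) \<le> 4 * \<xi> i s" if i: "i \<in> {1..v}" for n i
    proof -
      show "?B n i \<in> sets circle" by (rule emeasure_circle_norm_less(1)[OF \<xi>_pos[OF i]])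
      have "ennreal (measure circle (?B n i)) \<le> ennreal (4 * \<xi> i s)"
        using emeasure_circle_norm_less(2)[OF \<xi>_pos[OF i], of "a i - of_int n * \<alpha>"]
        by (simp add: circle.emeasure_eq_measure)
      then show "measure circle (?B n i) \<le> 4 * \<xi> i s" using \<xi>_pos[OF i, of s] by simp
    qed
    have inner: "(\<Union>i\<in>{1..v}. ?B n i) \<in> sets circle" for n using B(1) by (intro sets.finite_UN) auto
    have "measure circle (weak_visit s) \<le> (\<Sum>n\<in>?J. measure circle (\<Union>i\<in>{1..v}. ?B n i))"
      unfolding weak_visit_def using inner by (intro circle.finite_measure_subadditive_finite) auto
    also have "\<dots> \<le> (\<Sum>n\<in>?J. \<Sum>i\<in>{1..v}. 4 * \<xi> i s)"
    proof (rule sum_mono)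
      fix n
      have "measure circle (\<Union>i\<in>{1..v}. ?B n i) \<le> (\<Sum>i\<in>{1..v}. measure circle (?B n i))"
        using B(1) by (intro circle.finite_measure_subadditive_finite) auto
      also have "\<dots> \<le> (\<Sum>i\<in>{1..v}. 4 * \<xi> i s)" by (intro sum_mono B(2))
      finally show "measure circle (\<Union>i\<in>{1..v}. ?B n i) \<le> (\<Sum>i\<in>{1..v}. 4 * \<xi> i s)" .
    qed
    also have "\<dots> = (2 * real (q s) + 1) * (\<Sum>i\<in>{1..v}. 4 * \<xi> i s)" by (simp add: nat_add_distrib)
    also have "\<dots> \<le> (3 * real (q s)) * (\<Sum>i\<in>{1..v}. 4 * \<xi> i s)"
      using q_ge_1[of s] \<xi>_pos by (intro mult_right_mono sum_nonneg) (auto simp: less_imp_le)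
    also have "\<dots> = b s" by (simp add: b_def sum_distrib_left mult_ac)
    finally show ?thesis .
  qed
  have "summable (\<lambda>s. measure circle (weak_visit s))"
    by (rule summable_comparison_test'[OF \<open>summable b\<close>, of 0]) (use le in auto)
  then have "limsup weak_visit \<in> null_sets circle"
    using sets by (intro borel_cantelli_limsup1) (auto simp: circle.emeasure_eq_measure)
  then show "(\<Inter>n. \<Union>s\<in>{n..}. weak_visit s) \<in> null_sets circle"
    by (simp add: limsup_INF_SUP)
qed

lemma scale_exists:
  assumes "0 < \<Delta>" "\<Delta> < 1 / H s\<^sub>0"
  obtains s where "s \<ge> s\<^sub>0" "1 / H (Suc s) < \<Delta>" "\<Delta> \<le> 1 / H s"
proof -
  obtain n where n: "1 / \<Delta> < H n"
    using filterlim_at_top_dense[THEN iffD1, OF H_at_top, rule_format, of "1 / \<Delta>"]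
    by (auto simp: eventually_sequentially)
  define r where "r = (LEAST r. 1 / \<Delta> < H r)"
  have r: "1 / \<Delta> < H r" unfolding r_def by (rule LeastI[where P = "\<lambda>r. 1 / \<Delta> < H r", OF n])
  have "H s\<^sub>0 < 1 / \<Delta>" using assms H_pos[of s\<^sub>0] by (simp add: field_simps)
  then have "\<not> r \<le> s\<^sub>0" using H_mono[of r s\<^sub>0] r by linarith
  then obtain s where s: "r = Suc s" "s\<^sub>0 \<le> s" by (cases r) auto
  have "\<not> 1 / \<Delta> < H s" using not_less_Least[of s "\<lambda>r. 1 / \<Delta> < H r"] s(1) by (simp add: r_def)
  then show ?thesis using r s assms(1) H_pos[of s] H_pos[of "Suc s"]
    by (intro that[of s]) (auto simp: field_simps)
qed

text \<open>
  The backward sums start at time \<open>-1\<close>; adding the term \<open>f x\<close> makes them Birkhoff sums of the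
  inverse rotation, to which the maximal inequality applies.
\<close>

lemma roof_sum_backward: "f x - S (- int n) x = (\<Sum>i<Suc n. f (x + real i * - \<alpha>))"
proof (induction n)
  case (Suc n)
  have "S (- int n) x = S (- int (Suc n)) x + f (x + real (Suc n) * - \<alpha>)"
    using roof_sum_Suc[of \<alpha> f "- int (Suc n)" x] by (simp add: algebra_simps)
  then show ?case using Suc by (simp add: sum.lessThan_Suc[of _ "Suc n"] del: sum.lessThan_Suc of_nat_Suc)
qed simp

lemma not_steep_bounds:
  assumes x: "x \<in> space circle" "x \<notin> roof.steep \<alpha> K" "x \<notin> roof.steep (- \<alpha>) K"
  shows "n \<ge> 1 \<Longrightarrow> S (int n) x \<le> K * real n" "f x - S (- int n) x \<le> K * real (Suc n)" "f x \<le> K"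
proof -
  have fw: "(\<Sum>i<n. f (x + real i * \<alpha>)) \<le> K * real n" if "n \<ge> 1" for n
    using x(1,2) that unfolding roof.steep_def by (auto simp: not_less)
  have bw: "(\<Sum>i<n. f (x + real i * - \<alpha>)) \<le> K * real n" if "n \<ge> 1" for n
    using x(1,3) that unfolding roof.steep_def by (auto simp: not_less)
  show "S (int n) x \<le> K * real n" if "n \<ge> 1" using fw[OF that] by (simp add: roof_sum_of_nat)
  show "f x - S (- int n) x \<le> K * real (Suc n)" unfolding roof_sum_backward by (rule bw) simp
  show "f x \<le> K" using fw[of 1] by simp
qed

text \<open>
  Outside the exceptional sets, a slow window of the drift becomes a window of real times, of
  length comparable to its endpoints, in which the two orbits of the flow are close, up to the
  constant delay \<open>p\<close>, at most of the times \<open>n t\<^sub>0\<close>.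
\<close>

lemma good_times:
  fixes N :: nat
  assumes X: "(x, u) \<in> roof.X" "(y, w) \<in> roof.X" and t\<^sub>0: "0 < t\<^sub>0" and e: "0 < e"
    and steep: "x \<notin> roof.steep \<alpha> K" "x \<notin> roof.steep (- \<alpha>) K" and K: "1 \<le> K"
    and often: "(x, u) \<notin> roof.often_near_ends t\<^sub>0 (2 * \<epsilon>) \<theta>" "(x, u) \<notin> roof.often_near_ends (- t\<^sub>0) (2 * \<epsilon>) \<theta>"
    and window: "slow_window \<kappa> \<epsilon> Q s x (y + of_int j) b" and b: "b = 0 \<or> b = - int (q s div 2)"
    and close: "circle_norm (x - y) + 2 * \<epsilon> < e" "\<bar>u - w\<bar> \<le> \<epsilon>"
    and g\<^sub>0: "g\<^sub>0 > 0" "\<And>n x. n \<ge> n\<^sub>g \<Longrightarrow> g\<^sub>0 * real n \<le> S (int n) x"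
    and len: "len = g\<^sub>0 * \<kappa> / (2 * R) * real (q s)"
    and large: "6 * t\<^sub>0 \<le> len" "2 * real N * t\<^sub>0 < len" "real N * t\<^sub>0 + K \<le> g\<^sub>0 / 32 * real (q s)"
      "real n\<^sub>g + 1 \<le> 1 / 32 * real (q s)" "real n\<^sub>g \<le> \<kappa> / (2 * R) * real (q s)"
    and \<kappa>': "2 * \<kappa>' * (2 * K * real (q s)) \<le> len" and \<theta>: "8 * \<theta> * (2 * K * real (q s)) \<le> e * len" "0 < \<theta>"
  shows "roof.synchronized t\<^sub>0 Q \<kappa>' e N (x, u) (y, w)"
proof -
  obtain m n p where mn: "p \<in> Q" "b + int (q s div 16) \<le> m" "n \<le> b + int (q s div 4)"
    "\<kappa> * real (q s) \<le> 2 * R * real_of_int (n - m)"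
    and drift: "\<And>l. l \<in> {m..n} \<Longrightarrow> \<bar>drift x (y + of_int j) l - p\<bar> \<le> \<epsilon>"
    using window unfolding slow_window_def by blast
  have xs: "x \<in> space circle" "0 \<le> u" "u < f x" using X(1) by (auto simp: roof.mem_X)
  note bounds = not_steep_bounds[OF xs(1) steep]
  define z where "z = q s div 16"
  have z: "real (q s) / 32 \<le> real z" "real n\<^sub>g + 1 \<le> real z"
  proof -
    have "q s < 16 * (z + 1)"
      using dividend_less_div_times[of 16 "q s"] unfolding z_def by (simp add: mult.commute)
    then have "real (q s) < real (16 * (z + 1))" by (simp only: of_nat_less_iff)
    then show "real (q s) / 32 \<le> real z" using large(4) by simp
    then show "real n\<^sub>g + 1 \<le> real z" using large(4) by simp
  qed
  have "g\<^sub>0 * (real (q s) / 32) \<le> g\<^sub>0 * real z" using z(1) g\<^sub>0(1) by (intro mult_left_mono) auto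
  then have start: "real N * t\<^sub>0 + K \<le> g\<^sub>0 * real z" using large(3) by simp
  have after: "real N * t\<^sub>0 + K \<le> S l x'" if "int z \<le> l" for l x'
  proof -
    have l: "real z \<le> real (nat l)" using that by linarith
    then have "g\<^sub>0 * real z \<le> g\<^sub>0 * real (nat l)" using g\<^sub>0(1) by (intro mult_left_mono) auto
    also have "\<dots> \<le> S (int (nat l)) x'" using l z(2) by (intro g\<^sub>0(2)) linarith
    finally show ?thesis using start that by simp
  qed
  have len_le: "len \<le> S n x - S m x"
  proof -
    have 1: "\<kappa> / (2 * R) * real (q s) \<le> real_of_int (n - m)" using mn(4) R_pos by (simp add: field_simps)
    then have nm: "real n\<^sub>g \<le> real_of_int (n - m)" using large(5) by linarith
    then have nm': "int (nat (n - m)) = n - m" "n\<^sub>g \<le> nat (n - m)" by linarith+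
    have "len = g\<^sub>0 * (\<kappa> / (2 * R) * real (q s))" by (simp add: len)
    also have "\<dots> \<le> g\<^sub>0 * real_of_int (n - m)" using 1 g\<^sub>0(1) by (intro mult_left_mono) auto
    also have "\<dots> = g\<^sub>0 * real (nat (n - m))" using nm'(1) by (metis of_int_of_nat_eq)
    also have "\<dots> \<le> S (n - m) (x + of_int m * \<alpha>)" using g\<^sub>0(2)[OF nm'(2), of "x + of_int m * \<alpha>"] unfolding nm'(1) .
    also have "\<dots> = S n x - S m x" using roof_sum_add[of \<alpha> f m "n - m" x] by simp
    finally show ?thesis .
  qed
  have len_pos: "0 < len" using large(1) t\<^sub>0 by linarith
  have mn_le: "m \<le> n" using len_le len_pos roof.S_less_iff[of m x n] by linarith
  have match: "special_flow_dist circle_dist (roof.flow t (x, u)) (roof.flow (t + p) (y, w)) < e"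
    if t: "S m x < t + u" "t + u < S n x" "roof.flow t (x, u) \<notin> roof.near_ends (2 * \<epsilon>)" for t
  proof -
    have "special_flow_dist circle_dist (roof.flow t (x, u)) (roof.flow (t + p) (y, w)) \<le> circle_norm (x - y) + 2 * \<epsilon>"
    proof (rule roof.flow_matching[OF X _ t(2) _ close(2) t(3)])
      show "\<bar>S l y - S l x - p\<bar> \<le> \<epsilon>" if "l \<in> {m..n}" for l
        using drift[OF that] by (simp add: drift_def)
    qed (use t in simp)
    then show ?thesis using close(1) by linarith
  qed
  have rare: "real (card {i. i < n \<and> roof.flow (real i * t) (x, u) \<in> roof.near_ends (2 * \<epsilon>)}) \<le> \<theta> * real n"
    if "(x, u) \<notin> roof.often_near_ends t (2 * \<epsilon>) \<theta>" "n \<ge> 1" for t n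
    using that X(1) unfolding roof.often_near_ends_def by (auto simp: not_less)
  have div: "q s div 4 + q s div 16 \<le> q s div 2" "q s div 4 \<le> q s" "q s div 2 \<le> q s"
  proof -
    have "q s div 16 \<le> q s div 4" by (rule div_le_mono2) simp_all
    moreover have "q s div 4 + q s div 4 \<le> q s div 2" by (simp add: less_eq_div_iff_mult_less_eq)
    ultimately show "q s div 4 + q s div 16 \<le> q s div 2" by linarith
  qed simp_all
  note count = window_count[OF t\<^sub>0 e, where len = len and T = "2 * K * real (q s)" and \<theta> = \<theta> and \<kappa> = \<kappa>' and N = N,
      OF _ _ _ _ large(1,2) \<kappa>' \<theta>]
  show ?thesis
  proof (cases "b = 0")
    case True
    then have m: "int z \<le> m" using mn(2) by (simp add: z_def)
    have A: "real N * t\<^sub>0 + K \<le> S m x" by (rule after[OF m])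
    have B: "S n x \<le> K * real (q s)"
    proof -
      have "1 \<le> nat n" using m mn_le z(2) by linarith
      then have "S (int (nat n)) x \<le> K * real (nat n)" by (rule bounds(1))
      also have "\<dots> \<le> K * real (q s)" using K mn(3) True div(2) by (intro mult_left_mono) auto
      finally show ?thesis using m mn_le by simp
    qed
    have "0 \<le> real N * t\<^sub>0" using t\<^sub>0 by simp
    have "0 \<le> K * real (q s)" using K by simp
    obtain k L where kL: "k > N" "L > N" "real L / real k \<ge> \<kappa>'"
      "1 - e < real (card {i \<in> {k..k + L}. special_flow_dist circle_dist
        (roof.flow (real i * t\<^sub>0) (x, u)) (roof.flow (real i * t\<^sub>0 + p) (y, w)) < e}) / real L"
    proof (atomize_elim, rule count[where bad = "\<lambda>i. roof.flow (real i * t\<^sub>0) (x, u) \<in> roof.near_ends (2 * \<epsilon>)"])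
      show "0 < S m x - u" "real N * t\<^sub>0 \<le> S m x - u" using A bounds(3) xs \<open>0 \<le> real N * t\<^sub>0\<close> by linarith+
      show "len \<le> (S n x - u) - (S m x - u)" using len_le by simp
      show "S n x - u \<le> 2 * K * real (q s)" using B xs(2) \<open>0 \<le> K * real (q s)\<close> by linarith
    qed (use rare[OF often(1)] match in auto)
    then show ?thesis using mn(1) unfolding roof.synchronized_def by blast
  next
    case False
    with b have b': "b = - int (q s div 2)" by simp
    have n: "int z \<le> - n" using mn(3) b' div(1) unfolding z_def by linarith
    have A: "real N * t\<^sub>0 + K \<le> - S n x"
      using after[OF n, of "x + of_int n * \<alpha>"] roof_sum_minus[of \<alpha> f n "x + of_int n * \<alpha>"] by simp
    have B: "u - S m x \<le> 2 * K * real (q s)"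
    proof -
      have m: "- m \<le> int (q s)" "m \<le> 0" using mn(2) b' div(3) n mn_le by linarith+
      have "f x - S (- int (nat (- m))) x \<le> K * real (Suc (nat (- m)))" by (rule bounds(2))
      also have "\<dots> \<le> K * (2 * real (q s))" using K m q_ge_1[of s] by (intro mult_left_mono) auto
      finally show ?thesis using m xs(3) by simp
    qed
    have "0 \<le> real N * t\<^sub>0" using t\<^sub>0 by simp
    obtain k L where kL: "k > N" "L > N" "real L / real k \<ge> \<kappa>'"
      "1 - e < real (card {i \<in> {k..k + L}. special_flow_dist circle_dist
        (roof.flow (- real i * t\<^sub>0) (x, u)) (roof.flow (- real i * t\<^sub>0 + p) (y, w)) < e}) / real L"
    proof (atomize_elim, rule count[where bad = "\<lambda>i. roof.flow (- real i * t\<^sub>0) (x, u) \<in> roof.near_ends (2 * \<epsilon>)"])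
      show "0 < u - S n x" "real N * t\<^sub>0 \<le> u - S n x" using A K xs \<open>0 \<le> real N * t\<^sub>0\<close> by linarith+
      show "len \<le> (u - S m x) - (u - S n x)" using len_le by simp
      show "u - S m x \<le> 2 * K * real (q s)" by (rule B)
      show "real (card {i. i < l \<and> roof.flow (- real i * t\<^sub>0) (x, u) \<in> roof.near_ends (2 * \<epsilon>)}) \<le> \<theta> * real l"
        if "l \<ge> 1" for l using rare[OF often(2) that] by simp
      show "special_flow_dist circle_dist
          (roof.flow (- real i * t\<^sub>0) (x, u)) (roof.flow (- real i * t\<^sub>0 + p) (y, w)) < e"
        if "u - S n x < real i * t\<^sub>0" "real i * t\<^sub>0 < u - S m x"
          "roof.flow (- real i * t\<^sub>0) (x, u) \<notin> roof.near_ends (2 * \<epsilon>)" for i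
        by (rule match[OF _ _ that(3)]) (use that(1,2) in auto)
    qed
    then show ?thesis using mn(1) unfolding roof.synchronized_def by blast
  qed
qed

text \<open>
  The constants are chosen in the order \<open>K\<close>, \<open>\<rho>\<close>, \<open>\<kappa>\<close>, \<open>\<theta>\<close>. Since \<open>\<theta>\<close> is a multiple of \<open>\<kappa>\<close> and the points
  near the ends have measure at most a multiple of \<open>\<rho> \<kappa>\<close>, the factor \<open>\<kappa>\<close> cancels in the maximal
  inequality, so that \<open>\<rho>\<close> can be chosen before \<open>\<kappa>\<close>.
\<close>

lemma SWR:
  "SWR_property (special_flow_measure circle f) (special_flow_dist circle_dist)
     (special_flow circle (rotation \<alpha>) f)"
proof -
  obtain c M where c: "0 < c" and window: "\<forall>\<rho>>0. \<exists>\<kappa>>0. \<kappa> \<le> 1 \<and>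
      (\<forall>\<^sub>F s in sequentially. \<forall>x y b. admissible s x y b \<longrightarrow>
        slow_window \<kappa> (\<rho> * \<kappa>) {p. c \<le> \<bar>p\<bar> \<and> \<bar>p\<bar> \<le> M} s x y b)"
    by (rule drift_window) (rule that)
  obtain g\<^sub>0 n\<^sub>g where g\<^sub>0: "g\<^sub>0 > 0" "\<And>n x. n \<ge> n\<^sub>g \<Longrightarrow> g\<^sub>0 * real n \<le> S (int n) x"
    using roof_sum_linear_growth by blast
  define Q where "Q = {p. c \<le> \<bar>p\<bar> \<and> \<bar>p\<bar> \<le> M}"
  have Q: "compact Q" "0 \<notin> Q"
  proof -
    have "Q = {- M..- c} \<union> {c..M}" using c by (auto simp: Q_def abs_if split: if_splits)
    then show "compact Q" by (simp add: compact_Un)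
    show "0 \<notin> Q" using c by (simp add: Q_def)
  qed
  interpret \<mu>: prob_space roof.\<mu> by (rule roof.prob_space_\<mu>)
  let ?d = "special_flow_dist circle_dist"
  show ?thesis
  proof (rule roof.SWR_propertyI[OF Q])
    fix t\<^sub>0 :: real assume t\<^sub>0: "t\<^sub>0 > 0"
    show "switchable_R roof.\<mu> ?d roof.flow t\<^sub>0 Q"
      unfolding switchable_R_def roof.synchronized_def[symmetric]
    proof (intro allI impI)
      fix \<epsilon> :: real assume "\<epsilon> > 0"
      define e where "e = min \<epsilon> 1"
      have e: "0 < e" "e \<le> 1" "e \<le> \<epsilon>" using \<open>\<epsilon> > 0\<close> by (auto simp: e_def)
      have "\<forall>\<^sub>F n in sequentially. measure roof.\<mu> (roof.strip (roof.steep \<beta> (real (Suc n)))) < e / 8" for \<beta>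
        by (rule order_tendstoD(2)[OF roof.measure_strip_steep]) (use e in simp)
      then have "\<forall>\<^sub>F n in sequentially. measure roof.\<mu> (roof.strip (roof.steep \<alpha> (real (Suc n)))) < e / 8 \<and>
          measure roof.\<mu> (roof.strip (roof.steep (- \<alpha>) (real (Suc n)))) < e / 8"
        by (intro eventually_conj)
      then obtain n\<^sub>1 where n\<^sub>1: "measure roof.\<mu> (roof.strip (roof.steep \<alpha> (real (Suc n\<^sub>1)))) < e / 8"
          "measure roof.\<mu> (roof.strip (roof.steep (- \<alpha>) (real (Suc n\<^sub>1)))) < e / 8"
        by (auto simp: eventually_sequentially)
      define K where "K = real (Suc n\<^sub>1)"
      have K: "K \<ge> 1" by (simp add: K_def)
      \<comment> \<open>The numerical factors leave to each of the five exceptional sets a measure less than \<open>e / 8\<close>.\<close>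
      define \<rho> where "\<rho> = min (e / 8) (e\<^sup>2 * g\<^sub>0 * roof.area / (2048 * R * K))"
      have \<rho>: "0 < \<rho>" "\<rho> \<le> e / 8" "\<rho> \<le> e\<^sup>2 * g\<^sub>0 * roof.area / (2048 * R * K)"
        using e g\<^sub>0 K R_pos roof.area_pos by (auto simp: \<rho>_def)
      obtain \<kappa> where \<kappa>: "\<kappa> > 0" "\<kappa> \<le> 1" and window\<kappa>:
        "\<forall>\<^sub>F s in sequentially. \<forall>x y b. admissible s x y b \<longrightarrow> slow_window \<kappa> (\<rho> * \<kappa>) Q s x y b"
        using window \<rho>(1) unfolding Q_def by blast
      define \<epsilon>' where "\<epsilon>' = \<rho> * \<kappa>"
      have \<epsilon>': "0 < \<epsilon>'" "\<epsilon>' \<le> e / 8"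
        using \<rho> \<kappa> mult_mono[of \<rho> "e / 8" \<kappa> 1] by (auto simp: \<epsilon>'_def)
      define \<theta> where "\<theta> = e * g\<^sub>0 * \<kappa> / (32 * R * K)"
      have \<theta>: "\<theta> > 0" using e g\<^sub>0 \<kappa> R_pos K by (simp add: \<theta>_def)
      have often: "measure roof.\<mu> (roof.often_near_ends t (2 * \<epsilon>') \<theta>) < e / 8" for t
      proof -
        have "2 * (2 * \<epsilon>') / roof.area / \<theta> = \<rho> * (128 * R * K / (e * g\<^sub>0 * roof.area))"
          using e g\<^sub>0 \<kappa> R_pos K roof.area_pos by (simp add: \<theta>_def \<epsilon>'_def field_simps)
        also have "\<dots> \<le> e\<^sup>2 * g\<^sub>0 * roof.area / (2048 * R * K) * (128 * R * K / (e * g\<^sub>0 * roof.area))"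
          using e g\<^sub>0 R_pos K roof.area_pos by (intro mult_right_mono \<rho>(3)) auto
        also have "\<dots> = e / 16"
          using e g\<^sub>0 R_pos K roof.area_pos by (simp add: field_simps power2_eq_square)
        finally show ?thesis using roof.often_near_ends(2)[of "2 * \<epsilon>'" \<theta> t] \<epsilon>' \<theta> e by linarith
      qed
      define \<kappa>' where "\<kappa>' = g\<^sub>0 * \<kappa> / (8 * R * K)"
      show "\<exists>\<kappa>>0. \<forall>N. \<exists>\<delta>>0. \<exists>Z\<in>sets roof.\<mu>. 1 - \<epsilon> < measure roof.\<mu> Z \<and>
        (\<forall>P\<in>Z. \<forall>P'\<in>Z. ?d P P' < \<delta> \<and> (\<nexists>t. P = roof.flow t P') \<longrightarrow> roof.synchronized t\<^sub>0 Q \<kappa> \<epsilon> N P P')"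
      proof (rule exI[of _ \<kappa>'], intro conjI allI)
        show "\<kappa>' > 0" using g\<^sub>0 \<kappa> R_pos K by (simp add: \<kappa>'_def)
        fix N :: nat
        define len where "len s = g\<^sub>0 * \<kappa> / (2 * R) * real (q s)" for s
        have ev_gt: "\<forall>\<^sub>F s in sequentially. b < r * real (q s)" if "r > 0" for b r
          by (rule filterlim_at_top_dense[THEN iffD1, rule_format])
            (rule filterlim_tendsto_pos_mult_at_top[OF tendsto_const that filterlim_q])
        have ev_strip: "\<forall>\<^sub>F n in sequentially. measure roof.\<mu> (roof.strip (\<Union>s\<in>{n..}. weak_visit s)) < e / 8"
          by (rule order_tendstoD(2)[OF measure_strip_weak_visit]) (use e in simp)
        have r: "g\<^sub>0 * \<kappa> / (2 * R) > 0" "g\<^sub>0 / 32 > 0" "1 / 32 > (0::real)" "\<kappa> / (2 * R) > 0"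
          using g\<^sub>0 \<kappa> R_pos by auto
        define large where "large s \<longleftrightarrow> 6 * t\<^sub>0 + 2 * real N * t\<^sub>0 < len s \<and>
          real N * t\<^sub>0 + K < g\<^sub>0 / 32 * real (q s) \<and> real n\<^sub>g + 1 < 1 / 32 * real (q s) \<and>
          real n\<^sub>g < \<kappa> / (2 * R) * real (q s)" for s
        have "\<forall>\<^sub>F s in sequentially. large s"
          unfolding large_def len_def
          by (intro eventually_conj ev_gt[OF r(1)] ev_gt[OF r(2)] ev_gt[OF r(3)] ev_gt[OF r(4)])
        then have "\<forall>\<^sub>F s\<^sub>0 in sequentially. measure roof.\<mu> (roof.strip (\<Union>s\<in>{s\<^sub>0..}. weak_visit s)) < e / 8 \<and>
          (\<forall>s\<ge>s\<^sub>0. large s \<and> (\<forall>x y b. admissible s x y b \<longrightarrow> slow_window \<kappa> (\<rho> * \<kappa>) Q s x y b))"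
          using window\<kappa> ev_strip by (intro eventually_conj eventually_all_ge_at_top)
        then obtain s\<^sub>0 where s\<^sub>0: "measure roof.\<mu> (roof.strip (\<Union>s\<in>{s\<^sub>0..}. weak_visit s)) < e / 8"
          and scale: "\<And>s. s \<ge> s\<^sub>0 \<Longrightarrow> large s"
            "\<And>s x y b. s \<ge> s\<^sub>0 \<Longrightarrow> admissible s x y b \<Longrightarrow> slow_window \<kappa> \<epsilon>' Q s x y b"
          unfolding eventually_sequentially \<epsilon>'_def by blast
        define \<delta> where "\<delta> = min (1 / H s\<^sub>0) (min \<epsilon>' (e / 4))"
        have \<delta>: "0 < \<delta>" "\<delta> \<le> 1 / H s\<^sub>0" "\<delta> \<le> \<epsilon>'" "\<delta> \<le> e / 4"
          using H_pos[of s\<^sub>0] \<epsilon>' e by (auto simp: \<delta>_def)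
        define V where "V = roof.strip (roof.steep \<alpha> K) \<union> roof.strip (roof.steep (- \<alpha>) K) \<union>
          roof.strip (\<Union>s\<in>{s\<^sub>0..}. weak_visit s) \<union> roof.often_near_ends t\<^sub>0 (2 * \<epsilon>') \<theta> \<union>
          roof.often_near_ends (- t\<^sub>0) (2 * \<epsilon>') \<theta>"
        have V_sets: "roof.strip (roof.steep \<beta> K) \<in> sets roof.\<mu>" "roof.strip (\<Union>s\<in>{s\<^sub>0..}. weak_visit s) \<in> sets roof.\<mu>"
          "roof.often_near_ends t (2 * \<epsilon>') \<theta> \<in> sets roof.\<mu>" for \<beta> t
        proof -
          show "roof.strip (roof.steep \<beta> K) \<in> sets roof.\<mu>" using K by (intro roof.strip_sets roof.steep_sets) simp
          show "roof.strip (\<Union>s\<in>{s\<^sub>0..}. weak_visit s) \<in> sets roof.\<mu>"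
            by (intro roof.strip_sets sets.countable_UN'' weak_visit_sets) auto
          show "roof.often_near_ends t (2 * \<epsilon>') \<theta> \<in> sets roof.\<mu>" using \<epsilon>' \<theta> by (intro roof.often_near_ends(1)) auto
        qed
        have V: "V \<in> sets roof.\<mu>" unfolding V_def using V_sets by (intro sets.Un)
        have "measure roof.\<mu> V \<le> measure roof.\<mu> (roof.strip (roof.steep \<alpha> K)) + measure roof.\<mu> (roof.strip (roof.steep (- \<alpha>) K)) +
            measure roof.\<mu> (roof.strip (\<Union>s\<in>{s\<^sub>0..}. weak_visit s)) + measure roof.\<mu> (roof.often_near_ends t\<^sub>0 (2 * \<epsilon>') \<theta>) +
            measure roof.\<mu> (roof.often_near_ends (- t\<^sub>0) (2 * \<epsilon>') \<theta>)"
          unfolding V_def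
          by (intro order_trans[OF measure_Un_le] add_right_mono sets.Un V_sets) simp
        then have V_small: "measure roof.\<mu> V < e"
          using n\<^sub>1 s\<^sub>0 often[of t\<^sub>0] often[of "- t\<^sub>0"] e unfolding K_def by linarith
        show "\<exists>\<delta>>0. \<exists>Z\<in>sets roof.\<mu>. 1 - \<epsilon> < measure roof.\<mu> Z \<and>
          (\<forall>P\<in>Z. \<forall>P'\<in>Z. ?d P P' < \<delta> \<and> (\<nexists>t. P = roof.flow t P') \<longrightarrow> roof.synchronized t\<^sub>0 Q \<kappa>' \<epsilon> N P P')"
        proof (intro exI[of _ \<delta>] conjI \<delta>(1) bexI[of _ "roof.X - V"] ballI impI)
          show "roof.X - V \<in> sets roof.\<mu>" by (rule sets.Diff[OF roof.X_sets_\<mu> V])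
          show "1 - \<epsilon> < measure roof.\<mu> (roof.X - V)"
            using \<mu>.prob_compl[OF V] V_small e(3) by simp
          fix P P' assume P: "P \<in> roof.X - V" "P' \<in> roof.X - V"
            and d: "?d P P' < \<delta> \<and> (\<nexists>t. P = roof.flow t P')"
          obtain x u where xu: "P = (x, u)" by (cases P)
          obtain y w where yw: "P' = (y, w)" by (cases P')
          have X: "(x, u) \<in> roof.X" "(y, w) \<in> roof.X" using P by (auto simp: xu yw)
          have xs: "x \<in> space circle" "y \<in> {0..<1}" using X by (auto simp: roof.mem_X)
          have notV: "x \<notin> roof.steep \<alpha> K" "x \<notin> roof.steep (- \<alpha>) K" "\<And>s. s \<ge> s\<^sub>0 \<Longrightarrow> x \<notin> weak_visit s"
            "(x, u) \<notin> roof.often_near_ends t\<^sub>0 (2 * \<epsilon>') \<theta>" "(x, u) \<notin> roof.often_near_ends (- t\<^sub>0) (2 * \<epsilon>') \<theta>"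
            using P(1) X(1) by (auto simp: xu V_def roof.strip_def)
          have "circle_norm (x - y) + \<bar>u - w\<bar> < \<delta>" using d by (simp add: xu yw special_flow_dist_def circle_dist_def)
          then have near: "circle_norm (x - y) < \<delta>" "\<bar>u - w\<bar> < \<delta>" using circle_norm_nonneg[of "x - y"] by auto
          have "x \<noteq> y" using roof.same_fibre_same_orbit X d by (auto simp: xu yw)
          then have "circle_norm (x - y) \<noteq> 0" using circle_dist_eq_0_iff[of x y] xs by (simp add: circle_dist_def)
          then have \<Delta>: "0 < circle_norm (x - y)" "circle_norm (x - y) < 1 / H s\<^sub>0"
            using circle_norm_nonneg[of "x - y"] near(1) \<delta>(2) by auto
          obtain s where s: "s \<ge> s\<^sub>0" "1 / H (Suc s) < circle_norm (x - y)" "circle_norm (x - y) \<le> 1 / H s"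
            by (rule scale_exists[OF \<Delta>])
          obtain j where j: "circle_norm (x - y) = \<bar>x - y - of_int j\<bar>" by (rule circle_norm_obtain)
          then have yj: "\<bar>(y + of_int j) - x\<bar> = circle_norm (x - y)" by (simp add: abs_minus_commute algebra_simps)
          obtain b where b: "b = 0 \<or> b = - int (q s div 2)" "avoids_strong s x {b..<b + int (q s div 2)}"
            by (rule avoids_strong_switch)
          have "avoids_weak s x {b..<b + int (q s div 2)}"
            by (rule avoids_weak_mono[OF avoids_weak_if_not_visit[OF xs(1) notV(3)[OF s(1)]]])
              (use b(1) in \<open>auto simp: subset_iff\<close>)
          then have "admissible s x (y + of_int j) b" using b s unfolding admissible_def yj by blast
          then have win: "slow_window \<kappa> \<epsilon>' Q s x (y + of_int j) b" by (rule scale(2)[OF s(1)])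
          have lg: "large s" by (rule scale(1)[OF s(1)])
          have "roof.synchronized t\<^sub>0 Q \<kappa>' e N (x, u) (y, w)"
          proof (rule good_times[OF X t\<^sub>0 e(1) notV(1,2) K notV(4,5) win b(1) _ _ g\<^sub>0 len_def[of s]])
            show "circle_norm (x - y) + 2 * \<epsilon>' < e" using near(1) \<delta>(4) \<epsilon>'(2) e(1) by linarith
            show "\<bar>u - w\<bar> \<le> \<epsilon>'" using near(2) \<delta>(3) by linarith
            have "0 \<le> 2 * real N * t\<^sub>0" using t\<^sub>0 by simp
            then show "6 * t\<^sub>0 \<le> len s" "2 * real N * t\<^sub>0 < len s" using lg t\<^sub>0 unfolding large_def by linarith+
            show "2 * \<kappa>' * (2 * K * real (q s)) \<le> len s"
              using R_pos K by (simp add: \<kappa>'_def len_def mult_ac)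
            show "8 * \<theta> * (2 * K * real (q s)) \<le> e * len s"
              using R_pos K by (simp add: \<theta>_def len_def mult_ac)
          qed (use lg \<theta> in \<open>auto simp: large_def\<close>)
          then show "roof.synchronized t\<^sub>0 Q \<kappa>' \<epsilon> N P P'"
            unfolding xu yw by (rule roof.synchronized_mono[OF _ e(3)])
        qed
      qed
    qed
  qed
qed

end

theorem theorem3:
  fixes \<alpha> C D\<^sub>1 D\<^sub>2 :: real and q :: "nat \<Rightarrow> nat"
    and k v :: nat and a A B :: "nat \<Rightarrow> real"
    and f h :: "real \<Rightarrow> real" and g :: "nat \<Rightarrow> real \<Rightarrow> real" and x :: "nat \<Rightarrow> nat \<Rightarrow> real"
  assumes "\<alpha> \<notin> \<rat>" and "best_denominators \<alpha> q" and "bounded_partial_quotients q"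
    and a_circle: "\<And>i. i \<in> {1..k} \<Longrightarrow> a i \<in> {0..<1}" and "inj_on a {1..k}"
    and h: "comparison_function h" "filterlim h at_top (at_right 0)"
    and f_periodic: "\<And>y. f (y + 1) = f y"
    and f_smooth: "C2_on {y. frac y \<notin> a ` {1..k}} f"
    and f_pos: "\<And>y. f y > 0"
    and f_integrable: "integrable circle f"
    and f_type: "\<And>i. i \<in> {1..k} \<Longrightarrow> singularity_of_type f (a i) h (A i) (B i)"
    and E_nonempty: "v < k"
    and E: "\<And>i. i \<in> {v+1..k} \<Longrightarrow> (A i)\<^sup>2 + (B i)\<^sup>2 > 0"
    and F_comparison: "\<And>i. i \<in> {1..v} \<Longrightarrow> comparison_function (g i)"
    and F_type: "\<And>i. i \<in> {1..v} \<Longrightarrow> \<exists>A' B'. singularity_of_type f (a i) (g i) A' B'"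
    and F_right: "\<And>i. i \<in> {1..v} \<Longrightarrow>
          \<exists>l. ((\<lambda>y. \<bar>deriv f y / deriv (g i) (y - a i)\<bar>) \<longlongrightarrow> l) (at_right (a i))"
    and F_left: "\<And>i. i \<in> {1..v} \<Longrightarrow>
          \<exists>l. ((\<lambda>y. \<bar>deriv f y / deriv (g i) (a i - y)\<bar>) \<longlongrightarrow> l) (at_left (a i))"
    and F_small: "\<And>i. i \<in> {1..v} \<Longrightarrow> ((\<lambda>y. g i y / h y) \<longlongrightarrow> 0) (at_right 0)"
    and F_x: "\<And>i s. i \<in> {1..v} \<Longrightarrow> x i s \<in> {0<..<1}"
    and F_x_lower: "\<And>i s. i \<in> {1..v} \<Longrightarrow> x i s > 1 / (real (q s) * h (1 / (2 * real (q s))))"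
    and F_x_limit: "\<And>i. i \<in> {1..v} \<Longrightarrow>
          (\<lambda>s. deriv (g i) (x i s) / deriv h (1 / (2 * real (q s)))) \<longlonglongrightarrow> 0"
    and F_x_summable: "\<And>i. i \<in> {1..v} \<Longrightarrow> summable (\<lambda>s. real (q s) * x i s)"
    and "C > 1" and "badly_approximable \<alpha> q C (a ` {v+1..k})"
    and "D\<^sub>1 > 0" and "D\<^sub>2 > 0"
    and D_deriv: "\<And>s. - deriv h (1 / (C ^ 4 * real (q s))) /
            (real (q s) * h (1 / (2 * real (q s)))) \<in> {D\<^sub>1<..<D\<^sub>2}"
    and D_ratio: "\<And>s. h (1 / (2 * real (q s))) / h (1 / (2 * real (q (Suc s)))) > D\<^sub>1"
  shows "SWR_property (special_flow_measure circle f) (special_flow_dist circle_dist)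
           (special_flow circle (rotation \<alpha>) f)"
proof -
  obtain R :: real where R: "\<And>n. real (q (Suc n)) < R * real (q n)"
    using \<open>bounded_partial_quotients q\<close> by (auto simp: bounded_partial_quotients_def)
  have q_pos: "0 < real (q s)" for s
    using \<open>best_denominators \<alpha> q\<close> strict_mono_less_eq[of q 0 s] by (auto simp: best_denominators_def)
  have "0 < h (1 / (2 * real (q s)))" for s
  proof -
    have "1 \<le> real (q s)" using q_pos[of s] by simp
    then show ?thesis using h(1) by (simp add: comparison_function_def)
  qed
  note h_pos = this
  interpret singular_roof \<alpha> q h R C D\<^sub>1 k v a A B f g x
  proof unfold_locales
    show "D\<^sub>1 * (real (q s) * h (1 / (2 * real (q s)))) \<le> - deriv h (1 / (C ^ 4 * real (q s)))" for s
      using D_deriv[of s] pos_less_divide_eq[OF mult_pos_pos[OF q_pos h_pos, of s s]]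
      by (simp only: greaterThanLessThan_iff less_imp_le)
    show "D\<^sub>1 * h (1 / (2 * real (q (Suc s)))) \<le> h (1 / (2 * real (q s)))" for s
      using D_ratio[of s] h_pos[of "Suc s"] by (auto simp: pos_less_divide_eq)
  qed (rule assms R refl | assumption)+
  show ?thesis by (rule SWR)
qed

end
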